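(* Let $G$ be a locally compact, Hausdorff, étale groupoid with compact unit space. Suppose that $G$ is a-T-menable, has property (T), and that there is an invariant probability measure $\mu$ on $G^{(0)}$. Then $G$ is not large.
   Context: Notation: $r,s$ are the range and source maps, $G^x=r^{-1}(x)$, $G_x=s^{-1}(x)$. Étale means the topology has a basis of open bisections (open sets on which $r$ and $s$ are homeomorphisms onto their images in $G^{(0)}$). Large: for every compact subset $K$ of $G$, the restriction $r|_{G\setminus K}:G\setminus K\to G^{(0)}$ is surjective. Invariant probability measure: a Radon probability measure $\mu$ on $G^{(0)}$ with $\int\sum_{g\in G^x}f(g)\,d\mu(x)=\int\sum_{g\in G_x}f(g)\,d\mu(x)$ for all $f\in C_c(G)$. a-T-menable: there is a continuous, proper function $F:G\to[0,\infty)$ of negative type, i.e. $F(x)=0$ for $x\in G^{(0)}$; $F(g^{-1})=F(g)$ for $g\in G$; and for all $g_1,\dots,g_n\in G$ with the same range and all real $a_1,\dots,a_n$ with $\sum_ja_j=0$ one has $\sum_{i,j}a_ia_jF(g_i^{-1}g_j)\le0$. Property (T): $C_c(G)$ is the convolution $*$-algebra, $(f_1f_2)(g)=\sum_{hk=g}f_1(h)f_2(k)$, $f^*(g)=\overline{f(g^{-1})}$, and $\|f\|_I=\max\{\sup_{x}\sum_{g\in G^x}|f(g)|,\sup_x\sum_{g\in G_x}|f(g)|\}$. A representation $(H,\pi)$ is a unital $*$-homomorphism $\pi:C_c(G)\to\mathcal{B}(H)$, $H$ a complex Hilbert space; write $f\xi=\pi(f)\xi$. Put $\Psi:C_c(G)\to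 C(G^{(0)})$, $\Psi(f)(x)=\sum_{g\in G^x}f(g)$. A vector $\xi$ is constant if $f\xi=\Psi(f)\xi$ for all $f$; $H_\pi$ is the orthogonal complement of the space of constant vectors. $G$ has property (T) if there are a compact $K\subseteq G$ and $c>0$ such that for every representation $(H,\pi)$ of $C_c(G)$ and every $\xi\in H_\pi$ there is $f\in C_c(G)$ supported in $K$ with $\|f\|_I\le1$ and $\|f\xi-\Psi(f)\xi\|\ge c\|\xi\|$. *)

theory Defs
  imports
    "HOL-Analysis.Analysis"
    "HOL-Probability.Probability"
    "HOL-Algebra.Algebraic_Closure_Type"
begin

section \<open>Topological and etale groupoids\<close>

text \<open>
  The elements of a groupoid are all elements of the type \<open>'g\<close>, and its topology is the
  type-class topology.  Multiplication is a total function whose values are meaningful only on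
  composable pairs, i.e. when \<open>src g = rng h\<close>.
\<close>

record 'g groupoid =
  rng :: "'g \<Rightarrow> 'g"
  src :: "'g \<Rightarrow> 'g"
  ginv :: "'g \<Rightarrow> 'g"
  gmult :: "'g \<Rightarrow> 'g \<Rightarrow> 'g"

definition units :: "'g groupoid \<Rightarrow> 'g set" where
  "units G = range (rng G)"

definition composable :: "'g groupoid \<Rightarrow> ('g \<times> 'g) set" where
  "composable G = {(g, h). src G g = rng G h}"

definition rfibre :: "'g groupoid \<Rightarrow> 'g \<Rightarrow> 'g set" where
  "rfibre G x = {g. rng G g = x}"

definition sfibre :: "'g groupoid \<Rightarrow> 'g \<Rightarrow> 'g set" where
  "sfibre G x = {g. src G g = x}"

locale groupoid =
  fixes G :: "'g groupoid"
  assumes rng_rng: "rng G (rng G g) = rng G g"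
    and src_rng: "src G (rng G g) = rng G g"
    and rng_src: "rng G (src G g) = src G g"
    and src_src: "src G (src G g) = src G g"
    and rng_mult: "src G g = rng G h \<Longrightarrow> rng G (gmult G g h) = rng G g"
    and src_mult: "src G g = rng G h \<Longrightarrow> src G (gmult G g h) = src G h"
    and mult_assoc: "src G g = rng G h \<Longrightarrow> src G h = rng G k \<Longrightarrow>
          gmult G (gmult G g h) k = gmult G g (gmult G h k)"
    and rng_mult_left: "gmult G (rng G g) g = g"
    and src_mult_right: "gmult G g (src G g) = g"
    and rng_inv: "rng G (ginv G g) = src G g"
    and src_inv: "src G (ginv G g) = rng G g"
    and mult_inv_right: "gmult G g (ginv G g) = rng G g"
    and mult_inv_left: "gmult G (ginv G g) g = src G g"

locale topological_groupoid = groupoid G for G :: "'g::topological_space groupoid" +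
  assumes continuous_rng: "continuous_on UNIV (rng G)"
    and continuous_src: "continuous_on UNIV (src G)"
    and continuous_inv: "continuous_on UNIV (ginv G)"
    and continuous_mult: "continuous_on (composable G) (\<lambda>(g, h). gmult G g h)"

text \<open>
  The images of an open bisection are required to be open in the unit space, so that \<open>rng\<close> and
  \<open>src\<close> are local homeomorphisms.  Without this, \<open>Psi\<close> below need not take values in the
  continuous functions, and \<open>C_c(G)\<close> need not be closed under convolution.
\<close>

definition open_bisection :: "'g::topological_space groupoid \<Rightarrow> 'g set \<Rightarrow> bool" where
  "open_bisection G U \<longleftrightarrow> open U \<and>
     openin (top_of_set (units G)) (rng G ` U) \<and>
     openin (top_of_set (units G)) (src G ` U) \<and>
     (\<exists>q. homeomorphism U (rng G ` U) (rng G) q) \<and>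
     (\<exists>q. homeomorphism U (src G ` U) (src G) q)"

locale etale_groupoid = topological_groupoid G for G :: "'g::topological_space groupoid" +
  assumes basis_open_bisections: "topological_basis {U. open_bisection G U}"

definition large :: "'g::topological_space groupoid \<Rightarrow> bool" where
  "large G \<longleftrightarrow> (\<forall>K. compact K \<longrightarrow> rng G ` (UNIV - K) = units G)"

section \<open>The convolution algebra\<close>

definition supp :: "('g::topological_space \<Rightarrow> complex) \<Rightarrow> 'g set" where
  "supp f = closure {g. f g \<noteq> 0}"

definition Cc :: "('g::topological_space \<Rightarrow> complex) set" where
  "Cc = {f. continuous_on UNIV f \<and> compact (supp f)}"

text \<open>
  For \<open>f \<in> Cc\<close> over an etale groupoid, all \<open>infsum\<close>s below have only finitely many
  nonzero terms.
\<close>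

definition conv :: "'g groupoid \<Rightarrow> ('g \<Rightarrow> complex) \<Rightarrow> ('g \<Rightarrow> complex) \<Rightarrow> 'g \<Rightarrow> complex" where
  "conv G f1 f2 g = (\<Sum>\<^sub>\<infinity>(h, k)\<in>{(h, k) \<in> composable G. gmult G h k = g}. f1 h * f2 k)"

definition star :: "'g groupoid \<Rightarrow> ('g \<Rightarrow> complex) \<Rightarrow> 'g \<Rightarrow> complex" where
  "star G f g = cnj (f (ginv G g))"

text \<open>The unit of the convolution algebra, for compact unit space.\<close>

definition conv_one :: "'g groupoid \<Rightarrow> 'g \<Rightarrow> complex" where
  "conv_one G g = (if g \<in> units G then 1 else 0)"

definition I_norm :: "'g groupoid \<Rightarrow> ('g \<Rightarrow> complex) \<Rightarrow> real" where
  "I_norm G f = max (SUP x\<in>units G. \<Sum>\<^sub>\<infinity>g\<in>rfibre G x. cmod (f g))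
                    (SUP x\<in>units G. \<Sum>\<^sub>\<infinity>g\<in>sfibre G x. cmod (f g))"

text \<open>
  \<open>Psi G f\<close> is a function on the unit space.  It is extended by zero to all of \<open>G\<close>, which is
  the inclusion of \<open>C(units G)\<close> into \<open>Cc\<close> (the unit space is clopen and compact).
\<close>

definition Psi :: "'g groupoid \<Rightarrow> ('g \<Rightarrow> complex) \<Rightarrow> 'g \<Rightarrow> complex" where
  "Psi G f x = (if x \<in> units G then \<Sum>\<^sub>\<infinity>g\<in>rfibre G x. f g else 0)"

section \<open>Complex Hilbert spaces and representations\<close>

text \<open>
  A complex vector space is a module over the field of complex numbers.  The ring multiplication
  and unit that are part of the \<open>module\<close> record carry no meaning here.  The inner product is
  linear in its first argument.
\<close>

record 'v hilbert = "(complex, 'v) module" +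
  ip :: "'v \<Rightarrow> 'v \<Rightarrow> complex"

definition hnorm :: "'v hilbert \<Rightarrow> 'v \<Rightarrow> real" where
  "hnorm H x = sqrt (Re (ip H x x))"

locale hilbert_space =
  Module.module "ring_of_type_algebra :: complex ring" H for H :: "'v hilbert" (structure) +
  assumes ip_add_left: "\<lbrakk>x \<in> carrier H; y \<in> carrier H; z \<in> carrier H\<rbrakk>
            \<Longrightarrow> ip H (x \<oplus>\<^bsub>H\<^esub> y) z = ip H x z + ip H y z"
    and ip_smult_left: "\<lbrakk>x \<in> carrier H; y \<in> carrier H\<rbrakk>
            \<Longrightarrow> ip H (a \<odot>\<^bsub>H\<^esub> x) y = a * ip H x y"
    and ip_commute: "\<lbrakk>x \<in> carrier H; y \<in> carrier H\<rbrakk> \<Longrightarrow> ip H y x = cnj (ip H x y)"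
    and ip_nonneg: "x \<in> carrier H \<Longrightarrow> 0 \<le> Re (ip H x x)"
    and ip_definite: "\<lbrakk>x \<in> carrier H; ip H x x = 0\<rbrakk> \<Longrightarrow> x = \<zero>\<^bsub>H\<^esub>"
    and complete:
      "\<lbrakk>\<And>n. u n \<in> carrier H;
        \<And>e. 0 < e \<Longrightarrow> \<exists>N. \<forall>m\<ge>N. \<forall>n\<ge>N. hnorm H (u m \<ominus>\<^bsub>H\<^esub> u n) < e\<rbrakk>
       \<Longrightarrow> \<exists>l\<in>carrier H. (\<lambda>n. hnorm H (u n \<ominus>\<^bsub>H\<^esub> l)) \<longlonglongrightarrow> 0"

definition bounded_operator :: "'v hilbert \<Rightarrow> ('v \<Rightarrow> 'v) \<Rightarrow> bool" where
  "bounded_operator H T \<longleftrightarrow>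
     (\<forall>x\<in>carrier H. T x \<in> carrier H) \<and>
     (\<forall>x\<in>carrier H. \<forall>y\<in>carrier H. T (x \<oplus>\<^bsub>H\<^esub> y) = T x \<oplus>\<^bsub>H\<^esub> T y) \<and>
     (\<forall>a. \<forall>x\<in>carrier H. T (a \<odot>\<^bsub>H\<^esub> x) = a \<odot>\<^bsub>H\<^esub> T x) \<and>
     (\<exists>B. \<forall>x\<in>carrier H. hnorm H (T x) \<le> B * hnorm H x)"

locale groupoid_representation = hilbert_space H
  for G :: "'g::topological_space groupoid" and H :: "'v hilbert" (structure)
    and \<pi> :: "('g \<Rightarrow> complex) \<Rightarrow> 'v \<Rightarrow> 'v" +
  assumes rep_bounded: "f \<in> Cc \<Longrightarrow> bounded_operator H (\<pi> f)"
    and rep_add: "\<lbrakk>f1 \<in> Cc; f2 \<in> Cc; \<xi> \<in> carrier H\<rbrakk>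
            \<Longrightarrow> \<pi> (\<lambda>g. f1 g + f2 g) \<xi> = \<pi> f1 \<xi> \<oplus>\<^bsub>H\<^esub> \<pi> f2 \<xi>"
    and rep_smult: "\<lbrakk>f \<in> Cc; \<xi> \<in> carrier H\<rbrakk> \<Longrightarrow> \<pi> (\<lambda>g. a * f g) \<xi> = a \<odot>\<^bsub>H\<^esub> \<pi> f \<xi>"
    and rep_mult: "\<lbrakk>f1 \<in> Cc; f2 \<in> Cc; \<xi> \<in> carrier H\<rbrakk>
            \<Longrightarrow> \<pi> (conv G f1 f2) \<xi> = \<pi> f1 (\<pi> f2 \<xi>)"
    and rep_star: "\<lbrakk>f \<in> Cc; \<xi> \<in> carrier H; \<eta> \<in> carrier H\<rbrakk>
            \<Longrightarrow> ip H (\<pi> (star G f) \<xi>) \<eta> = ip H \<xi> (\<pi> f \<eta>)"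
    and rep_one: "\<xi> \<in> carrier H \<Longrightarrow> \<pi> (conv_one G) \<xi> = \<xi>"

definition constant_vectors ::
    "'g::topological_space groupoid \<Rightarrow> 'v hilbert \<Rightarrow> (('g \<Rightarrow> complex) \<Rightarrow> 'v \<Rightarrow> 'v) \<Rightarrow> 'v set" where
  "constant_vectors G H \<pi> = {\<xi> \<in> carrier H. \<forall>f\<in>Cc. \<pi> f \<xi> = \<pi> (Psi G f) \<xi>}"

definition nonconstant_part ::
    "'g::topological_space groupoid \<Rightarrow> 'v hilbert \<Rightarrow> (('g \<Rightarrow> complex) \<Rightarrow> 'v \<Rightarrow> 'v) \<Rightarrow> 'v set" where
  "nonconstant_part G H \<pi> =
     {\<xi> \<in> carrier H. \<forall>\<eta>\<in>constant_vectors G H \<pi>. ip H \<xi> \<eta> = 0}"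

section \<open>Property (T), a-T-menability, invariant measures\<close>

text \<open>
  HOL cannot quantify over all types inside a formula, so the Hilbert spaces in property (T) are
  those whose underlying set is a subset of the type \<open>('g \<Rightarrow> complex) \<Rightarrow> complex\<close>; the vector
  space structure and the inner product on that subset are arbitrary.  This loses nothing.
  Let \<open>\<xi>\<close> lie in the nonconstant part of an arbitrary representation \<open>(H, \<pi>)\<close>, and let \<open>M\<close> be
  the closure of \<open>{\<pi> f \<xi> | f \<in> Cc}\<close>.  Then \<open>M\<close> is a subrepresentation containing \<open>\<xi>\<close>, and
  \<open>\<xi>\<close> lies in its nonconstant part, because constant vectors of \<open>M\<close> are constant in \<open>H\<close>.  The
  condition on \<open>\<xi>\<close> is the same in \<open>M\<close> as in \<open>H\<close>.  Finally, the linear map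
  sending \<open>\<eta> \<in> M\<close> to the function with value \<open>ip H \<eta> (\<pi> f \<xi>)\<close> at \<open>f \<in> Cc\<close>, and \<open>0\<close>
  elsewhere, is injective and identifies \<open>M\<close> with a Hilbert space on a subset of this type.
  Hence the condition below, with the same \<open>K\<close> and \<open>c\<close>, holds for all Hilbert spaces.
\<close>

definition property_T :: "'g::topological_space groupoid \<Rightarrow> bool" where
  "property_T G \<longleftrightarrow>
     (\<exists>K c. compact K \<and> 0 < c \<and>
       (\<forall>(H :: (('g \<Rightarrow> complex) \<Rightarrow> complex) hilbert) \<pi>. groupoid_representation G H \<pi> \<longrightarrow>
         (\<forall>\<xi>\<in>nonconstant_part G H \<pi>.
           \<exists>f\<in>Cc. supp f \<subseteq> K \<and> I_norm G f \<le> 1 \<and>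
             hnorm H (\<pi> f \<xi> \<ominus>\<^bsub>H\<^esub> \<pi> (Psi G f) \<xi>) \<ge> c * hnorm H \<xi>)))"

definition negative_type :: "'g groupoid \<Rightarrow> ('g \<Rightarrow> real) \<Rightarrow> bool" where
  "negative_type G F \<longleftrightarrow>
     (\<forall>x\<in>units G. F x = 0) \<and>
     (\<forall>g. F (ginv G g) = F g) \<and>
     (\<forall>(n::nat) (\<gamma> :: nat \<Rightarrow> 'g) (a :: nat \<Rightarrow> real).
        (\<forall>i<n. \<forall>j<n. rng G (\<gamma> i) = rng G (\<gamma> j)) \<and> (\<Sum>j<n. a j) = 0 \<longrightarrow>
        (\<Sum>i<n. \<Sum>j<n. a i * a j * F (gmult G (ginv G (\<gamma> i)) (\<gamma> j))) \<le> 0)"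

definition a_T_menable :: "'g::topological_space groupoid \<Rightarrow> bool" where
  "a_T_menable G \<longleftrightarrow>
     (\<exists>F :: 'g \<Rightarrow> real. range F \<subseteq> {0..} \<and> continuous_on UNIV F \<and>
        (\<forall>C\<subseteq>{0..}. compact C \<longrightarrow> compact (F -` C)) \<and> negative_type G F)"

definition radon_probability_on :: "'g::t2_space set \<Rightarrow> 'g measure \<Rightarrow> bool" where
  "radon_probability_on S \<mu> \<longleftrightarrow>
     prob_space \<mu> \<and> sets \<mu> = sets (restrict_space borel S) \<and>
     (\<forall>A\<in>sets \<mu>. emeasure \<mu> A = (SUP K\<in>{K. compact K \<and> K \<subseteq> A}. emeasure \<mu> K))"

definition invariant_probability :: "'g::t2_space groupoid \<Rightarrow> 'g measure \<Rightarrow> bool" where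
  "invariant_probability G \<mu> \<longleftrightarrow>
     radon_probability_on (units G) \<mu> \<and>
     (\<forall>f\<in>Cc. (LINT x|\<mu>. (\<Sum>\<^sub>\<infinity>g\<in>rfibre G x. f g)) = (LINT x|\<mu>. (\<Sum>\<^sub>\<infinity>g\<in>sfibre G x. f g)))"

end

theory Submission
  imports Defs
begin

text \<open>
  Let \<open>F\<close> be a proper function of negative type.  By Schoenberg's theorem \<open>exp (- t * F)\<close> is of
  positive type, and together with \<open>\<mu>\<close> it yields a GNS representation of \<open>Cc\<close>.  The unit vector
  given by \<open>conv_one\<close> is almost constant for small \<open>t\<close>, uniformly over functions supported in a
  given compact set, so property (T) forbids it from lying in the nonconstant part.

  If \<open>G\<close> is large, then all range fibres are infinite, and then \<open>conv_one\<close> is orthogonal to every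
  constant vector \<open>\<eta>\<close>.  Heuristically, put \<open>u(x) = \<langle>\<eta>, conv_one\<rangle>\<close> at the unit \<open>x\<close>.  Constancy
  makes \<open>u (src g)\<close> a matrix coefficient, which decays as \<open>g\<close> leaves compact sets in a fibre.  Hence
  an arrow of \<open>G\<close> joins two points where \<open>u\<close> is large only if it lies in a compact set.  Transport
  the set where \<open>u\<close> is large along spread out probability measures on the infinite fibres: the
  transported density keeps its mass by invariance of \<open>\<mu>\<close>, but its second moment is arbitrarily
  small.  Hence \<open>u = 0\<close> almost everywhere.
\<close>

section \<open>Completion of a semi-inner product space of functions\<close>

text \<open>Property (T) tests only Hilbert spaces carried by subsets of
  \<open>('g => complex) => complex\<close>, so the GNS space has to live inside this type.
  Completing \<open>Cc\<close> to a set of antilinear functionals achieves this, and null vectors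
  disappear without a quotient. The price is that an element of the completion is not a function on
  \<open>G\<close>: the function \<open>u\<close> of the heuristic does not exist. It is replaced by
  \<open>vphi h\<close> for an approximant \<open>h\<close>, whose error is small only in the mean,
  so pointwise estimates need a correction. Invariance of \<open>\<mu>\<close> enters only through
  \<open>I_ginv\<close>. Besides preserving mass, it makes the involution of \<open>Cc\<close> act
  by adjoints. The parameter \<open>t\<close> has two roles. For every positive \<open>t\<close>,
  properness of \<open>F\<close> makes \<open>exp (- t * F)\<close> vanish at infinity, and this
  alone excludes constant vectors. Closeness to 1 on a compact set needs small \<open>t\<close>;
  hence \<open>t\<close> may depend on the compact set and the constant of property (T).\<close>

locale semi_inner_product =
  fixes V :: "('a \<Rightarrow> complex) set" and B :: "('a \<Rightarrow> complex) \<Rightarrow> ('a \<Rightarrow> complex) \<Rightarrow> complex"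
  assumes V_zero: "(\<lambda>_. 0) \<in> V"
    and V_add: "f \<in> V \<Longrightarrow> g \<in> V \<Longrightarrow> (\<lambda>x. f x + g x) \<in> V"
    and V_smult: "f \<in> V \<Longrightarrow> (\<lambda>x. c * f x) \<in> V"
    and B_add: "f \<in> V \<Longrightarrow> g \<in> V \<Longrightarrow> h \<in> V \<Longrightarrow> B (\<lambda>x. f x + g x) h = B f h + B g h"
    and B_smult: "f \<in> V \<Longrightarrow> h \<in> V \<Longrightarrow> B (\<lambda>x. c * f x) h = c * B f h"
    and B_commute: "f \<in> V \<Longrightarrow> g \<in> V \<Longrightarrow> B g f = cnj (B f g)"
    and B_nonneg: "f \<in> V \<Longrightarrow> 0 \<le> Re (B f f)"
begin

section \<open>Cauchy-Schwarz and the triangle inequality for a semidefinite form\<close>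

definition seminorm :: "('a \<Rightarrow> complex) \<Rightarrow> real" where
  "seminorm f = sqrt (Re (B f f))"

lemma V_diff: "f \<in> V \<Longrightarrow> g \<in> V \<Longrightarrow> (\<lambda>x. f x - g x) \<in> V"
  using V_add[of f "\<lambda>x. -1 * g x"] V_smult[of g "-1"] by simp

lemma B_diff: "f \<in> V \<Longrightarrow> g \<in> V \<Longrightarrow> h \<in> V \<Longrightarrow> B (\<lambda>x. f x - g x) h = B f h - B g h"
  using B_add[of f "\<lambda>x. -1 * g x" h] V_smult[of g "-1"] B_smult[of g h "-1"] by simp

lemma B_add_right: "f \<in> V \<Longrightarrow> g \<in> V \<Longrightarrow> h \<in> V \<Longrightarrow> B h (\<lambda>x. f x + g x) = B h f + B h g"
  using B_commute[of "\<lambda>x. f x + g x" h] B_commute[of f h] B_commute[of g h] B_add[of f g h] V_add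
  by simp

lemma B_smult_right: "f \<in> V \<Longrightarrow> h \<in> V \<Longrightarrow> B h (\<lambda>x. c * f x) = cnj c * B h f"
  using B_commute[of "\<lambda>x. c * f x" h] B_commute[of f h] B_smult[of f h c] V_smult
  by simp

lemma B_diff_right: "f \<in> V \<Longrightarrow> g \<in> V \<Longrightarrow> h \<in> V \<Longrightarrow> B h (\<lambda>x. f x - g x) = B h f - B h g"
  using B_add_right[of f "\<lambda>x. -1 * g x" h] V_smult[of g "-1"] B_smult_right[of g h "-1"] by simp

lemma seminorm_nonneg [simp]: "f \<in> V \<Longrightarrow> 0 \<le> seminorm f"
  by (simp add: seminorm_def B_nonneg)

lemma seminorm_sq: "f \<in> V \<Longrightarrow> (seminorm f)\<^sup>2 = Re (B f f)"
  by (simp add: seminorm_def B_nonneg)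

lemma B_self: "f \<in> V \<Longrightarrow> B f f = of_real ((seminorm f)\<^sup>2)"
  using B_commute[of f f] by (auto simp: seminorm_sq complex_eq_iff)

text \<open>Nonnegativity of \<open>B\<close> at \<open>f - c * g\<close>, expanded. The scalar
  stays free because Cauchy-Schwarz chooses it differently according to whether
  \<open>seminorm g\<close> vanishes.\<close>

lemma Re_B_le: "f \<in> V \<Longrightarrow> g \<in> V \<Longrightarrow> 0 \<le> (seminorm f)\<^sup>2 - 2 * Re (cnj c * B f g) + (cmod c)\<^sup>2 * (seminorm g)\<^sup>2"
proof -
  assume fg: "f \<in> V" "g \<in> V"
  let ?d = "\<lambda>x. f x - c * g x"
  have cg: "(\<lambda>x. c * g x) \<in> V" using fg V_smult by blast
  have d: "?d \<in> V" using V_diff[OF fg(1) cg] .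
  have "B ?d ?d = B f f - cnj c * B f g - c * (B g f - cnj c * B g g)"
    using fg cg d by (simp add: B_diff B_diff_right B_smult B_smult_right algebra_simps)
  moreover have "B g f = cnj (B f g)" using fg B_commute by blast
  moreover have "c * cnj c = of_real ((cmod c)\<^sup>2)"
    by (rule complex_norm_square[symmetric])
  ultimately have "B ?d ?d = of_real ((seminorm f)\<^sup>2) - (cnj c * B f g + cnj (cnj c * B f g))
      + of_real ((cmod c)\<^sup>2) * of_real ((seminorm g)\<^sup>2)"
    using fg by (simp add: B_self algebra_simps)
  then have "Re (B ?d ?d) = (seminorm f)\<^sup>2 - 2 * Re (cnj c * B f g) + (cmod c)\<^sup>2 * (seminorm g)\<^sup>2"
    by (simp add: complex_add_cnj flip: of_real_mult of_real_power)
  then show ?thesis using B_nonneg[OF d] by simp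
qed

lemma Cauchy_Schwarz: assumes "f \<in> V" "g \<in> V" shows "cmod (B f g) \<le> seminorm f * seminorm g"
proof (cases "seminorm g = 0")
  case True
  have "B f g = 0"
  proof (rule ccontr)
    assume nz: "B f g \<noteq> 0"
    \<comment> \<open>At \<open>c = t * B f g\<close> this value turns the right-hand side of
      \<open>Re_B_le\<close> into -1. The quadratic term cannot compensate, since
      \<open>seminorm g = 0\<close>.\<close>
    define t where "t = ((seminorm f)\<^sup>2 + 1) / (2 * (cmod (B f g))\<^sup>2)"
    have "cnj (of_real t * B f g) * B f g = of_real t * (B f g * cnj (B f g))"
      by (simp add: ac_simps)
    also have "\<dots> = of_real (t * (cmod (B f g))\<^sup>2)"
      by (simp flip: complex_norm_square)
    finally have "cnj (of_real t * B f g) * B f g = of_real (t * (cmod (B f g))\<^sup>2)" .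
    then have "Re (cnj (of_real t * B f g) * B f g) = t * (cmod (B f g))\<^sup>2"
      by (metis Re_complex_of_real)
    then have "0 \<le> (seminorm f)\<^sup>2 - 2 * (t * (cmod (B f g))\<^sup>2)"
      using Re_B_le[OF assms, of "of_real t * B f g"] True by simp
    then show False using nz by (simp add: t_def field_simps)
  qed
  then show ?thesis using assms by simp
next
  case False
  let ?s = "(seminorm g)\<^sup>2"
  have s: "?s > 0" using False by simp
  \<comment> \<open>The coefficient of the orthogonal projection of \<open>f\<close> onto
    \<open>g\<close>, where the quadratic expression is minimal.\<close>
  define c where "c = B f g / of_real ?s"
  have "cnj c * B f g = (B f g * cnj (B f g)) / of_real ?s"
    by (simp add: c_def ac_simps)
  also have "\<dots> = of_real ((cmod (B f g))\<^sup>2 / ?s)"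
    by (simp flip: complex_norm_square)
  finally have "cnj c * B f g = of_real ((cmod (B f g))\<^sup>2 / ?s)" .
  then have 1: "Re (cnj c * B f g) = (cmod (B f g))\<^sup>2 / ?s"
    by (metis Re_complex_of_real)
  have "cmod c = cmod (B f g) / ?s" by (simp add: c_def norm_divide norm_power)
  then have 2: "(cmod c)\<^sup>2 * ?s = (cmod (B f g))\<^sup>2 / ?s"
    using s by (simp add: power2_eq_square field_simps)
  have "0 \<le> (seminorm f)\<^sup>2 - (cmod (B f g))\<^sup>2 / ?s"
    using Re_B_le[OF assms, of c] 1 2 by simp
  then have "(cmod (B f g))\<^sup>2 \<le> (seminorm f * seminorm g)\<^sup>2"
    using s by (simp add: field_simps power_mult_distrib)
  then show ?thesis using assms by (simp add: power2_le_iff_abs_le)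
qed

lemma seminorm_add: assumes "f \<in> V" "g \<in> V" shows "seminorm (\<lambda>x. f x + g x) \<le> seminorm f + seminorm g"
proof -
  have "(seminorm (\<lambda>x. f x + g x))\<^sup>2 = (seminorm f)\<^sup>2 + 2 * Re (B f g) + (seminorm g)\<^sup>2"
    using assms V_add[OF assms] B_commute[OF assms]
    by (simp add: seminorm_sq B_add B_add_right)
  also have "\<dots> \<le> (seminorm f + seminorm g)\<^sup>2"
    using Cauchy_Schwarz[OF assms] complex_Re_le_cmod[of "B f g"] by (simp add: power2_sum)
  finally show ?thesis using assms by (auto intro: power2_le_imp_le)
qed

text \<open>\<open>B (u n)\<close> tends to \<open>L\<close> in the dual norm of
  \<open>seminorm\<close>. The rate is uniform in \<open>f\<close>, so \<open>f\<close> may vary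
  with \<open>n\<close> in the limits below. Nothing forces \<open>e n\<close> to be nonnegative
  when \<open>seminorm\<close> vanishes identically, hence the absolute values later on.\<close>

definition approx :: "(('a \<Rightarrow> complex) \<Rightarrow> complex) \<Rightarrow> (nat \<Rightarrow> 'a \<Rightarrow> complex) \<Rightarrow> bool" where
  "approx L u \<longleftrightarrow> (\<forall>n. u n \<in> V) \<and>
     (\<exists>e. e \<longlonglongrightarrow> 0 \<and> (\<forall>n. \<forall>f\<in>V. cmod (L f - B (u n) f) \<le> e n * seminorm f))"

text \<open>The completion: an element is identified with the antilinear functional it defines on \<open>V\<close>.\<close>

definition completion :: "(('a \<Rightarrow> complex) \<Rightarrow> complex) set" where
  "completion = {L. (\<forall>f. f \<notin> V \<longrightarrow> L f = 0) \<and>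
     (\<forall>\<epsilon>>0. \<exists>a\<in>V. \<forall>f\<in>V. cmod (L f - B a f) \<le> \<epsilon> * seminorm f)}"

lemma approx_exists: assumes "L \<in> completion" shows "\<exists>u. approx L u"
proof -
  have "\<exists>a\<in>V. \<forall>f\<in>V. cmod (L f - B a f) \<le> inverse (real (Suc n)) * seminorm f" for n
    using assms by (auto simp: completion_def)
  then obtain u where "\<And>n. u n \<in> V"
    "\<And>n f. f \<in> V \<Longrightarrow> cmod (L f - B (u n) f) \<le> inverse (real (Suc n)) * seminorm f"
    by metis
  then have "approx L u"
    unfolding approx_def using LIMSEQ_inverse_real_of_nat by blast
  then show ?thesis by blast
qed

lemma completionI:
  assumes "\<And>f. f \<notin> V \<Longrightarrow> L f = 0" "approx L u"
  shows "L \<in> completion"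
proof -
  obtain e where e: "e \<longlonglongrightarrow> 0" "\<And>n f. f \<in> V \<Longrightarrow> cmod (L f - B (u n) f) \<le> e n * seminorm f"
    and u: "\<And>n. u n \<in> V"
    using assms(2) by (auto simp: approx_def)
  have "\<exists>a\<in>V. \<forall>f\<in>V. cmod (L f - B a f) \<le> \<epsilon> * seminorm f" if eps: "\<epsilon> > 0" for \<epsilon>
  proof -
    have "\<exists>n. e n < \<epsilon>"
      using order_tendstoD(2)[OF e(1) eps] by (auto simp: eventually_sequentially)
    then obtain n where "e n < \<epsilon>" by blast
    then have "e n * seminorm f \<le> \<epsilon> * seminorm f" if "f \<in> V" for f
      using that by (intro mult_right_mono) auto
    then show ?thesis using e(2) u by (meson order_trans)
  qed
  then show ?thesis using assms(1) by (auto simp: completion_def)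
qed

lemma approx_tendsto:
  assumes "approx L u" "f \<in> V" shows "(\<lambda>n. B (u n) f) \<longlonglongrightarrow> L f"
proof -
  obtain e where e: "e \<longlonglongrightarrow> 0" "\<And>n f. f \<in> V \<Longrightarrow> cmod (L f - B (u n) f) \<le> e n * seminorm f"
    using assms(1) by (auto simp: approx_def)
  have "(\<lambda>n. B (u n) f - L f) \<longlonglongrightarrow> 0"
  proof (rule Lim_null_comparison)
    show "\<forall>\<^sub>F n in sequentially. cmod (B (u n) f - L f) \<le> e n * seminorm f"
      using e(2)[OF assms(2)] by (simp add: norm_minus_commute)
    show "(\<lambda>n. e n * seminorm f) \<longlonglongrightarrow> 0" using tendsto_mult_right[OF e(1), of "seminorm f"] by simp
  qed
  then show ?thesis by (simp add: LIM_zero_iff)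
qed

text \<open>Linearity is not demanded in \<open>completion\<close>; it is inherited from the
  functionals \<open>B (u n)\<close> in the pointwise limit.\<close>

lemma approx_diff:
  assumes "approx L u" "f \<in> V" "g \<in> V" shows "L (\<lambda>x. f x - g x) = L f - L g"
proof (rule LIMSEQ_unique)
  show "(\<lambda>n. B (u n) (\<lambda>x. f x - g x)) \<longlonglongrightarrow> L (\<lambda>x. f x - g x)"
    by (rule approx_tendsto[OF assms(1) V_diff[OF assms(2,3)]])
  have "(\<lambda>n. B (u n) f - B (u n) g) \<longlonglongrightarrow> L f - L g"
    by (intro tendsto_diff approx_tendsto assms)
  then show "(\<lambda>n. B (u n) (\<lambda>x. f x - g x)) \<longlonglongrightarrow> L f - L g"
    using assms by (simp add: B_diff_right approx_def)
qed

lemma approx_bounded: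
  assumes "approx L u" obtains C where "C \<ge> 0" "\<And>f. f \<in> V \<Longrightarrow> cmod (L f) \<le> C * seminorm f"
proof -
  obtain e where e: "\<And>n f. f \<in> V \<Longrightarrow> cmod (L f - B (u n) f) \<le> e n * seminorm f"
    and u: "\<And>n. u n \<in> V"
    using assms(1) by (auto simp: approx_def)
  have "cmod (L f) \<le> (\<bar>e 0\<bar> + seminorm (u 0)) * seminorm f" if f: "f \<in> V" for f
  proof -
    have "cmod (L f) \<le> cmod (L f - B (u 0) f) + cmod (B (u 0) f)"
      using norm_triangle_ineq[of "L f - B (u 0) f" "B (u 0) f"] by simp
    also have "\<dots> \<le> e 0 * seminorm f + seminorm (u 0) * seminorm f"
      using e[OF f, of 0] Cauchy_Schwarz[OF u f, of 0] by linarith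
    also have "e 0 * seminorm f \<le> \<bar>e 0\<bar> * seminorm f" using f by (intro mult_right_mono) auto
    finally show ?thesis by (simp add: algebra_simps)
  qed
  then show ?thesis using that[of "\<bar>e 0\<bar> + seminorm (u 0)"] u by simp
qed

text \<open>Both estimates are tested on \<open>d = a - b\<close> itself, because
  \<open>B d d\<close> is the difference of the two errors at \<open>d\<close>. Besides the
  independence of limits from choices, this serves to compare two approximants of one
  functional.\<close>

lemma seminorm_diff_le:
  assumes "a \<in> V" "b \<in> V" "\<And>f. f \<in> V \<Longrightarrow> cmod (M f - B a f) \<le> e * seminorm f"
    "\<And>f. f \<in> V \<Longrightarrow> cmod (M f - B b f) \<le> e' * seminorm f"
  shows "seminorm (\<lambda>x. a x - b x) \<le> \<bar>e\<bar> + \<bar>e'\<bar>"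
proof -
  let ?d = "\<lambda>x. a x - b x"
  have d: "?d \<in> V" using assms V_diff by blast
  have "(seminorm ?d)\<^sup>2 = cmod (B ?d ?d)" using d by (simp add: B_self norm_power)
  also have "B ?d ?d = (M ?d - B b ?d) - (M ?d - B a ?d)" using assms d by (simp add: B_diff)
  also have "cmod \<dots> \<le> e' * seminorm ?d + e * seminorm ?d"
    using assms(3)[OF d] assms(4)[OF d]
      norm_triangle_ineq4[of "(M ?d - B b ?d)" "(M ?d - B a ?d)"] by linarith
  also have "\<dots> \<le> (\<bar>e\<bar> + \<bar>e'\<bar>) * seminorm ?d"
    using d by (simp add: algebra_simps add_mono mult_right_mono)
  finally have "seminorm ?d * seminorm ?d \<le> (\<bar>e\<bar> + \<bar>e'\<bar>) * seminorm ?d" by (simp add: power2_eq_square)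
  then show ?thesis using seminorm_nonneg[OF d] by (cases "seminorm ?d = 0") auto
qed

text \<open>Sequences that approximate the same \<open>M\<close> approach each other in
  \<open>seminorm\<close>, and \<open>L\<close> is bounded. This makes the choice in
  \<open>ip_lim\<close> harmless.\<close>

lemma approx_cross:
  assumes "approx L u" "approx M v" "approx M v'"
  shows "(\<lambda>n. L (v n) - L (v' n)) \<longlonglongrightarrow> 0"
proof -
  obtain C where C: "C \<ge> 0" "\<And>f. f \<in> V \<Longrightarrow> cmod (L f) \<le> C * seminorm f"
    using approx_bounded[OF assms(1)] by blast
  obtain e where e: "e \<longlonglongrightarrow> 0" "\<And>n f. f \<in> V \<Longrightarrow> cmod (M f - B (v n) f) \<le> e n * seminorm f"
    and v: "\<And>n. v n \<in> V"
    using assms(2) by (auto simp: approx_def)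
  obtain e' where e': "e' \<longlonglongrightarrow> 0" "\<And>n f. f \<in> V \<Longrightarrow> cmod (M f - B (v' n) f) \<le> e' n * seminorm f"
    and v': "\<And>n. v' n \<in> V"
    using assms(3) by (auto simp: approx_def)
  have le: "cmod (L (v n) - L (v' n)) \<le> C * (\<bar>e n\<bar> + \<bar>e' n\<bar>)" for n
  proof -
    have "L (v n) - L (v' n) = L (\<lambda>x. v n x - v' n x)"
      using approx_diff[OF assms(1) v v'] by simp
    also have "cmod \<dots> \<le> C * seminorm (\<lambda>x. v n x - v' n x)"
      using C v v' V_diff by blast
    also have "\<dots> \<le> C * (\<bar>e n\<bar> + \<bar>e' n\<bar>)"
      using C seminorm_diff_le[OF v v' e(2) e'(2)] by (intro mult_left_mono) auto
    finally show ?thesis .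
  qed
  have "(\<lambda>n. C * (\<bar>e n\<bar> + \<bar>e' n\<bar>)) \<longlonglongrightarrow> 0"
    using e(1) e'(1) by (auto intro!: tendsto_eq_intros)
  then show ?thesis by (rule Lim_null_comparison[OF eventuallyI[OF le]])
qed

lemma approx_convergent:
  assumes "approx L u" "approx M v"
  shows "convergent (\<lambda>n. L (v n))"
proof -
  obtain C where C: "C \<ge> 0" "\<And>f. f \<in> V \<Longrightarrow> cmod (L f) \<le> C * seminorm f"
    using approx_bounded[OF assms(1)] by blast
  obtain e where e: "e \<longlonglongrightarrow> 0" "\<And>n f. f \<in> V \<Longrightarrow> cmod (M f - B (v n) f) \<le> e n * seminorm f"
    and v: "\<And>n. v n \<in> V"
    using assms(2) by (auto simp: approx_def)
  have le: "cmod (L (v m) - L (v n)) \<le> C * (\<bar>e m\<bar> + \<bar>e n\<bar>)" for m n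
  proof -
    have "L (v m) - L (v n) = L (\<lambda>x. v m x - v n x)"
      using approx_diff[OF assms(1) v v] by simp
    also have "cmod \<dots> \<le> C * seminorm (\<lambda>x. v m x - v n x)"
      using C v V_diff by blast
    also have "\<dots> \<le> C * (\<bar>e m\<bar> + \<bar>e n\<bar>)"
      using C seminorm_diff_le[OF v v e(2) e(2)] by (intro mult_left_mono) auto
    finally show ?thesis .
  qed
  have "Cauchy (\<lambda>n. L (v n))"
  proof (rule CauchyI)
    fix r :: real assume r: "0 < r"
    have "r / (2 * (C + 1)) > 0" using r C by simp
    then obtain N where N: "\<And>n. n \<ge> N \<Longrightarrow> \<bar>e n\<bar> < r / (2 * (C + 1))"
      using LIMSEQ_D[OF e(1)] by fastforce
    have "cmod (L (v m) - L (v n)) < r" if "m \<ge> N" "n \<ge> N" for m n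
    proof -
      have "cmod (L (v m) - L (v n)) \<le> C * (\<bar>e m\<bar> + \<bar>e n\<bar>)" by (rule le)
      also have "\<dots> \<le> C * (r / (C + 1))"
        using N[OF that(1)] N[OF that(2)] C by (intro mult_left_mono) (auto simp: field_simps)
      also have "\<dots> < r" using r C by (simp add: field_simps)
      finally show ?thesis .
    qed
    then show "\<exists>M. \<forall>m\<ge>M. \<forall>n\<ge>M. norm (L (v m) - L (v n)) < r" by blast
  qed
  then show ?thesis by (simp add: Cauchy_convergent_iff)
qed

text \<open>Since \<open>L f\<close> plays the role of the inner product of \<open>L\<close> with
  \<open>f\<close>, the inner product with \<open>M\<close> has to be the limit of \<open>L\<close>
  along a sequence that approximates \<open>M\<close>.\<close>

definition ip_lim :: "(('a \<Rightarrow> complex) \<Rightarrow> complex) \<Rightarrow> (('a \<Rightarrow> complex) \<Rightarrow> complex) \<Rightarrow> complex" where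
  "ip_lim L M = lim (\<lambda>n. L ((SOME v. approx M v) n))"

lemma ip_lim_tendsto:
  assumes "approx L u" "approx M v" shows "(\<lambda>n. L (v n)) \<longlonglongrightarrow> ip_lim L M"
proof -
  let ?w = "SOME v. approx M v"
  have w: "approx M ?w" using assms(2) by (rule someI[of "approx M"])
  have "(\<lambda>n. L (?w n)) \<longlonglongrightarrow> ip_lim L M"
    using approx_convergent[OF assms(1) w] by (simp add: ip_lim_def convergent_LIMSEQ_iff)
  from tendsto_add[OF this approx_cross[OF assms(1) assms(2) w]] show ?thesis by simp
qed

text \<open>Approximating both arguments gives a description symmetric in \<open>L\<close> and
  \<open>M\<close>, from which conjugate symmetry and positivity pass to the limit.\<close>

lemma B_tendsto:
  assumes "approx L u" "approx M v" shows "(\<lambda>n. B (u n) (v n)) \<longlonglongrightarrow> ip_lim L M"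
proof -
  obtain C where C: "C \<ge> 0" "\<And>f. f \<in> V \<Longrightarrow> cmod (M f) \<le> C * seminorm f"
    using approx_bounded[OF assms(2)] by blast
  obtain e where e: "e \<longlonglongrightarrow> 0" "\<And>n f. f \<in> V \<Longrightarrow> cmod (L f - B (u n) f) \<le> e n * seminorm f"
    and u: "\<And>n. u n \<in> V"
    using assms(1) by (auto simp: approx_def)
  obtain e' where e': "e' \<longlonglongrightarrow> 0" "\<And>n f. f \<in> V \<Longrightarrow> cmod (M f - B (v n) f) \<le> e' n * seminorm f"
    and v: "\<And>n. v n \<in> V"
    using assms(2) by (auto simp: approx_def)
  have b: "seminorm (v n) \<le> C + \<bar>e' n\<bar>" for n
  proof -
    have "(seminorm (v n))\<^sup>2 = cmod (M (v n) - (M (v n) - B (v n) (v n)))"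
      using v by (simp add: B_self norm_power)
    also have "\<dots> \<le> C * seminorm (v n) + e' n * seminorm (v n)"
      using C(2)[OF v, of n] e'(2)[OF v, of n n]
        norm_triangle_ineq4[of "M (v n)" "M (v n) - B (v n) (v n)"] by linarith
    also have "\<dots> \<le> (C + \<bar>e' n\<bar>) * seminorm (v n)"
      using v by (simp add: algebra_simps mult_right_mono)
    finally have "seminorm (v n) * seminorm (v n) \<le> (C + \<bar>e' n\<bar>) * seminorm (v n)" by (simp add: power2_eq_square)
    then show ?thesis using seminorm_nonneg[OF v, of n] C(1)
      by (cases "seminorm (v n) = 0") (auto simp: mult_le_cancel_right)
  qed
  have le: "cmod (L (v n) - B (u n) (v n)) \<le> \<bar>e n\<bar> * (C + \<bar>e' n\<bar>)" for n
  proof -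
    have "cmod (L (v n) - B (u n) (v n)) \<le> \<bar>e n\<bar> * seminorm (v n)"
      using e(2)[OF v, of n n] mult_right_mono[OF abs_ge_self seminorm_nonneg[OF v], of "e n" n] by linarith
    also have "\<dots> \<le> \<bar>e n\<bar> * (C + \<bar>e' n\<bar>)" using b by (intro mult_left_mono) auto
    finally show ?thesis .
  qed
  have "(\<lambda>n. \<bar>e n\<bar> * (C + \<bar>e' n\<bar>)) \<longlonglongrightarrow> 0"
    using e(1) e'(1) by (auto intro!: tendsto_eq_intros)
  then have "(\<lambda>n. L (v n) - B (u n) (v n)) \<longlonglongrightarrow> 0"
    by (rule Lim_null_comparison[OF eventuallyI[OF le]])
  from tendsto_diff[OF ip_lim_tendsto[OF assms] this] show ?thesis by simp
qed

section \<open>Vector space operations on the completion\<close>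

lemma approx_add:
  assumes "approx L u" "approx M v"
  shows "approx (\<lambda>f. L f + M f) (\<lambda>n x. u n x + v n x)"
proof -
  obtain e where e: "e \<longlonglongrightarrow> 0" "\<And>n f. f \<in> V \<Longrightarrow> cmod (L f - B (u n) f) \<le> e n * seminorm f"
    and u: "\<And>n. u n \<in> V"
    using assms(1) by (auto simp: approx_def)
  obtain e' where e': "e' \<longlonglongrightarrow> 0" "\<And>n f. f \<in> V \<Longrightarrow> cmod (M f - B (v n) f) \<le> e' n * seminorm f"
    and v: "\<And>n. v n \<in> V"
    using assms(2) by (auto simp: approx_def)
  have "cmod ((L f + M f) - B (\<lambda>x. u n x + v n x) f) \<le> (e n + e' n) * seminorm f" if "f \<in> V" for n f
  proof -
    have "(L f + M f) - B (\<lambda>x. u n x + v n x) f = (L f - B (u n) f) + (M f - B (v n) f)"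
      using u v that by (simp add: B_add)
    then show ?thesis
      using e(2)[OF that, of n] e'(2)[OF that, of n]
        norm_triangle_ineq[of "L f - B (u n) f" "M f - B (v n) f"] by (simp add: algebra_simps)
  qed
  moreover have "(\<lambda>n. e n + e' n) \<longlonglongrightarrow> 0" using tendsto_add[OF e(1) e'(1)] by simp
  moreover have "\<forall>n. (\<lambda>x. u n x + v n x) \<in> V" using u v V_add by blast
  ultimately show ?thesis unfolding approx_def by blast
qed

lemma approx_smult:
  assumes "approx L u"
  shows "approx (\<lambda>f. c * L f) (\<lambda>n x. c * u n x)"
proof -
  obtain e where e: "e \<longlonglongrightarrow> 0" "\<And>n f. f \<in> V \<Longrightarrow> cmod (L f - B (u n) f) \<le> e n * seminorm f"
    and u: "\<And>n. u n \<in> V"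
    using assms(1) by (auto simp: approx_def)
  have "cmod (c * L f - B (\<lambda>x. c * u n x) f) \<le> (cmod c * e n) * seminorm f" if "f \<in> V" for n f
  proof -
    have "c * L f - B (\<lambda>x. c * u n x) f = c * (L f - B (u n) f)"
      using u that by (simp add: B_smult algebra_simps)
    then show ?thesis
      using mult_left_mono[OF e(2)[OF that, of n], of "cmod c"] by (simp add: norm_mult mult.assoc)
  qed
  moreover have "(\<lambda>n. cmod c * e n) \<longlonglongrightarrow> 0" using tendsto_mult_left[OF e(1), of "cmod c"] by simp
  moreover have "\<forall>n. (\<lambda>x. c * u n x) \<in> V" using u V_smult by blast
  ultimately show ?thesis unfolding approx_def by blast
qed

lemma approx_zero: "approx (\<lambda>_. 0) (\<lambda>_ _. 0)"
  using V_zero B_smult[OF V_zero, where c = 0]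
  by (auto simp: approx_def intro!: exI[of _ "\<lambda>_. 0"])

text \<open>The canonical map into the completion. By Cauchy-Schwarz it sends null vectors to the
  zero functional. The value 0 outside \<open>V\<close> is the normalisation of
  \<open>completion\<close>, under which functionals agreeing on \<open>V\<close> are equal.\<close>

definition embed :: "('a \<Rightarrow> complex) \<Rightarrow> ('a \<Rightarrow> complex) \<Rightarrow> complex" where
  "embed a f = (if f \<in> V then B a f else 0)"

lemma approx_embed: "a \<in> V \<Longrightarrow> approx (embed a) (\<lambda>_. a)"
  by (auto simp: approx_def embed_def intro!: exI[of _ "\<lambda>_. 0"])

lemma embed_in: "a \<in> V \<Longrightarrow> embed a \<in> completion"
  by (rule completionI[OF _ approx_embed]) (auto simp: embed_def)

lemma add_in:
  assumes "L \<in> completion" "M \<in> completion" shows "(\<lambda>f. L f + M f) \<in> completion"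
proof -
  obtain u v where "approx L u" "approx M v" using approx_exists assms by metis
  then show ?thesis
    using assms by (intro completionI[OF _ approx_add]) (auto simp: completion_def)
qed

lemma smult_in: "L \<in> completion \<Longrightarrow> (\<lambda>f. c * L f) \<in> completion"
proof -
  assume L: "L \<in> completion"
  then obtain u where "approx L u" using approx_exists by blast
  then show ?thesis
    using L by (intro completionI[OF _ approx_smult]) (auto simp: completion_def)
qed

lemma zero_in: "(\<lambda>_. 0) \<in> completion"
  by (rule completionI[OF _ approx_zero]) auto

section \<open>The Hilbert space structure and its norm as a dual norm\<close>

definition hilb :: "(('a \<Rightarrow> complex) \<Rightarrow> complex) hilbert" where
  "hilb = \<lparr>carrier = completion, monoid.mult = (\<lambda>L M. L), one = (\<lambda>_. 0), ring.zero = (\<lambda>_. 0),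
     add = (\<lambda>L M f. L f + M f), smult = (\<lambda>c L f. c * L f), ip = ip_lim\<rparr>"

lemma hilb_simps [simp]:
  "carrier hilb = completion" "\<zero>\<^bsub>hilb\<^esub> = (\<lambda>_. 0)" "L \<oplus>\<^bsub>hilb\<^esub> M = (\<lambda>f. L f + M f)"
  "c \<odot>\<^bsub>hilb\<^esub> L = (\<lambda>f. c * L f)" "ip hilb = ip_lim"
  by (simp_all add: hilb_def)

lemma abelian_group_hilb: "abelian_group hilb"
proof (rule abelian_groupI)
  fix L assume "L \<in> carrier hilb"
  then show "\<exists>M\<in>carrier hilb. M \<oplus>\<^bsub>hilb\<^esub> L = \<zero>\<^bsub>hilb\<^esub>"
    using smult_in[of L "-1"] by (intro bexI[of _ "\<lambda>f. -1 * L f"]) auto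
qed (auto simp: add_in zero_in add.assoc add.commute)

lemma module_hilb: "Module.module (ring_of_type_algebra :: complex ring) hilb"
  by (rule moduleI[OF cring_from_type_algebra abelian_group_hilb])
    (auto simp: ring_of_type_algebra_def smult_in algebra_simps)

lemma minus_hilb: assumes "L \<in> completion" "M \<in> completion"
  shows "L \<ominus>\<^bsub>hilb\<^esub> M = (\<lambda>f. L f - M f)"
proof -
  interpret abelian_group hilb by (rule abelian_group_hilb)
  have "\<ominus>\<^bsub>hilb\<^esub> M = (\<lambda>f. -1 * M f)"
    using assms smult_in[of M "-1"] by (intro minus_equality) auto
  then show ?thesis by (simp add: a_minus_def)
qed

lemma ip_add_left':
  assumes "L \<in> completion" "M \<in> completion" "N \<in> completion"
  shows "ip_lim (\<lambda>f. L f + M f) N = ip_lim L N + ip_lim M N"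
proof -
  obtain u v w where a: "approx L u" "approx M v" "approx N w" using approx_exists assms by metis
  show ?thesis
    by (rule LIMSEQ_unique[OF ip_lim_tendsto[OF approx_add[OF a(1,2)] a(3)]])
      (intro tendsto_add ip_lim_tendsto[OF a(1,3)] ip_lim_tendsto[OF a(2,3)])
qed

lemma ip_smult_left':
  assumes "L \<in> completion" "N \<in> completion"
  shows "ip_lim (\<lambda>f. c * L f) N = c * ip_lim L N"
proof -
  obtain u w where a: "approx L u" "approx N w" using approx_exists assms by metis
  show ?thesis
    by (rule LIMSEQ_unique[OF ip_lim_tendsto[OF approx_smult[OF a(1)] a(2)]])
      (intro tendsto_mult_left ip_lim_tendsto[OF a])
qed

lemma ip_commute':
  assumes "L \<in> completion" "N \<in> completion"
  shows "ip_lim N L = cnj (ip_lim L N)"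
proof -
  obtain u w where a: "approx L u" "approx N w" using approx_exists assms by metis
  have "(\<lambda>n. cnj (B (u n) (w n))) \<longlonglongrightarrow> cnj (ip_lim L N)"
    by (intro tendsto_cnj B_tendsto a)
  moreover have "cnj (B (u n) (w n)) = B (w n) (u n)" for n
    using a B_commute[of "u n" "w n"] by (simp add: approx_def)
  ultimately show ?thesis using B_tendsto[OF a(2,1)] LIMSEQ_unique by simp
qed

lemma seminorm_tendsto: assumes "approx L u" shows "(\<lambda>n. (seminorm (u n))\<^sup>2) \<longlonglongrightarrow> Re (ip_lim L L)"
proof -
  have "(\<lambda>n. Re (B (u n) (u n))) \<longlonglongrightarrow> Re (ip_lim L L)"
    by (intro tendsto_Re B_tendsto assms)
  then show ?thesis using assms by (simp add: seminorm_sq approx_def)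
qed

lemma ip_nonneg': assumes "L \<in> completion" shows "0 \<le> Re (ip_lim L L)"
proof -
  obtain u where "approx L u" using approx_exists assms by blast
  from seminorm_tendsto[OF this] show ?thesis by (rule LIMSEQ_le_const) auto
qed

lemma hnorm_hilb: "hnorm hilb L = sqrt (Re (ip_lim L L))"
  by (simp add: hnorm_def)

text \<open>Together with \<open>hnorm_le\<close> this identifies the Hilbert norm with the dual
  norm of \<open>L\<close>, so that operator bounds and completeness can be checked on values of
  functionals.\<close>

lemma hnorm_bound:
  assumes "L \<in> completion" "f \<in> V" shows "cmod (L f) \<le> hnorm hilb L * seminorm f"
proof -
  obtain u where u: "approx L u" using approx_exists assms by blast
  then have uV: "u n \<in> V" for n by (auto simp: approx_def)
  have "(\<lambda>n. sqrt ((seminorm (u n))\<^sup>2)) \<longlonglongrightarrow> hnorm hilb L"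
    unfolding hnorm_hilb by (intro tendsto_real_sqrt seminorm_tendsto u)
  then have "(\<lambda>n. seminorm (u n)) \<longlonglongrightarrow> hnorm hilb L" using uV by simp
  then have lim: "(\<lambda>n. seminorm (u n) * seminorm f) \<longlonglongrightarrow> hnorm hilb L * seminorm f" by (rule tendsto_mult_right)
  have "(\<lambda>n. cmod (B (u n) f)) \<longlonglongrightarrow> cmod (L f)"
    by (intro tendsto_norm approx_tendsto u assms)
  then show ?thesis
    by (rule LIMSEQ_le[OF _ lim]) (use Cauchy_Schwarz uV assms in blast)
qed

text \<open>Inserting a sequence that approximates \<open>L\<close> into the assumed bound gives, in
  the limit, that the square of the norm is at most \<open>C\<close> times the norm.\<close>

lemma hnorm_le:
  assumes "L \<in> completion" "0 \<le> C" "\<And>f. f \<in> V \<Longrightarrow> cmod (L f) \<le> C * seminorm f"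
  shows "hnorm hilb L \<le> C"
proof -
  obtain u where u: "approx L u" using approx_exists assms by blast
  then have uV: "u n \<in> V" for n by (auto simp: approx_def)
  have "(\<lambda>n. sqrt ((seminorm (u n))\<^sup>2)) \<longlonglongrightarrow> hnorm hilb L"
    unfolding hnorm_hilb by (intro tendsto_real_sqrt seminorm_tendsto u)
  then have "(\<lambda>n. seminorm (u n)) \<longlonglongrightarrow> hnorm hilb L" using uV by simp
  then have lim: "(\<lambda>n. C * seminorm (u n)) \<longlonglongrightarrow> C * hnorm hilb L" by (rule tendsto_mult_left)
  have "(\<lambda>n. cmod (L (u n))) \<longlonglongrightarrow> cmod (ip_lim L L)"
    by (intro tendsto_norm ip_lim_tendsto[OF u u])
  then have "cmod (ip_lim L L) \<le> C * hnorm hilb L"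
    by (rule LIMSEQ_le[OF _ lim]) (use assms uV in blast)
  then have "Re (ip_lim L L) \<le> C * hnorm hilb L"
    using complex_Re_le_cmod order_trans by blast
  then have "(hnorm hilb L)\<^sup>2 \<le> C * hnorm hilb L"
    using ip_nonneg'[OF assms(1)] by (simp add: hnorm_hilb)
  moreover have "hnorm hilb L \<ge> 0" by (simp add: hnorm_hilb ip_nonneg' assms)
  ultimately show ?thesis using assms(2)
    by (cases "hnorm hilb L = 0") (auto simp: power2_eq_square)
qed

lemma hnorm_embed: assumes "a \<in> V" shows "hnorm hilb (embed a) = seminorm a"
proof -
  have "(seminorm a)\<^sup>2 = Re (ip_lim (embed a) (embed a))"
    using LIMSEQ_unique[OF tendsto_const seminorm_tendsto[OF approx_embed[OF assms]]] .
  then show ?thesis using assms by (metis abs_of_nonneg hnorm_hilb real_sqrt_abs seminorm_nonneg)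
qed

lemma ip_embed: assumes "a \<in> V" "L \<in> completion" shows "ip_lim L (embed a) = L a"
proof -
  obtain u where "approx L u" using approx_exists assms by blast
  from ip_lim_tendsto[OF this approx_embed[OF assms(1)]] show ?thesis
    by (simp add: LIMSEQ_const_iff)
qed

text \<open>Completeness is that of a dual space: Cauchy sequences converge pointwise, the estimates
  are uniform on \<open>V\<close> and survive in the limit, and a limit of approximable functionals
  is approximable.\<close>

lemma hilbert_space_hilb: "hilbert_space hilb"
proof -
  interpret M: Module.module "ring_of_type_algebra :: complex ring" hilb by (rule module_hilb)
  show ?thesis
  proof (unfold_locales)
    fix x assume x: "x \<in> carrier hilb" "ip hilb x x = 0"
    then have x': "x \<in> completion" by simp
    have "x f = 0" for f
    proof (cases "f \<in> V")
      case True
      then show ?thesis using hnorm_bound[OF x' True] x(2) by (simp add: hnorm_hilb)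
    next
      case False
      then show ?thesis using x' by (simp add: completion_def)
    qed
    then show "x = \<zero>\<^bsub>hilb\<^esub>" by auto
  next
    fix u :: "nat \<Rightarrow> ('a \<Rightarrow> complex) \<Rightarrow> complex"
    assume "\<And>n. u n \<in> carrier hilb"
      and Cau: "\<And>e. 0 < e \<Longrightarrow> \<exists>N. \<forall>m\<ge>N. \<forall>n\<ge>N. hnorm hilb (u m \<ominus>\<^bsub>hilb\<^esub> u n) < e"
    then have u: "u n \<in> completion" for n by simp
    have dif: "(\<lambda>f. L f - M f) \<in> completion" if "L \<in> completion" "M \<in> completion" for L M
      using M.minus_closed[of L M] that by (simp add: minus_hilb)
    have C1: "\<exists>N. \<forall>m\<ge>N. \<forall>n\<ge>N. \<forall>f\<in>V. cmod (u m f - u n f) \<le> e * seminorm f" if "0 < e" for e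
    proof -
      obtain N where N: "\<forall>m\<ge>N. \<forall>n\<ge>N. hnorm hilb (u m \<ominus>\<^bsub>hilb\<^esub> u n) < e" using Cau \<open>0 < e\<close> by blast
      have "cmod (u m f - u n f) \<le> e * seminorm f" if "m \<ge> N" "n \<ge> N" "f \<in> V" for m n f
      proof -
        have "hnorm hilb (\<lambda>f. u m f - u n f) < e"
          using N that u by (simp add: minus_hilb)
        moreover have "cmod (u m f - u n f) \<le> hnorm hilb (\<lambda>f. u m f - u n f) * seminorm f"
          using hnorm_bound[OF dif[OF u u] that(3)] by simp
        ultimately show ?thesis
          using that(3) by (meson less_imp_le mult_right_mono order_trans seminorm_nonneg)
      qed
      then show ?thesis by blast
    qed
    have conv: "convergent (\<lambda>n. u n f)" for f
    proof (cases "f \<in> V")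
      case True
      have "Cauchy (\<lambda>n. u n f)"
      proof (rule CauchyI)
        fix e :: real assume e: "0 < e"
        \<comment> \<open>The summand 1 keeps the quotient meaningful when \<open>f\<close> is a
          null vector.\<close>
        have "e / (2 * (seminorm f + 1)) > 0" using e seminorm_nonneg[OF True] by simp
        then obtain N where N: "\<forall>m\<ge>N. \<forall>n\<ge>N. cmod (u m f - u n f) \<le> e / (2 * (seminorm f + 1)) * seminorm f"
          using C1 True by blast
        have "e / (2 * (seminorm f + 1)) * seminorm f < e"
        proof -
          have "seminorm f / (2 * (seminorm f + 1)) < 1" using seminorm_nonneg[OF True] by (simp add: field_simps)
          then have "e * (seminorm f / (2 * (seminorm f + 1))) < e * 1" using e by (intro mult_strict_left_mono)
          then show ?thesis by simp
        qed
        then show "\<exists>M. \<forall>m\<ge>M. \<forall>n\<ge>M. norm (u m f - u n f) < e" using N by (meson le_less_trans)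
      qed
      then show ?thesis by (simp add: Cauchy_convergent_iff)
    next
      case False
      then have "u n f = 0" for n using u[of n] by (simp add: completion_def)
      then show ?thesis by (simp add: convergent_const)
    qed
    define l where "l = (\<lambda>f. lim (\<lambda>n. u n f))"
    have lim: "(\<lambda>n. u n f) \<longlonglongrightarrow> l f" for f
      using conv by (simp add: l_def convergent_LIMSEQ_iff)
    have C2: "\<exists>N. \<forall>n\<ge>N. \<forall>f\<in>V. cmod (u n f - l f) \<le> e * seminorm f" if e: "0 < e" for e
    proof -
      obtain N where N: "\<forall>m\<ge>N. \<forall>n\<ge>N. \<forall>f\<in>V. cmod (u m f - u n f) \<le> e * seminorm f" using C1 e by blast
      have "cmod (u n f - l f) \<le> e * seminorm f" if "n \<ge> N" "f \<in> V" for n f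
      proof (rule LIMSEQ_le_const2)
        show "(\<lambda>m. cmod (u n f - u m f)) \<longlonglongrightarrow> cmod (u n f - l f)"
          by (intro tendsto_intros lim)
        show "\<exists>N. \<forall>m\<ge>N. cmod (u n f - u m f) \<le> e * seminorm f" using N that by blast
      qed
      then show ?thesis by blast
    qed
    have l0: "l f = 0" if "f \<notin> V" for f
    proof -
      have "u n f = 0" for n using u[of n] that by (simp add: completion_def)
      then show ?thesis using lim[of f] by (simp add: LIMSEQ_const_iff)
    qed
    have l: "l \<in> completion"
    proof -
      have "\<exists>a\<in>V. \<forall>f\<in>V. cmod (l f - B a f) \<le> \<epsilon> * seminorm f" if e: "\<epsilon> > 0" for \<epsilon>
      proof -
        obtain n where n: "\<And>f. f \<in> V \<Longrightarrow> cmod (u n f - l f) \<le> \<epsilon> / 2 * seminorm f"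
          using C2[of "\<epsilon> / 2"] e by auto
        obtain a where a: "a \<in> V" "\<And>f. f \<in> V \<Longrightarrow> cmod (u n f - B a f) \<le> \<epsilon> / 2 * seminorm f"
          using u[of n] e unfolding completion_def by (auto dest!: spec[of _ "\<epsilon> / 2"])
        have "cmod (l f - B a f) \<le> \<epsilon> * seminorm f" if f: "f \<in> V" for f
          using n[OF f] a(2)[OF f] norm_triangle_ineq4[of "u n f - B a f" "u n f - l f"]
          by (simp add: algebra_simps)
        then show ?thesis using a(1) by blast
      qed
      then show ?thesis using l0 by (auto simp: completion_def)
    qed
    have "(\<lambda>n. hnorm hilb (u n \<ominus>\<^bsub>hilb\<^esub> l)) \<longlonglongrightarrow> 0"
    proof (rule LIMSEQ_I)
      fix r :: real assume r: "0 < r"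
      then obtain N where N: "\<And>n f. n \<ge> N \<Longrightarrow> f \<in> V \<Longrightarrow> cmod (u n f - l f) \<le> r / 2 * seminorm f"
        using C2[of "r / 2"] by auto
      have "norm (hnorm hilb (u n \<ominus>\<^bsub>hilb\<^esub> l) - 0) < r" if "n \<ge> N" for n
      proof -
        have "hnorm hilb (\<lambda>f. u n f - l f) \<le> r / 2"
          using r by (intro hnorm_le dif u l N that) auto
        moreover have "0 \<le> hnorm hilb (\<lambda>f. u n f - l f)"
          by (simp add: hnorm_hilb ip_nonneg' dif u l)
        ultimately show ?thesis using r by (simp add: minus_hilb u l)
      qed
      then show "\<exists>no. \<forall>n\<ge>no. norm (hnorm hilb (u n \<ominus>\<^bsub>hilb\<^esub> l) - 0) < r" by blast
    qed
    then show "\<exists>l\<in>carrier hilb. (\<lambda>n. hnorm hilb (u n \<ominus>\<^bsub>hilb\<^esub> l)) \<longlonglongrightarrow> 0" using l by auto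
  qed (auto simp: ip_add_left' ip_smult_left' ip_nonneg' intro: ip_commute')
qed

end

section \<open>Kernels of positive type\<close>

definition psd_kernel :: "'a set \<Rightarrow> ('a \<Rightarrow> 'a \<Rightarrow> real) \<Rightarrow> bool" where
  "psd_kernel S A \<longleftrightarrow> (\<forall>i\<in>S. \<forall>j\<in>S. A i j = A j i) \<and>
     (\<forall>a. 0 \<le> (\<Sum>i\<in>S. \<Sum>j\<in>S. a i * a j * A i j))"

lemma psd_kernel_subset:
  assumes "psd_kernel S A" "T \<subseteq> S" "finite S" shows "psd_kernel T A"
proof -
  have "0 \<le> (\<Sum>i\<in>T. \<Sum>j\<in>T. a i * a j * A i j)" for a
  proof -
    let ?b = "\<lambda>i. if i \<in> T then a i else 0"
    have "(\<Sum>i\<in>T. \<Sum>j\<in>T. a i * a j * A i j) = (\<Sum>i\<in>S. \<Sum>j\<in>S. ?b i * ?b j * A i j)"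
      using assms by (intro sum.mono_neutral_cong_left) auto
    then show ?thesis using assms(1) by (simp add: psd_kernel_def)
  qed
  moreover have "A i j = A j i" if "i \<in> T" "j \<in> T" for i j
    using assms that by (auto simp: psd_kernel_def)
  ultimately show ?thesis by (auto simp: psd_kernel_def)
qed

text \<open>Cholesky factorisation by induction on the index set. A positive pivot
  \<open>A z z\<close> is split off by a Schur complement; a zero pivot has a zero row.\<close>

lemma psd_kernel_gram:
  assumes "finite S" "psd_kernel S A"
  shows "\<exists>(m::nat) u. \<forall>i\<in>S. \<forall>j\<in>S. A i j = (\<Sum>l<m. u l i * u l j)"
  using assms
proof (induction S arbitrary: A rule: finite_induct)
  case empty
  then show ?case by simp
next
  case (insert z S)
  note sym = insert.prems[unfolded psd_kernel_def, THEN conjunct1, rule_format]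
  note pos = insert.prems[unfolded psd_kernel_def, THEN conjunct2, rule_format]
  have exp: "(\<Sum>i\<in>insert z S. \<Sum>j\<in>insert z S. a i * a j * A i j)
      = (a z)\<^sup>2 * A z z + 2 * a z * (\<Sum>i\<in>S. a i * A i z) + (\<Sum>i\<in>S. \<Sum>j\<in>S. a i * a j * A i j)" for a
  proof -
    have "(\<Sum>j\<in>S. a z * a j * A z j) = a z * (\<Sum>i\<in>S. a i * A i z)"
      unfolding sum_distrib_left using sym by (intro sum.cong) auto
    moreover have "(\<Sum>i\<in>S. a i * a z * A i z) = a z * (\<Sum>i\<in>S. a i * A i z)"
      unfolding sum_distrib_left by (intro sum.cong) auto
    ultimately show ?thesis
      using insert.hyps by (simp add: sum.distrib power2_eq_square algebra_simps)
  qed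
  have Aoo: "0 \<le> A z z"
    using pos[of "\<lambda>i. if i = z then 1 else 0"] insert.hyps
    by (simp add: if_distrib[of "\<lambda>x. x * _"] if_distrib[of "\<lambda>x. _ * x"] cong: if_cong)
  show ?case
  proof (cases "A z z = 0")
    case True
    have zero: "A i z = 0" if i: "i \<in> S" for i
    proof (rule ccontr)
      assume nz: "A i z \<noteq> 0"
      \<comment> \<open>Chosen so that the form with coefficient \<open>t\<close> at
        \<open>z\<close> and 1 at \<open>i\<close> equals -1.\<close>
      define t where "t = - (A i i + 1) / (2 * A i z)"
      define a where "a = (\<lambda>k. if k = z then t else if k = i then 1 else 0 :: real)"
      have io: "i \<noteq> z" using insert.hyps i by auto
      have a: "a z = t" "\<And>k. k \<in> S \<Longrightarrow> a k = (if k = i then 1 else 0)"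
        using insert.hyps by (auto simp: a_def)
      have 1: "(\<Sum>k\<in>S. a k * A k z) = A i z"
        using i insert.hyps by (simp add: a(2) if_distrib[of "\<lambda>x. x * _"] cong: if_cong)
      have 2: "(\<Sum>k\<in>S. \<Sum>j\<in>S. a k * a j * A k j) = A i i"
      proof -
        have "(\<Sum>k\<in>S. \<Sum>j\<in>S. a k * a j * A k j) = (\<Sum>k\<in>S. if k = i then A i i else 0)"
          using i insert.hyps
          by (intro sum.cong refl) (simp add: a(2) if_distrib[of "\<lambda>x. x * _"] cong: if_cong)
        then show ?thesis using i insert.hyps by simp
      qed
      have "0 \<le> 2 * t * A i z + A i i"
        using pos[of a] unfolding exp 1 2 a(1) True by simp
      then show False using nz by (simp add: t_def)
    qed
    have "psd_kernel S A" using psd_kernel_subset[OF insert.prems] insert.hyps by auto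
    from insert.IH[OF this] obtain m u
      where u: "\<forall>i\<in>S. \<forall>j\<in>S. A i j = (\<Sum>l<(m::nat). u l i * u l j)" by blast
    define u' where "u' l i = (if i = z then 0 else u l i)" for l i
    have "A i j = (\<Sum>l<m. u' l i * u' l j)" if ij: "i \<in> insert z S" "j \<in> insert z S" for i j
    proof (cases "i = z \<or> j = z")
      case True
      then have "A i j = 0" using ij zero sym \<open>A z z = 0\<close> by (metis insertE)
      then show ?thesis using True by (auto simp: u'_def)
    next
      case False
      then show ?thesis using u ij by (auto simp: u'_def)
    qed
    then show ?thesis by blast
  next
    case False
    then have p: "A z z > 0" using Aoo by simp
    \<comment> \<open>The Schur complement: subtracting the rank-one kernel of the pivot kills the
      row and the column of \<open>z\<close>.\<close>
    define C where "C i j = A i j - A i z * A j z / A z z" for i j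
    have "psd_kernel S C"
      unfolding psd_kernel_def
    proof (intro conjI allI ballI)
      fix i j assume "i \<in> S" "j \<in> S" then show "C i j = C j i" using sym by (simp add: C_def)
    next
      fix a
      define s where "s = (\<Sum>i\<in>S. a i * A i z)"
      \<comment> \<open>The coefficient at \<open>z\<close> that minimises the form for given
        coefficients on \<open>S\<close>; the minimum is the form of \<open>C\<close>.\<close>
      define a' where "a' = (\<lambda>i. if i = z then - s / A z z else a i)"
      have a': "a' z = - s / A z z" "\<And>i. i \<in> S \<Longrightarrow> a' i = a i"
        using insert.hyps by (auto simp: a'_def)
      have "0 \<le> s\<^sup>2 / A z z - 2 * s / A z z * s + (\<Sum>i\<in>S. \<Sum>j\<in>S. a i * a j * A i j)"
        using pos[of a'] p unfolding exp by (simp add: a' s_def[symmetric] power2_eq_square)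
      also have "\<dots> = (\<Sum>i\<in>S. \<Sum>j\<in>S. a i * a j * A i j) - s * s / A z z"
        by (simp add: power2_eq_square)
      also have "s * s / A z z = (\<Sum>i\<in>S. \<Sum>j\<in>S. a i * a j * (A i z * A j z / A z z))"
        unfolding s_def sum_product sum_divide_distrib by (intro sum.cong refl) (simp add: ac_simps)
      also have "(\<Sum>i\<in>S. \<Sum>j\<in>S. a i * a j * A i j) - \<dots> = (\<Sum>i\<in>S. \<Sum>j\<in>S. a i * a j * C i j)"
        by (simp add: C_def right_diff_distrib sum_subtractf)
      finally show "0 \<le> (\<Sum>i\<in>S. \<Sum>j\<in>S. a i * a j * C i j)" .
    qed
    from insert.IH[OF this] obtain m u
      where u: "\<forall>i\<in>S. \<forall>j\<in>S. C i j = (\<Sum>l<(m::nat). u l i * u l j)" by blast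
    \<comment> \<open>Coordinate \<open>m\<close> carries the rank-one kernel. The coordinates below
      \<open>m\<close> vanish at \<open>z\<close>, as \<open>C\<close> does.\<close>
    define u' where "u' l i = (if l = m then A i z / sqrt (A z z) else if i = z then 0 else u l i)" for l i
    have "A i j = (\<Sum>l<Suc m. u' l i * u' l j)" if "i \<in> insert z S" "j \<in> insert z S" for i j
    proof -
      have "(\<Sum>l<Suc m. u' l i * u' l j) = (\<Sum>l<m. u' l i * u' l j) + A i z * A j z / A z z"
        using p by (simp add: u'_def)
      moreover have "(\<Sum>l<m. u' l i * u' l j) = C i j"
      proof (cases "i = z \<or> j = z")
        case True
        then have "(\<Sum>l<m. u' l i * u' l j) = 0" by (auto simp: u'_def intro!: sum.neutral)
        moreover have "C i j = 0" using True p sym that by (auto simp: C_def)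
        ultimately show ?thesis by simp
      next
        case False
        then have "C i j = (\<Sum>l<m. u l i * u l j)" using u that by auto
        then show ?thesis using False by (auto simp: u'_def intro!: sum.cong)
      qed
      ultimately show ?thesis by (simp add: C_def)
    qed
    then show ?thesis by blast
  qed
qed

text \<open>A Gram representation of \<open>A\<close> splits the form of the product into
  \<open>m\<close> forms of \<open>C\<close>, the \<open>l\<close>-th one with coefficients
  \<open>a i * u l i\<close>.\<close>

lemma psd_kernel_Schur_product:
  assumes "finite S" "psd_kernel S A" "psd_kernel S C"
  shows "psd_kernel S (\<lambda>i j. A i j * C i j)"
proof -
  obtain m u where u: "\<forall>i\<in>S. \<forall>j\<in>S. A i j = (\<Sum>l<(m::nat). u l i * u l j)"
    using psd_kernel_gram[OF assms(1,2)] by blast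
  have "0 \<le> (\<Sum>i\<in>S. \<Sum>j\<in>S. a i * a j * (A i j * C i j))" for a
  proof -
    have "(\<Sum>i\<in>S. \<Sum>j\<in>S. a i * a j * (A i j * C i j))
      = (\<Sum>i\<in>S. \<Sum>j\<in>S. \<Sum>l<m. (a i * u l i) * (a j * u l j) * C i j)"
      using u by (intro sum.cong refl) (simp add: sum_distrib_left sum_distrib_right ac_simps)
    also have "\<dots> = (\<Sum>i\<in>S. \<Sum>l<m. \<Sum>j\<in>S. (a i * u l i) * (a j * u l j) * C i j)"
      by (intro sum.cong refl sum.swap)
    also have "\<dots> = (\<Sum>l<m. \<Sum>i\<in>S. \<Sum>j\<in>S. (a i * u l i) * (a j * u l j) * C i j)"
      by (rule sum.swap)
    also have "\<dots> \<ge> 0"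
      using assms(3)[unfolded psd_kernel_def, THEN conjunct2, rule_format, of "\<lambda>i. a i * u l i" for l]
      by (rule sum_nonneg)
    finally show ?thesis .
  qed
  then show ?thesis using assms by (auto simp: psd_kernel_def)
qed

lemma psd_kernel_power:
  assumes "finite S" "psd_kernel S A"
  shows "psd_kernel S (\<lambda>i j. A i j ^ n)"
proof (induction n)
  case 0
  have "(\<Sum>i\<in>S. \<Sum>j\<in>S. a i * a j) = (\<Sum>i\<in>S. a i)\<^sup>2" for a :: "'a \<Rightarrow> real"
    by (simp add: power2_eq_square sum_product)
  then show ?case by (simp add: psd_kernel_def)
next
  case (Suc n)
  then show ?case using psd_kernel_Schur_product[OF assms(1,2) Suc] by simp
qed

text \<open>Entrywise powers are of positive type, and the exponential series has nonnegative
  coefficients.\<close>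

lemma psd_kernel_exp:
  assumes "finite S" "psd_kernel S A"
  shows "psd_kernel S (\<lambda>i j. exp (A i j))"
proof -
  have "0 \<le> (\<Sum>i\<in>S. \<Sum>j\<in>S. a i * a j * exp (A i j))" for a
  proof -
    have sums: "(\<lambda>n. \<Sum>i\<in>S. \<Sum>j\<in>S. a i * a j * (A i j ^ n /\<^sub>R fact n))
        sums (\<Sum>i\<in>S. \<Sum>j\<in>S. a i * a j * exp (A i j))"
      by (intro sums_sum sums_mult exp_converges)
    have "0 \<le> (\<Sum>i\<in>S. \<Sum>j\<in>S. a i * a j * (A i j ^ n /\<^sub>R fact n))" for n
    proof -
      have "(\<Sum>i\<in>S. \<Sum>j\<in>S. a i * a j * (A i j ^ n /\<^sub>R fact n))
        = (\<Sum>i\<in>S. \<Sum>j\<in>S. a i * a j * A i j ^ n) / fact n"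
        unfolding sum_divide_distrib by (intro sum.cong refl) (simp add: divide_inverse ac_simps)
      then show ?thesis using psd_kernel_power[OF assms, of n] by (simp add: psd_kernel_def)
    qed
    then show ?thesis by (rule sums_le[OF _ sums_zero sums])
  qed
  then show ?thesis using assms by (auto simp: psd_kernel_def)
qed

lemma psd_kernel_complex:
  assumes "psd_kernel S A"
  shows "0 \<le> Re (\<Sum>i\<in>S. \<Sum>j\<in>S. cnj (a i) * a j * of_real (A i j))"
proof -
  have "Re (\<Sum>i\<in>S. \<Sum>j\<in>S. cnj (a i) * a j * of_real (A i j))
    = (\<Sum>i\<in>S. \<Sum>j\<in>S. Re (a i) * Re (a j) * A i j) + (\<Sum>i\<in>S. \<Sum>j\<in>S. Im (a i) * Im (a j) * A i j)"
    by (simp add: sum.distrib algebra_simps)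
  then show ?thesis using assms by (simp add: psd_kernel_def)
qed

text \<open>If \<open>N\<close> is a squared distance in a Hilbert space, then \<open>P i j\<close>
  is twice the inner product of \<open>i - z\<close> and \<open>j - z\<close>; in general
  \<open>P\<close> is still of positive type. Up to factors that depend on \<open>i\<close> or
  \<open>j\<close> alone, and are absorbed in the coefficients, \<open>exp (- t * N i j)\<close> is
  \<open>exp (t * P i j)\<close>.\<close>

lemma psd_kernel_Schoenberg:
  fixes N :: "'a \<Rightarrow> 'a \<Rightarrow> real"
  assumes "finite S" and sym: "\<And>i j. i \<in> S \<Longrightarrow> j \<in> S \<Longrightarrow> N i j = N j i"
    and diag: "\<And>i. i \<in> S \<Longrightarrow> N i i = 0"
    and neg: "\<And>a. (\<Sum>i\<in>S. a i) = 0 \<Longrightarrow> (\<Sum>i\<in>S. \<Sum>j\<in>S. a i * a j * N i j) \<le> 0"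
    and t: "0 \<le> t"
  shows "psd_kernel S (\<lambda>i j. exp (- t * N i j))"
proof (cases "S = {}")
  case True
  then show ?thesis by (simp add: psd_kernel_def)
next
  case False
  then obtain z where z: "z \<in> S" by blast
  define P where "P i j = N i z + N j z - N i j" for i j
  have P: "0 \<le> (\<Sum>i\<in>S. \<Sum>j\<in>S. a i * a j * P i j)" for a
  proof -
    define s where "s = (\<Sum>i\<in>S. a i)"
    \<comment> \<open>Compensating the total mass \<open>s\<close> at the base point makes the
      coefficients sum to zero, as \<open>neg\<close> requires.\<close>
    define a' where "a' i = a i - (if i = z then s else 0)" for i
    have ex: "(\<Sum>j\<in>S. (if j = z then s else 0) * h j) = s * h z" for h
      using z assms(1) by (simp add: if_distrib[of "\<lambda>x. x * _"] cong: if_cong)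
    have "(\<Sum>i\<in>S. a' i) = 0"
      using z assms(1) by (simp add: a'_def s_def sum_subtractf)
    from neg[OF this] have le: "(\<Sum>i\<in>S. a' i * (\<Sum>j\<in>S. a' j * N i j)) \<le> 0"
      by (simp add: sum_distrib_left ac_simps)
    have inner: "(\<Sum>j\<in>S. a' j * N i j) = (\<Sum>j\<in>S. a j * N i j) - s * N i z" for i
      using ex[of "N i"] by (simp add: a'_def left_diff_distrib sum_subtractf)
    have "(\<Sum>i\<in>S. a' i * (\<Sum>j\<in>S. a' j * N i j))
       = (\<Sum>i\<in>S. a i * ((\<Sum>j\<in>S. a j * N i j) - s * N i z)) - s * ((\<Sum>j\<in>S. a j * N z j) - s * N z z)"
      unfolding inner using ex[of "\<lambda>i. (\<Sum>j\<in>S. a j * N i j) - s * N i z"]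
      by (simp add: a'_def left_diff_distrib sum_subtractf)
    also have "(\<Sum>j\<in>S. a j * N z j) = (\<Sum>j\<in>S. a j * N j z)" using sym z by (intro sum.cong) auto
    also have "(\<Sum>i\<in>S. a i * ((\<Sum>j\<in>S. a j * N i j) - s * N i z))
      = (\<Sum>i\<in>S. \<Sum>j\<in>S. a i * a j * N i j) - s * (\<Sum>j\<in>S. a j * N j z)"
      by (simp add: right_diff_distrib sum_subtractf sum_distrib_left ac_simps)
    finally have eq: "(\<Sum>i\<in>S. a' i * (\<Sum>j\<in>S. a' j * N i j))
      = (\<Sum>i\<in>S. \<Sum>j\<in>S. a i * a j * N i j) - 2 * s * (\<Sum>j\<in>S. a j * N j z)"
      using diag[OF z] by (simp add: algebra_simps)
    have "(\<Sum>i\<in>S. \<Sum>j\<in>S. a i * a j * N i z) = s * (\<Sum>j\<in>S. a j * N j z)"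
      unfolding s_def sum_product by (subst sum.swap) (simp add: ac_simps)
    moreover have "(\<Sum>i\<in>S. \<Sum>j\<in>S. a i * a j * N j z) = s * (\<Sum>j\<in>S. a j * N j z)"
      unfolding s_def sum_product by (simp add: ac_simps)
    ultimately have "(\<Sum>i\<in>S. \<Sum>j\<in>S. a i * a j * P i j)
      = 2 * s * (\<Sum>j\<in>S. a j * N j z) - (\<Sum>i\<in>S. \<Sum>j\<in>S. a i * a j * N i j)"
      by (simp add: P_def algebra_simps sum.distrib sum_subtractf)
    then show ?thesis using le eq by simp
  qed
  have "psd_kernel S (\<lambda>i j. t * P i j)"
  proof -
    have "(\<Sum>i\<in>S. \<Sum>j\<in>S. a i * a j * (t * P i j)) = t * (\<Sum>i\<in>S. \<Sum>j\<in>S. a i * a j * P i j)" for a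
      by (simp add: sum_distrib_left ac_simps)
    then show ?thesis using P t sym by (simp add: psd_kernel_def P_def)
  qed
  note E = psd_kernel_exp[OF assms(1) this]
  have eq: "exp (- t * N i j) = exp (- t * N i z) * exp (- t * N j z) * exp (t * P i j)" for i j
    by (simp add: P_def algebra_simps flip: exp_add)
  have "0 \<le> (\<Sum>i\<in>S. \<Sum>j\<in>S. a i * a j * exp (- t * N i j))" for a
  proof -
    have "(\<Sum>i\<in>S. \<Sum>j\<in>S. a i * a j * exp (- t * N i j))
      = (\<Sum>i\<in>S. \<Sum>j\<in>S. (a i * exp (- t * N i z)) * (a j * exp (- t * N j z)) * exp (t * P i j))"
      by (intro sum.cong refl, subst eq) (simp only: ac_simps)
    then show ?thesis
      using E[unfolded psd_kernel_def, THEN conjunct2, rule_format, of "\<lambda>i. a i * exp (- t * N i z)"]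
      by simp
  qed
  then show ?thesis using sym by (simp add: psd_kernel_def)
qed

section \<open>Functions on etale groupoids\<close>

lemma infsum_swap_finite:
  fixes F :: "'a \<Rightarrow> 'b \<Rightarrow> 'c :: banach"
  assumes fin: "finite {l \<in> A. \<exists>h\<in>B. F l h \<noteq> 0}"
    "\<And>l. l \<in> A \<Longrightarrow> finite {h \<in> B. F l h \<noteq> 0}"
  shows "(\<Sum>\<^sub>\<infinity>l\<in>A. \<Sum>\<^sub>\<infinity>h\<in>B. F l h) = (\<Sum>\<^sub>\<infinity>h\<in>B. \<Sum>\<^sub>\<infinity>l\<in>A. F l h)"
proof (rule infsum_swap_banach, rule finite_nonzero_values_imp_summable_on)
  have "{p \<in> A \<times> B. (case p of (l, h) \<Rightarrow> F l h) \<noteq> 0}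
      \<subseteq> Sigma {l \<in> A. \<exists>h\<in>B. F l h \<noteq> 0} (\<lambda>l. {h \<in> B. F l h \<noteq> 0})"
    by auto
  moreover have "finite \<dots>" using fin by (intro finite_SigmaI) auto
  ultimately show "finite {p \<in> A \<times> B. (case p of (l, h) \<Rightarrow> F l h) \<noteq> 0}"
    by (rule finite_subset)
qed

section \<open>Closure properties of \<open>Cc\<close>\<close>

lemma CcI:
  fixes f :: "'a::t2_space \<Rightarrow> complex"
  assumes "continuous_on UNIV f" "compact C" "\<And>g. g \<notin> C \<Longrightarrow> f g = 0"
  shows "f \<in> Cc"
proof -
  have "supp f \<subseteq> C" unfolding supp_def
    using assms by (intro closure_minimal compact_imp_closed[OF assms(2)]) auto
  then have "supp f = C \<inter> supp f" by auto
  then have "compact (supp f)" using compact_Int_closed[OF assms(2), of "supp f"] by (simp add: supp_def)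
  then show ?thesis using assms by (simp add: Cc_def)
qed

lemma Cc_cont: "f \<in> Cc \<Longrightarrow> continuous_on UNIV f"
  by (simp add: Cc_def)

lemma Cc_compact: "f \<in> Cc \<Longrightarrow> compact (supp f)"
  by (simp add: Cc_def)

lemma supp_zero: "g \<notin> supp f \<Longrightarrow> f g = 0"
  using closure_subset[of "{g. f g \<noteq> 0}"] by (auto simp: supp_def)

lemma Cc_vanish:
  fixes f f' :: "'a::t2_space \<Rightarrow> complex"
  assumes "f \<in> Cc" "continuous_on UNIV f'" "\<And>g. f g = 0 \<Longrightarrow> f' g = 0"
  shows "f' \<in> Cc"
  by (rule CcI[OF assms(2) Cc_compact[OF assms(1)]]) (use supp_zero assms(3) in blast)

lemma Cc_mult: "(f :: 'a::t2_space \<Rightarrow> complex) \<in> Cc \<Longrightarrow> continuous_on UNIV c \<Longrightarrow> (\<lambda>g. f g * c g) \<in> Cc"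
  by (rule Cc_vanish[of f]) (auto intro: continuous_on_mult Cc_cont)

lemma Cc_mult2: "(f :: 'a::t2_space \<Rightarrow> complex) \<in> Cc \<Longrightarrow> continuous_on UNIV c \<Longrightarrow> (\<lambda>g. c g * f g) \<in> Cc"
  using Cc_mult[of f c] by (simp add: mult.commute)

lemma Cc_smult: "(f :: 'a::t2_space \<Rightarrow> complex) \<in> Cc \<Longrightarrow> (\<lambda>g. c * f g) \<in> Cc"
  by (rule Cc_mult2) auto

lemma Cc_add: "(f :: 'a::t2_space \<Rightarrow> complex) \<in> Cc \<Longrightarrow> f' \<in> Cc \<Longrightarrow> (\<lambda>g. f g + f' g) \<in> Cc"
  by (rule CcI[of _ "supp f \<union> supp f'"])
    (auto intro: continuous_on_add Cc_cont compact_Un Cc_compact simp: supp_zero)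

lemma Cc_diff: "(f :: 'a::t2_space \<Rightarrow> complex) \<in> Cc \<Longrightarrow> f' \<in> Cc \<Longrightarrow> (\<lambda>g. f g - f' g) \<in> Cc"
  using Cc_add[OF _ Cc_smult[of f' "-1"], of f] by simp

lemma Cc_zero: "(\<lambda>_ :: 'a::t2_space. 0) \<in> Cc"
  by (rule CcI[of _ "{}"]) auto

lemma Cc_cnj: "(f :: 'a::t2_space \<Rightarrow> complex) \<in> Cc \<Longrightarrow> (\<lambda>g. cnj (f g)) \<in> Cc"
  by (rule Cc_vanish[of f]) (auto intro: continuous_on_cnj Cc_cont)

lemma Cc_norm: "(f :: 'a::t2_space \<Rightarrow> complex) \<in> Cc \<Longrightarrow> (\<lambda>g. of_real (cmod (f g))) \<in> Cc"
  by (rule Cc_vanish[of f]) (auto intro: continuous_on_of_real continuous_on_norm Cc_cont)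

lemma Cc_sum:
  fixes f :: "'i \<Rightarrow> 'a::t2_space \<Rightarrow> complex"
  shows "finite I \<Longrightarrow> (\<And>i. i \<in> I \<Longrightarrow> f i \<in> Cc) \<Longrightarrow> (\<lambda>g. \<Sum>i\<in>I. f i g) \<in> Cc"
  by (induction I rule: finite_induct) (auto simp: Cc_zero intro: Cc_add)

section \<open>Division along range fibres, and convolution as a fibre sum\<close>

context groupoid
begin

abbreviation ldiv :: "'g \<Rightarrow> 'g \<Rightarrow> 'g" where
  "ldiv h g \<equiv> gmult G (ginv G h) g"

lemma units_iff: "x \<in> units G \<longleftrightarrow> rng G x = x"
  by (metis rangeE rangeI rng_rng units_def)

lemma rng_in_units [simp]: "rng G g \<in> units G"
  by (simp add: units_def)

lemma src_in_units [simp]: "src G g \<in> units G"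
  by (simp add: units_iff rng_src)

lemma src_unit: "x \<in> units G \<Longrightarrow> src G x = x"
  using src_rng[of x] by (simp add: units_iff)

lemma ginv_ginv [simp]: "ginv G (ginv G g) = g"
proof -
  let ?a = "ginv G g"
  have "ginv G ?a = gmult G (ginv G ?a) (src G (ginv G ?a))" by (simp add: src_mult_right)
  also have "src G (ginv G ?a) = gmult G ?a g" by (simp add: src_inv rng_inv mult_inv_left)
  also have "gmult G (ginv G ?a) (gmult G ?a g) = gmult G (gmult G (ginv G ?a) ?a) g"
    by (rule mult_assoc[symmetric]) (simp_all add: src_inv rng_inv)
  also have "gmult G (ginv G ?a) ?a = rng G g" by (simp add: mult_inv_left src_inv)
  finally show ?thesis by (simp add: rng_mult_left)
qed

lemma ginv_unit: "x \<in> units G \<Longrightarrow> ginv G x = x"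
  by (metis mult_inv_right rng_inv rng_mult_left src_unit units_iff)

lemma rng_ldiv: "rng G h = rng G g \<Longrightarrow> rng G (ldiv h g) = src G h"
  by (simp add: rng_mult src_inv rng_inv)

lemma src_ldiv: "rng G h = rng G g \<Longrightarrow> src G (ldiv h g) = src G g"
  by (simp add: src_mult src_inv)

lemma mult_ldiv: "rng G h = rng G g \<Longrightarrow> gmult G h (ldiv h g) = g"
  by (metis mult_assoc mult_inv_right rng_inv rng_mult_left src_inv)

lemma ldiv_mult: "src G h = rng G k \<Longrightarrow> ldiv h (gmult G h k) = k"
  by (metis mult_assoc mult_inv_left rng_mult_left src_inv)

lemma ldiv_self: "ldiv h h = src G h"
  by (rule mult_inv_left)

lemma ldiv_unit: "x \<in> units G \<Longrightarrow> rng G g = x \<Longrightarrow> ldiv x g = g"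
  by (metis ginv_unit rng_mult_left)

lemma ginv_mult:
  assumes "src G g = rng G h" shows "ginv G (gmult G g h) = gmult G (ginv G h) (ginv G g)"
proof -
  let ?k = "gmult G g h" and ?l = "gmult G (ginv G h) (ginv G g)"
  have rk: "rng G ?k = rng G g" "src G ?k = src G h" using assms by (simp_all add: rng_mult src_mult)
  have "gmult G ?k ?l = gmult G g (gmult G h ?l)"
    by (rule mult_assoc) (simp_all add: assms rng_mult rng_inv src_inv)
  also have "gmult G h ?l = ginv G g"
    using mult_ldiv[of h "ginv G g"] assms by (simp add: rng_inv)
  finally have kl: "gmult G ?k ?l = rng G g" by (simp add: mult_inv_right)
  have l: "rng G ?l = src G h" "src G ?l = rng G g"
    using assms by (simp_all add: rng_mult src_mult rng_inv src_inv)
  have "?l = ldiv ?k (gmult G ?k ?l)"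
    by (rule ldiv_mult[symmetric]) (simp add: rk l)
  also have "\<dots> = gmult G (ginv G ?k) (src G (ginv G ?k))" by (simp add: kl src_inv rk)
  finally show ?thesis by (simp add: src_mult_right)
qed

lemma ginv_ldiv: "rng G h = rng G g \<Longrightarrow> ginv G (ldiv h g) = ldiv g h"
  by (simp add: ginv_mult src_inv)

text \<open>Left translation does not change the quotient of two elements of a fibre; associativity
  of convolution rests on this.\<close>

lemma ldiv_ldiv:
  assumes "rng G l = rng G h" "rng G l = rng G g"
  shows "ldiv (ldiv l h) (ldiv l g) = ldiv h g"
proof -
  have "ldiv (ldiv l h) (ldiv l g) = gmult G (ldiv h l) (ldiv l g)"
    using assms by (simp add: ginv_ldiv)
  also have "\<dots> = gmult G (ginv G h) (gmult G l (ldiv l g))"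
    using assms by (intro mult_assoc) (simp_all add: src_inv rng_ldiv)
  finally show ?thesis using assms by (simp add: mult_ldiv)
qed

lemma bij_ldiv: "bij_betw (ldiv l) (rfibre G (rng G l)) (rfibre G (src G l))"
proof (rule bij_betwI[where g = "gmult G l"])
  show "ldiv l \<in> rfibre G (rng G l) \<rightarrow> rfibre G (src G l)"
    by (auto simp: rfibre_def rng_ldiv)
  show "gmult G l \<in> rfibre G (src G l) \<rightarrow> rfibre G (rng G l)"
    by (auto simp: rfibre_def rng_mult)
qed (auto simp: rfibre_def mult_ldiv ldiv_mult)

lemma bij_ginv_sfibre: "bij_betw (ginv G) (rfibre G x) (sfibre G x)"
  by (rule bij_betwI[where g = "ginv G"]) (auto simp: rfibre_def sfibre_def rng_inv src_inv)

lemma infsum_sfibre: "infsum f (sfibre G x) = (\<Sum>\<^sub>\<infinity>g\<in>rfibre G x. f (ginv G g))"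
  by (rule infsum_reindex_bij_betw[OF bij_ginv_sfibre, symmetric])

text \<open>A factorisation of \<open>g\<close> is determined by its left factor, which may be any
  element of the range fibre of \<open>g\<close>. Convolution thereby becomes a sum over one fibre,
  the form used from here on.\<close>

lemma conv_eq: "conv G a c g = (\<Sum>\<^sub>\<infinity>h\<in>rfibre G (rng G g). a h * c (ldiv h g))"
proof -
  have "bij_betw (\<lambda>h. (h, ldiv h g)) (rfibre G (rng G g)) {(h, k) \<in> composable G. gmult G h k = g}"
    by (rule bij_betwI[where g = fst])
      (auto simp: rfibre_def composable_def rng_ldiv mult_ldiv ldiv_mult rng_mult)
  from infsum_reindex_bij_betw[OF this, of "\<lambda>(h, k). a h * c k"] show ?thesis
    by (simp add: conv_def)
qed

lemma Psi_eq: "x \<in> units G \<Longrightarrow> Psi G f x = (\<Sum>\<^sub>\<infinity>g\<in>rfibre G x. f g)"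
  by (simp add: Psi_def)

lemma conv_ginv_eq: "conv G a (\<lambda>k. c (ginv G k)) g = (\<Sum>\<^sub>\<infinity>h\<in>rfibre G (rng G g). a h * c (ldiv g h))"
  unfolding conv_eq by (intro infsum_cong) (simp add: rfibre_def ginv_ldiv)

end

section \<open>Topology of a locally compact etale groupoid\<close>

locale lc_etale_groupoid = etale_groupoid G for G :: "'g::t2_space groupoid" +
  assumes locally_compact: "locally compact (UNIV :: 'g set)"
    and compact_units: "compact (units G)"
begin

text \<open>If both \<open>g\<close> and \<open>rng G g\<close> lie in one bisection, they coincide,
  because they have the same range. Both lie in it for all \<open>g\<close> near a unit.\<close>

lemma open_units: "open (units G)"
proof (subst open_subopen, safe)
  fix x assume x: "x \<in> units G"
  obtain U where U: "open_bisection G U" "x \<in> U"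
    using topological_basisE[OF basis_open_bisections open_UNIV UNIV_I] by blast
  have opU: "open U" using U by (simp add: open_bisection_def)
  define W where "W = U \<inter> rng G -` U"
  have "open W" unfolding W_def
    using opU continuous_rng by (intro open_Int open_vimage) auto
  moreover have "x \<in> W" using x U(2) by (simp add: W_def units_iff)
  moreover have "W \<subseteq> units G"
  proof
    fix g assume g: "g \<in> W"
    obtain q where q: "homeomorphism U (rng G ` U) (rng G) q"
      using U by (auto simp: open_bisection_def)
    have "g = q (rng G g)" using q g by (simp add: homeomorphism_def W_def)
    also have "\<dots> = q (rng G (rng G g))" by (simp add: rng_rng)
    also have "\<dots> = rng G g" using q g by (simp add: homeomorphism_def W_def)
    finally show "g \<in> units G" by (simp add: units_iff)
  qed
  ultimately show "\<exists>T. open T \<and> x \<in> T \<and> T \<subseteq> units G" by blast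
qed

lemma closed_units: "closed (units G)"
  by (rule compact_imp_closed[OF compact_units])

text \<open>Locally compact Hausdorff spaces are completely regular. Compactness of the support is
  not asserted, as \<open>u\<close> will only multiply functions in \<open>Cc\<close>.\<close>

lemma bump:
  assumes "open U" "g \<in> U"
  shows "\<exists>u :: 'g \<Rightarrow> real. continuous_on UNIV u \<and> u g = 1 \<and> (\<forall>h. 0 \<le> u h) \<and>
    closure {h. u h \<noteq> 0} \<subseteq> U"
proof -
  have haus: "Hausdorff_space (euclidean :: 'g topology)"
    unfolding Hausdorff_space_def
  proof (intro allI impI)
    fix x y :: 'g assume "x \<in> topspace euclidean \<and> y \<in> topspace euclidean \<and> x \<noteq> y"
    then have "x \<noteq> y" by simp
    from hausdorff[OF this]
    show "\<exists>U V. openin euclidean U \<and> openin euclidean V \<and> x \<in> U \<and> y \<in> V \<and> disjnt U V"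
      by (simp add: disjnt_def)
  qed
  have "locally_compact_space (euclidean :: 'g topology)"
    unfolding locally_compact_space_def
  proof
    fix x :: 'g
    have "\<exists>u v. openin (top_of_set UNIV) u \<and> compact v \<and> x \<in> u \<and> u \<subseteq> v \<and> v \<subseteq> UNIV"
      using locally_compact[unfolded locally_def, rule_format, of UNIV x] by simp
    then show "\<exists>U K. openin euclidean U \<and> compactin euclidean K \<and> x \<in> U \<and> U \<subseteq> K" by auto
  qed
  then have "completely_regular_space (euclidean :: 'g topology)"
    using locally_compact_Hausdorff_imp_regular_space[OF _ haus]
      locally_compact_regular_imp_completely_regular_space by blast
  then obtain f :: "'g \<Rightarrow> real" where f: "continuous_map euclidean (top_of_set {0..1}) f"
    "f g = 0" "f ` (- U) \<subseteq> {1}"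
    unfolding completely_regular_space_def using assms by (metis Compl_iff DiffI UNIV_I closed_Compl
      closed_closedin topspace_euclidean)
  have cf: "continuous_on UNIV f" using f(1) by (simp add: continuous_map_in_subtopology)
  \<comment> \<open>Cutting off at level 1/2 leaves room for the closure of the nonvanishing set,
    which stays in \<open>{h. f h \<le> 1/2}\<close>.\<close>
  define u where "u h = max 0 (1 - 2 * f h)" for h
  have "closure {h. u h \<noteq> 0} \<subseteq> {h. f h \<le> 1/2}"
    by (rule closure_minimal) (auto simp: u_def max_def intro!: closed_Collect_le cf continuous_intros)
  also have "\<dots> \<subseteq> U" using f(3) by fastforce
  finally have "closure {h. u h \<noteq> 0} \<subseteq> U" .
  moreover have "continuous_on UNIV u" unfolding u_def by (intro continuous_intros cf)
  ultimately show ?thesis using f(2) by (intro exI[of _ u]) (auto simp: u_def)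
qed

lemma Cc_ginv: assumes "f \<in> Cc" shows "(\<lambda>g. f (ginv G g)) \<in> Cc"
proof (rule CcI[of _ "ginv G ` supp f"])
  show "continuous_on UNIV (\<lambda>g. f (ginv G g))"
    by (rule continuous_on_compose2[OF Cc_cont[OF assms] continuous_inv]) auto
  show "compact (ginv G ` supp f)"
    by (rule compact_continuous_image[OF continuous_on_subset[OF continuous_inv] Cc_compact[OF assms]]) auto
  fix g assume "g \<notin> ginv G ` supp f"
  then have "ginv G g \<notin> supp f" by (metis ginv_ginv image_eqI)
  then show "f (ginv G g) = 0" by (rule supp_zero)
qed

lemma Cc_star: "f \<in> Cc \<Longrightarrow> star G f \<in> Cc"
  unfolding star_def[abs_def] by (intro Cc_cnj Cc_ginv)

lemma continuous_on_units:
  fixes f :: "'g \<Rightarrow> complex"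
  shows "continuous_on (units G) f \<Longrightarrow> continuous_on UNIV (\<lambda>g. if g \<in> units G then f g else 0)"
proof -
  assume f: "continuous_on (units G) f"
  have "continuous_on (units G \<union> - units G) (\<lambda>g. if g \<in> units G then f g else 0)"
  proof (rule continuous_on_open_Un)
    show "continuous_on (units G) (\<lambda>g. if g \<in> units G then f g else 0)"
      by (rule continuous_on_eq[OF f]) simp
    show "continuous_on (- units G) (\<lambda>g. if g \<in> units G then f g else 0)"
      by (rule continuous_on_eq[of _ "\<lambda>_. 0"]) auto
  qed (use open_units closed_units in auto)
  then show ?thesis by simp
qed

lemma Cc_units: "continuous_on (units G) f \<Longrightarrow> (\<lambda>g. if g \<in> units G then f g else 0) \<in> Cc"
  by (rule CcI[OF continuous_on_units compact_units]) auto

lemma conv_one_Cc: "conv_one G \<in> Cc"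
  unfolding conv_one_def[abs_def] by (rule Cc_units) auto

lemma bisection_basis:
  assumes "open W" "g \<in> W" obtains U where "open_bisection G U" "g \<in> U" "U \<subseteq> W"
  using topological_basisE[OF basis_open_bisections assms] by blast

lemma bisection_rng_inj: "open_bisection G U \<Longrightarrow> g \<in> U \<Longrightarrow> h \<in> U \<Longrightarrow> rng G g = rng G h \<Longrightarrow> g = h"
  unfolding open_bisection_def homeomorphism_def by metis

lemma bisection_src_inj: "open_bisection G U \<Longrightarrow> g \<in> U \<Longrightarrow> h \<in> U \<Longrightarrow> src G g = src G h \<Longrightarrow> g = h"
  unfolding open_bisection_def homeomorphism_def by metis

text \<open>Finitely many bisections cover a compact set, and each of them meets a range fibre at
  most once.\<close>

lemma finite_rfibre_compact:
  assumes "compact C" shows "finite (rfibre G x \<inter> C)"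
proof -
  have "\<forall>g\<in>C. \<exists>U. open_bisection G U \<and> g \<in> U" using bisection_basis[OF open_UNIV UNIV_I] by metis
  then obtain U where U: "\<And>g. g \<in> C \<Longrightarrow> open_bisection G (U g)" "\<And>g. g \<in> C \<Longrightarrow> g \<in> U g" by metis
  then have "\<And>g. g \<in> C \<Longrightarrow> open (U g)" "C \<subseteq> (\<Union>g\<in>C. U g)" by (auto simp: open_bisection_def)
  then obtain D where D: "D \<subseteq> C" "finite D" "C \<subseteq> (\<Union>g\<in>D. U g)"
    using compactE_image[OF assms] by metis
  have "finite (rfibre G x \<inter> U g)" if "g \<in> D" for g
  proof (cases "rfibre G x \<inter> U g = {}")
    case False
    then obtain h where "h \<in> rfibre G x \<inter> U g" by blast
    then have "rfibre G x \<inter> U g \<subseteq> {h}"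
      using bisection_rng_inj[OF U(1)] D that by (fastforce simp: rfibre_def)
    then show ?thesis using finite_subset by blast
  qed simp
  then have "finite (\<Union>g\<in>D. rfibre G x \<inter> U g)" using D by blast
  then show ?thesis by (rule rev_finite_subset) (use D in auto)
qed

lemma finite_rfibre: "f \<in> Cc \<Longrightarrow> finite {g \<in> rfibre G x. f g \<noteq> 0}"
  by (rule finite_subset[OF _ finite_rfibre_compact[OF Cc_compact, of f x]]) (use supp_zero in blast)

lemma finite_rfibre_ldiv:
  assumes "f \<in> Cc" shows "finite {h \<in> rfibre G (rng G l). f (ldiv l h) \<noteq> 0}"
proof -
  have "ldiv l ` {h \<in> rfibre G (rng G l). f (ldiv l h) \<noteq> 0} \<subseteq> {g \<in> rfibre G (src G l). f g \<noteq> 0}"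
    using bij_ldiv[of l] by (auto simp: bij_betw_def)
  then have "finite (ldiv l ` {h \<in> rfibre G (rng G l). f (ldiv l h) \<noteq> 0})"
    using finite_rfibre[OF assms] finite_subset by blast
  then show ?thesis
    by (rule finite_imageD) (rule inj_on_subset[OF bij_betw_imp_inj_on[OF bij_ldiv]], auto)
qed

lemma summable_rfibre_mult: "f \<in> Cc \<Longrightarrow> (\<lambda>g. f g * c g) summable_on rfibre G x"
  by (rule finite_nonzero_values_imp_summable_on, rule finite_subset[OF _ finite_rfibre[of f x]]) auto

lemma summable_rfibre: "f \<in> Cc \<Longrightarrow> f summable_on rfibre G x"
  using summable_rfibre_mult[of f "\<lambda>_. 1"] by simp

lemma conv_add_left:
  "f \<in> Cc \<Longrightarrow> f' \<in> Cc \<Longrightarrow> conv G (\<lambda>g. f g + f' g) c g = conv G f c g + conv G f' c g"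
  unfolding conv_eq by (simp add: distrib_right infsum_add summable_rfibre_mult)

lemma conv_smult_left: "conv G (\<lambda>g. a * f g) c g = a * conv G f c g"
  unfolding conv_eq by (simp add: mult.assoc infsum_cmult_right')

lemma conv_diff_left:
  "f \<in> Cc \<Longrightarrow> f' \<in> Cc \<Longrightarrow> conv G (\<lambda>g. f g - f' g) c g = conv G f c g - conv G f' c g"
  using conv_add_left[OF _ Cc_smult[of f' "-1"], of f c g] conv_smult_left[of "-1" f' c g] by simp

text \<open>Partitions of unity reduce statements on \<open>Cc\<close> to functions supported in a bisection.\<close>

lemma Cc_induct [consumes 1, case_names bisection add]:
  assumes f: "f \<in> Cc"
    and bis: "\<And>f U. f \<in> Cc \<Longrightarrow> open_bisection G U \<Longrightarrow> supp f \<subseteq> U \<Longrightarrow> P f"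
    and add: "\<And>f f'. f \<in> Cc \<Longrightarrow> f' \<in> Cc \<Longrightarrow> P f \<Longrightarrow> P f' \<Longrightarrow> P (\<lambda>g. f g + f' g)"
  shows "P f"
proof -
  have "\<forall>g. \<exists>u :: 'g \<Rightarrow> real. continuous_on UNIV u \<and> u g = 1 \<and> (\<forall>h. 0 \<le> u h) \<and>
    (\<exists>U. open_bisection G U \<and> closure {h. u h \<noteq> 0} \<subseteq> U)"
  proof
    fix g
    obtain U where U: "open_bisection G U" "g \<in> U" using bisection_basis[OF open_UNIV UNIV_I] by metis
    then have "open U" by (simp add: open_bisection_def)
    from bump[OF this U(2)] U(1) show "\<exists>u :: 'g \<Rightarrow> real. continuous_on UNIV u \<and> u g = 1 \<and> (\<forall>h. 0 \<le> u h) \<and>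
      (\<exists>U. open_bisection G U \<and> closure {h. u h \<noteq> 0} \<subseteq> U)" by metis
  qed
  then obtain u :: "'g \<Rightarrow> 'g \<Rightarrow> real" where u: "\<And>g. continuous_on UNIV (u g)" "\<And>g. u g g = 1"
      "\<And>g h. 0 \<le> u g h" "\<And>g. \<exists>U. open_bisection G U \<and> closure {h. u g h \<noteq> 0} \<subseteq> U"
    by metis
  have "0 < u g g" for g using u(2)[of g] by simp
  then have "supp f \<subseteq> (\<Union>g\<in>supp f. {h. 0 < u g h})" by blast
  moreover have "open {h. 0 < u g h}" for g by (intro open_Collect_less continuous_intros u)
  ultimately obtain D where D: "D \<subseteq> supp f" "finite D" "supp f \<subseteq> (\<Union>g\<in>D. {h. 0 < u g h})"
    using compactE_image[OF Cc_compact[OF f]] by metis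
  define s where "s h = (\<Sum>g\<in>D. u g h)" for h
  have s_cont: "continuous_on UNIV s" unfolding s_def[abs_def] by (intro continuous_intros u)
  have s_pos: "0 < s h" if h: "h \<in> supp f" for h
  proof -
    obtain g where "g \<in> D" "0 < u g h" using D h by blast
    then show ?thesis unfolding s_def using D u(3) by (intro sum_pos2) auto
  qed
  define F where "F g h = f h * of_real (u g h / s h)" for g h
  have F_cont: "continuous_on UNIV (F g)" for g
  proof -
    \<comment> \<open>The quotient \<open>u g h / s h\<close> may be discontinuous where
      \<open>s\<close> vanishes, but such points lie outside \<open>supp f\<close>, where the
      product is 0.\<close>
    have "continuous_on ({h. 0 < s h} \<union> - supp f) (F g)"
    proof (rule continuous_on_open_Un)
      show "open {h. 0 < s h}" by (intro open_Collect_less continuous_intros s_cont)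
      show "open (- supp f)" by (auto simp: supp_def)
      show "continuous_on {h. 0 < s h} (F g)" unfolding F_def
        by (intro continuous_intros continuous_on_subset[OF Cc_cont[OF f]]
            continuous_on_subset[OF u(1)] continuous_on_subset[OF s_cont]) auto
      have "continuous_on (- supp f) (\<lambda>_. 0 :: complex)" by simp
      then show "continuous_on (- supp f) (F g)"
        by (rule continuous_on_eq) (simp add: F_def supp_zero)
    qed
    moreover have "{h. 0 < s h} \<union> - supp f = UNIV" using s_pos by auto
    ultimately show ?thesis by simp
  qed
  have F_Cc: "F g \<in> Cc" for g
    by (rule CcI[OF F_cont Cc_compact[OF f]]) (simp add: F_def supp_zero)
  have F_P: "P (F g)" for g
  proof -
    obtain U where U: "open_bisection G U" "closure {h. u g h \<noteq> 0} \<subseteq> U" using u(4) by blast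
    have "supp (F g) \<subseteq> closure {h. u g h \<noteq> 0}" unfolding supp_def
      by (rule closure_mono) (auto simp: F_def)
    then show ?thesis using bis[OF F_Cc U(1)] U(2) by blast
  qed
  have P0: "P (\<lambda>_. 0)"
  proof -
    obtain U where U: "open_bisection G U" using u(4) by blast
    show ?thesis by (rule bis[OF Cc_zero U]) (simp add: supp_def)
  qed
  have "P (\<lambda>h. \<Sum>g\<in>E. F g h)" if "finite E" for E
    using that
  proof (induction E rule: finite_induct)
    case (insert g E)
    then show ?case using add[OF F_Cc Cc_sum[of E F]] F_Cc F_P by simp
  qed (simp add: P0)
  from this[OF D(2)] have "P (\<lambda>h. \<Sum>g\<in>D. F g h)" .
  moreover have "(\<lambda>h. \<Sum>g\<in>D. F g h) = f"
  proof
    fix h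
    have "(\<Sum>g\<in>D. F g h) = f h * of_real (\<Sum>g\<in>D. u g h / s h)"
      unfolding F_def by (simp only: sum_distrib_left of_real_sum)
    also have "(\<Sum>g\<in>D. u g h / s h) = s h / s h"
      unfolding s_def by (simp only: sum_divide_distrib)
    finally have "(\<Sum>g\<in>D. F g h) = f h * of_real (s h / s h)" .
    then show "(\<Sum>g\<in>D. F g h) = f h"
      using s_pos[of h] supp_zero[of h f] by (cases "h \<in> supp f") auto
  qed
  ultimately show ?thesis by simp
qed

text \<open>For \<open>f\<close> supported in a bisection at most one term of the fibre sum
  survives, and it varies continuously through the local inverse \<open>q\<close> of the range map.
  Only continuity of \<open>c\<close> is assumed, because \<open>c\<close> will be a function of
  positive type or the constant 1.\<close>

lemma conv_cont:
  assumes "f \<in> Cc" "continuous_on UNIV c" shows "continuous_on UNIV (conv G f c)"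
  using assms(1)
proof (induction rule: Cc_induct)
  case (add f f')
  then show ?case using conv_add_left[OF add(1,2)] continuous_on_add[OF add(3,4)] by (simp cong: continuous_on_cong)
next
  case (bisection f U)
  obtain q where q: "homeomorphism U (rng G ` U) (rng G) q"
    and op: "openin (top_of_set (units G)) (rng G ` U)"
    using bisection by (auto simp: open_bisection_def)
  have opU: "open (rng G ` U)" using op open_units openin_open_eq by blast
  have single: "conv G f c g = f (q (rng G g)) * c (ldiv (q (rng G g)) g)" if "rng G g \<in> rng G ` U" for g
  proof -
    have qU: "q (rng G g) \<in> U" "rng G (q (rng G g)) = rng G g"
      using q that by (auto simp: homeomorphism_def)
    have "conv G f c g = infsum (\<lambda>h. f h * c (ldiv h g)) {q (rng G g)}"
      unfolding conv_eq
    proof (rule infsum_cong_neutral)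
      fix h assume h: "h \<in> rfibre G (rng G g) - {q (rng G g)}"
      then have "h \<notin> U" using bisection_rng_inj[OF bisection(2) _ qU(1)] qU(2) by (auto simp: rfibre_def)
      then show "f h * c (ldiv h g) = 0" using bisection(3) supp_zero[of h f] by auto
    qed (use qU in \<open>auto simp: rfibre_def\<close>)
    then show ?thesis by simp
  qed
  \<comment> \<open>Over \<open>?A\<close> the single-term formula holds, and over \<open>?B\<close>
    the sum is empty. Compactness of \<open>supp f\<close> makes \<open>?B\<close> open, and
    \<open>supp f \<subseteq> U\<close> makes the two sets cover \<open>G\<close>.\<close>
  let ?A = "rng G -` (rng G ` U)" and ?B = "rng G -` (- (rng G ` supp f))"
  have "continuous_on (?A \<union> ?B) (conv G f c)"
  proof (rule continuous_on_open_Un)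
    show "open ?A" by (rule open_vimage[OF opU continuous_rng])
    have "compact (rng G ` supp f)"
      by (rule compact_continuous_image[OF continuous_on_subset[OF continuous_rng] Cc_compact[OF bisection(1)]]) simp
    then show "open ?B" by (intro open_vimage continuous_rng open_Compl compact_imp_closed)
    have "continuous_on ?A (\<lambda>g. q (rng G g))"
      by (rule continuous_on_compose2[of "rng G ` U" q])
        (use q in \<open>auto simp: homeomorphism_def intro: continuous_on_subset[OF continuous_rng]\<close>)
    note cq = this
    have ci: "continuous_on ?A (\<lambda>g. ginv G (q (rng G g)))"
      by (rule continuous_on_compose2[OF continuous_inv cq]) auto
    have "continuous_on ?A (\<lambda>g. (\<lambda>(g, h). gmult G g h) (ginv G (q (rng G g)), g))"
      by (rule continuous_on_compose2[OF continuous_mult continuous_on_Pair[OF ci continuous_on_id]])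
        (use q in \<open>auto simp: composable_def src_inv homeomorphism_def\<close>)
    then have cl: "continuous_on ?A (\<lambda>g. ldiv (q (rng G g)) g)" by simp
    have "continuous_on ?A (\<lambda>g. f (q (rng G g)) * c (ldiv (q (rng G g)) g))"
      by (intro continuous_on_mult continuous_on_compose2[OF Cc_cont[OF bisection(1)] cq]
          continuous_on_compose2[OF assms(2) cl]) auto
    then show "continuous_on ?A (conv G f c)"
      by (rule continuous_on_eq) (use single in auto)
    have "continuous_on ?B (\<lambda>_. 0 :: complex)" by simp
    moreover have "conv G f c g = 0" if "g \<in> ?B" for g
      unfolding conv_eq
    proof (rule infsum_0)
      fix h assume h: "h \<in> rfibre G (rng G g)"
      then have "h \<notin> supp f" using that by (auto simp: rfibre_def image_iff)
      then show "f h * c (ldiv h g) = 0" by (simp add: supp_zero)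
    qed
    ultimately show "continuous_on ?B (conv G f c)" by (metis (no_types, lifting) continuous_on_eq)
  qed
  moreover have "?A \<union> ?B = UNIV" using image_mono[OF bisection(3), of "rng G"] by blast
  ultimately show ?case by simp
qed

text \<open>A nonzero value at \<open>g\<close> exhibits \<open>g\<close> as a product of a
  composable pair from the two supports. Composability is a closed condition, so these pairs form a
  compact set.\<close>

lemma conv_Cc: assumes "f \<in> Cc" "c \<in> Cc" shows "conv G f c \<in> Cc"
proof (rule CcI[OF conv_cont[OF assms(1) Cc_cont[OF assms(2)]]])
  let ?K = "(supp f \<times> supp c) \<inter> composable G"
  have "closed (composable G)" unfolding composable_def case_prod_unfold
    by (intro closed_Collect_eq continuous_on_compose2[OF continuous_rng]
        continuous_on_compose2[OF continuous_src] continuous_intros) auto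
  then have "compact ?K" by (intro compact_Int_closed compact_Times Cc_compact assms)
  then show "compact ((\<lambda>(g, h). gmult G g h) ` ?K)"
    by (intro compact_continuous_image continuous_on_subset[OF continuous_mult]) auto
  fix g assume g: "g \<notin> (\<lambda>(g, h). gmult G g h) ` ?K"
  show "conv G f c g = 0" unfolding conv_eq
  proof (rule infsum_0)
    fix h assume h: "h \<in> rfibre G (rng G g)"
    then have "(h, ldiv h g) \<in> composable G" "gmult G h (ldiv h g) = g"
      by (auto simp: rfibre_def composable_def rng_ldiv mult_ldiv)
    then have "\<not> (h \<in> supp f \<and> ldiv h g \<in> supp c)" using g by force
    then show "f h * c (ldiv h g) = 0" using supp_zero by auto
  qed
qed

text \<open>Here the second factor is the constant function 1 on \<open>G\<close>, not the unit
  \<open>conv_one\<close>. This makes \<open>Psi\<close> an instance of convolution, to which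
  \<open>conv_cont\<close> and \<open>conv_assoc\<close> apply.\<close>

lemma conv_one_right: "conv G f (\<lambda>_. 1) g = (\<Sum>\<^sub>\<infinity>h\<in>rfibre G (rng G g). f h)"
  by (simp add: conv_eq)

lemma Psi_Cc: assumes "f \<in> Cc" shows "Psi G f \<in> Cc"
proof -
  have "Psi G f = (\<lambda>g. if g \<in> units G then conv G f (\<lambda>_. 1) g else 0)"
    by (auto simp: Psi_def conv_one_right units_iff)
  moreover have "\<dots> \<in> Cc"
    by (intro Cc_units continuous_on_subset[OF conv_cont[OF assms]]) auto
  ultimately show ?thesis by simp
qed

text \<open>The supports of \<open>f\<close> and \<open>a\<close> already make the double sum
  finite, so \<open>c\<close> is arbitrary and may be \<open>phi\<close> or the constant 1.\<close>

lemma conv_assoc: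
  assumes "f \<in> Cc" "a \<in> Cc" shows "conv G (conv G f a) c g = conv G f (conv G a c) g"
proof -
  let ?R = "rfibre G (rng G g)"
  have "conv G (conv G f a) c g = (\<Sum>\<^sub>\<infinity>h\<in>?R. \<Sum>\<^sub>\<infinity>l\<in>?R. f l * a (ldiv l h) * c (ldiv h g))"
    unfolding conv_eq by (intro infsum_cong) (simp add: rfibre_def infsum_cmult_left')
  also have "\<dots> = (\<Sum>\<^sub>\<infinity>l\<in>?R. \<Sum>\<^sub>\<infinity>h\<in>?R. f l * a (ldiv l h) * c (ldiv h g))"
  proof (rule infsum_swap_finite[symmetric])
    show "finite {l \<in> ?R. \<exists>h\<in>?R. f l * a (ldiv l h) * c (ldiv h g) \<noteq> 0}"
      by (rule finite_subset[OF _ finite_rfibre[OF assms(1)]]) auto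
    fix l assume "l \<in> ?R"
    then show "finite {h \<in> ?R. f l * a (ldiv l h) * c (ldiv h g) \<noteq> 0}"
      by (intro finite_subset[OF _ finite_rfibre_ldiv[OF assms(2), of l]]) (auto simp: rfibre_def)
  qed
  also have "\<dots> = (\<Sum>\<^sub>\<infinity>l\<in>?R. f l * conv G a c (ldiv l g))"
  proof (rule infsum_cong)
    fix l assume l: "l \<in> ?R"
    then have rl: "rng G l = rng G g" by (simp add: rfibre_def)
    have "(\<Sum>\<^sub>\<infinity>h\<in>?R. a (ldiv l h) * c (ldiv h g))
      = (\<Sum>\<^sub>\<infinity>h\<in>rfibre G (rng G l). a (ldiv l h) * c (ldiv (ldiv l h) (ldiv l g)))"
      using rl by (intro infsum_cong_neutral) (auto simp: rfibre_def ldiv_ldiv)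
    also have "\<dots> = (\<Sum>\<^sub>\<infinity>m\<in>rfibre G (src G l). a m * c (ldiv m (ldiv l g)))"
      by (rule infsum_reindex_bij_betw[OF bij_ldiv, of "\<lambda>m. a m * c (ldiv m (ldiv l g))"])
    finally have "(\<Sum>\<^sub>\<infinity>h\<in>?R. a (ldiv l h) * c (ldiv h g)) = conv G a c (ldiv l g)"
      by (simp add: conv_eq rng_ldiv rl)
    then show "(\<Sum>\<^sub>\<infinity>h\<in>?R. f l * a (ldiv l h) * c (ldiv h g)) = f l * conv G a c (ldiv l g)"
      by (simp add: mult.assoc infsum_cmult_right')
  qed
  finally show ?thesis by (simp add: conv_eq)
qed

section \<open>Functions supported on the units, and the involution\<close>

lemma conv_unit_supported:
  assumes "\<And>g. g \<notin> units G \<Longrightarrow> p g = 0"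
  shows "conv G p c g = p (rng G g) * c g"
proof -
  have "conv G p c g = infsum (\<lambda>h. p h * c (ldiv h g)) {rng G g}"
    unfolding conv_eq
    by (rule infsum_cong_neutral) (use assms in \<open>auto simp: rfibre_def rng_rng units_iff\<close>)
  then show ?thesis by (simp add: ldiv_unit)
qed

lemma conv_one_left: "conv G (conv_one G) c = c"
  using conv_unit_supported[of "conv_one G" c] by (auto simp: conv_one_def)

lemma star_conv:
  "star G (conv G f a) g = conv G (star G a) (star G f) g"
proof -
  have "star G (conv G f a) g = (\<Sum>\<^sub>\<infinity>h\<in>rfibre G (src G g). cnj (f h) * cnj (a (ldiv h (ginv G g))))"
    by (simp add: star_def conv_eq rng_inv flip: infsum_cnj)
  also have "\<dots> = (\<Sum>\<^sub>\<infinity>h\<in>rfibre G (rng G g). cnj (f (ldiv g h)) * cnj (a (ldiv (ldiv g h) (ginv G g))))"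
    using infsum_reindex_bij_betw[OF bij_ldiv[of g], of "\<lambda>h. cnj (f h) * cnj (a (ldiv h (ginv G g)))"] by simp
  also have "\<dots> = (\<Sum>\<^sub>\<infinity>h\<in>rfibre G (rng G g). star G a h * star G f (ldiv h g))"
  proof (rule infsum_cong)
    fix h assume "h \<in> rfibre G (rng G g)"
    then have h: "rng G h = rng G g" by (simp add: rfibre_def)
    have "ldiv (ldiv g h) (ginv G g) = gmult G (ldiv h g) (ginv G g)" using h by (simp add: ginv_ldiv)
    also have "\<dots> = gmult G (ginv G h) (gmult G g (ginv G g))"
      by (rule mult_assoc) (simp_all add: src_inv rng_inv h)
    also have "\<dots> = ginv G h" by (metis h mult_inv_right src_inv src_mult_right)
    finally have "ldiv (ldiv g h) (ginv G g) = ginv G h" .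
    moreover have "ldiv g h = ginv G (ldiv h g)" using h by (simp add: ginv_ldiv)
    ultimately show "cnj (f (ldiv g h)) * cnj (a (ldiv (ldiv g h) (ginv G g))) = star G a h * star G f (ldiv h g)"
      by (simp add: star_def)
  qed
  finally show ?thesis by (simp add: conv_eq)
qed

lemma star_star [simp]: "star G (star G f) = f"
  by (auto simp: star_def)

lemma star_conv_one [simp]: "star G (conv_one G) = conv_one G"
proof
  fix g show "star G (conv_one G) g = conv_one G g"
    using ginv_unit[of g] ginv_unit[of "ginv G g"] by (auto simp: star_def conv_one_def)
qed

lemma conv_one_right_unit: "conv G f (conv_one G) = f"
proof
  fix g
  have "conv G f (conv_one G) g = infsum (\<lambda>h. f h * conv_one G (ldiv h g)) {g}"
    unfolding conv_eq
  proof (rule infsum_cong_neutral)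
    fix h assume h: "h \<in> rfibre G (rng G g) - {g}"
    then have rh: "rng G h = rng G g" by (simp add: rfibre_def)
    have "ldiv h g \<notin> units G"
    proof
      assume "ldiv h g \<in> units G"
      then have "ldiv h g = src G h" using rng_ldiv[OF rh] by (simp add: units_iff)
      then have "g = h" using mult_ldiv[OF rh] src_mult_right[of h] by simp
      then show False using h by simp
    qed
    then show "f h * conv_one G (ldiv h g) = 0" by (simp add: conv_one_def)
  qed (auto simp: rfibre_def)
  then show "conv G f (conv_one G) g = f g" by (simp add: ldiv_self conv_one_def)
qed

lemma star_unit_supported:
  assumes "\<And>g. g \<notin> units G \<Longrightarrow> p g = 0" shows "star G p = (\<lambda>g. cnj (p g))"
proof
  fix g show "star G p g = cnj (p g)"
  proof (cases "g \<in> units G")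
    case True
    then show ?thesis by (simp add: star_def ginv_unit)
  next
    case False
    then have "ginv G g \<notin> units G" using ginv_unit[of "ginv G g"] by auto
    then show ?thesis using False assms by (simp add: star_def)
  qed
qed

end

section \<open>Integration against an invariant probability measure\<close>

locale measured_groupoid = lc_etale_groupoid G for G :: "'g::t2_space groupoid" +
  fixes \<mu> :: "'g measure"
  assumes invariant_probability: "invariant_probability G \<mu>"
begin

text \<open>Integration over \<open>G\<close> against the measure formed from \<open>\<mu>\<close>
  and the counting measures on the range fibres.\<close>

definition I :: "('g \<Rightarrow> complex) \<Rightarrow> complex" where
  "I f = (LINT x|\<mu>. Psi G f x)"

lemma prob_space_mu: "prob_space \<mu>"
  using invariant_probability by (simp add: invariant_probability_def radon_probability_on_def)

lemma sets_mu: "sets \<mu> = sets (restrict_space borel (units G))"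
  using invariant_probability by (simp add: invariant_probability_def radon_probability_on_def)

lemma space_mu: "space \<mu> = units G"
  using sets_eq_imp_space_eq[OF sets_mu] by (simp add: space_restrict_space)

lemma units_bounded:
  fixes c :: "'g \<Rightarrow> 'b::real_normed_vector"
  assumes "continuous_on UNIV c" shows "\<exists>C\<ge>0. \<forall>x\<in>units G. norm (c x) \<le> C"
proof -
  have "bounded (c ` units G)"
    by (intro compact_imp_bounded compact_continuous_image compact_units continuous_on_subset[OF assms]) simp
  then obtain C where C: "\<forall>x\<in>units G. norm (c x) \<le> C" by (auto simp: bounded_iff)
  then have "\<forall>x\<in>units G. norm (c x) \<le> max 0 C" by force
  then show ?thesis by (intro exI[of _ "max 0 C"]) simp
qed

lemma Cc_bounded: assumes "f \<in> Cc" shows "\<exists>C\<ge>0. \<forall>g::'g. cmod (f g) \<le> C"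
proof -
  have "bounded (f ` supp f)"
    by (intro compact_imp_bounded compact_continuous_image Cc_compact assms continuous_on_subset[OF Cc_cont[OF assms]]) simp
  then obtain C where C: "\<forall>x\<in>supp f. cmod (f x) \<le> C" by (auto simp: bounded_iff)
  have "cmod (f g) \<le> max 0 C" for g
    using C supp_zero[of g f] by (cases "g \<in> supp f") (auto simp: le_max_iff_disj)
  then show ?thesis by (intro exI[of _ "max 0 C"]) simp
qed

lemma integrable_units:
  fixes c :: "'g \<Rightarrow> 'b::{banach, second_countable_topology}"
  assumes "continuous_on UNIV c" shows "integrable \<mu> c"
proof -
  interpret prob_space \<mu> by (rule prob_space_mu)
  obtain C where C: "\<forall>x\<in>units G. norm (c x) \<le> C" using units_bounded[OF assms] by blast
  have "c \<in> borel_measurable (restrict_space borel (units G))"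
    by (intro measurable_restrict_space1 borel_measurable_continuous_onI assms)
  then have "c \<in> borel_measurable \<mu>" using measurable_cong_sets[OF sets_mu refl] by blast
  then show ?thesis
    by (rule integrable_const_bound[of _ C, rotated]) (use C in \<open>auto simp: space_mu intro!: AE_I2\<close>)
qed

lemma integrable_Psi: "f \<in> Cc \<Longrightarrow> integrable \<mu> (Psi G f)"
  by (intro integrable_units Cc_cont Psi_Cc)

section \<open>Linearity and positivity of \<open>Psi\<close> and \<open>I\<close>\<close>

lemma Psi_add: "f \<in> Cc \<Longrightarrow> f' \<in> Cc \<Longrightarrow> Psi G (\<lambda>g. f g + f' g) x = Psi G f x + Psi G f' x"
  by (simp add: Psi_def infsum_add summable_rfibre)

lemma Psi_smult: "Psi G (\<lambda>g. c * f g) x = c * Psi G f x"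
  by (simp add: Psi_def infsum_cmult_right')

lemma Psi_cnj: "Psi G (\<lambda>g. cnj (f g)) x = cnj (Psi G f x)"
  by (simp add: Psi_def)

lemma Psi_rng_mult: "x \<in> units G \<Longrightarrow> Psi G (\<lambda>g. p (rng G g) * f g) x = p x * Psi G f x"
proof -
  assume "x \<in> units G"
  moreover have "(\<Sum>\<^sub>\<infinity>g\<in>rfibre G x. p (rng G g) * f g) = (\<Sum>\<^sub>\<infinity>g\<in>rfibre G x. p x * f g)"
    by (rule infsum_cong) (simp add: rfibre_def)
  ultimately show ?thesis by (simp add: Psi_def infsum_cmult_right')
qed

lemma Re_Psi_nonneg: assumes "f \<in> Cc" "\<And>g. 0 \<le> Re (f g)" shows "0 \<le> Re (Psi G f x)"
proof -
  have "Re (\<Sum>\<^sub>\<infinity>g\<in>rfibre G x. f g) = (\<Sum>\<^sub>\<infinity>g\<in>rfibre G x. Re (f g))"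
    by (rule infsum_Re[OF summable_rfibre[OF assms(1)], symmetric])
  also have "\<dots> \<ge> 0" using assms by (intro infsum_nonneg)
  finally show ?thesis by (simp add: Psi_def)
qed

lemma Psi_norm: assumes "f \<in> Cc" shows "cmod (Psi G f x) \<le> Re (Psi G (\<lambda>g. of_real (cmod (f g))) x)"
proof -
  have s: "(\<lambda>g. cmod (f g)) summable_on rfibre G x"
    by (rule finite_nonzero_values_imp_summable_on) (use finite_rfibre[OF assms] in simp)
  have "cmod (\<Sum>\<^sub>\<infinity>g\<in>rfibre G x. f g) \<le> (\<Sum>\<^sub>\<infinity>g\<in>rfibre G x. cmod (f g))"
    by (rule norm_infsum_bound[OF s])
  also have "\<dots> = Re (\<Sum>\<^sub>\<infinity>g\<in>rfibre G x. of_real (cmod (f g)))"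
    using infsum_Re[OF summable_rfibre[OF Cc_norm[OF assms]], of x] by simp
  finally show ?thesis by (simp add: Psi_def)
qed

lemma I_cong: "(\<And>x. x \<in> units G \<Longrightarrow> Psi G f x = Psi G f' x) \<Longrightarrow> I f = I f'"
  unfolding I_def by (intro Bochner_Integration.integral_cong) (simp_all add: space_mu)

lemma I_add: "f \<in> Cc \<Longrightarrow> f' \<in> Cc \<Longrightarrow> I (\<lambda>g. f g + f' g) = I f + I f'"
proof -
  assume f: "f \<in> Cc" "f' \<in> Cc"
  have "Psi G (\<lambda>g. f g + f' g) = (\<lambda>x. Psi G f x + Psi G f' x)" using Psi_add[OF f] by blast
  then show ?thesis unfolding I_def using f by (simp add: integrable_Psi)
qed

lemma I_smult: "I (\<lambda>g. c * f g) = c * I f"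
proof -
  have "Psi G (\<lambda>g. c * f g) = (\<lambda>x. c * Psi G f x)" using Psi_smult by blast
  then show ?thesis unfolding I_def by simp
qed

lemma I_diff: "f \<in> Cc \<Longrightarrow> f' \<in> Cc \<Longrightarrow> I (\<lambda>g. f g - f' g) = I f - I f'"
  using I_add[OF _ Cc_smult[of f' "-1"], of f] I_smult[of "-1" f'] by simp

lemma I_cnj: "I (\<lambda>g. cnj (f g)) = cnj (I f)"
proof -
  have "Psi G (\<lambda>g. cnj (f g)) = (\<lambda>x. cnj (Psi G f x))" using Psi_cnj by blast
  then show ?thesis unfolding I_def by simp
qed

lemma Re_I_nonneg': assumes "f \<in> Cc" "\<And>x. x \<in> units G \<Longrightarrow> 0 \<le> Re (Psi G f x)" shows "0 \<le> Re (I f)"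
proof -
  have "Re (I f) = (LINT x|\<mu>. Re (Psi G f x))"
    unfolding I_def by (rule integral_Re[symmetric]) (rule integrable_Psi[OF assms(1)])
  also have "\<dots> \<ge> 0" by (rule Bochner_Integration.integral_nonneg) (use assms space_mu in auto)
  finally show ?thesis .
qed

lemma Re_I_nonneg: "f \<in> Cc \<Longrightarrow> (\<And>g. 0 \<le> Re (f g)) \<Longrightarrow> 0 \<le> Re (I f)"
  by (intro Re_I_nonneg' Re_Psi_nonneg)

lemma Re_I_mono: assumes "f \<in> Cc" "f' \<in> Cc" "\<And>g. Re (f g) \<le> Re (f' g)" shows "Re (I f) \<le> Re (I f')"
proof -
  have "0 \<le> Re (I (\<lambda>g. f' g - f g))" using assms by (intro Re_I_nonneg Cc_diff) auto
  then show ?thesis using assms by (simp add: I_diff)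
qed

lemma I_bound: assumes "f \<in> Cc" "\<And>x. x \<in> units G \<Longrightarrow> cmod (Psi G f x) \<le> C" shows "cmod (I f) \<le> C"
proof -
  interpret prob_space \<mu> by (rule prob_space_mu)
  have "cmod (I f) \<le> (LINT x|\<mu>. cmod (Psi G f x))"
    unfolding I_def by (rule integral_norm_bound)
  also have "\<dots> \<le> (LINT x|\<mu>. C)"
    by (rule integral_mono) (use assms integrable_Psi[OF assms(1)] space_mu in auto)
  finally have "cmod (I f) \<le> (LINT x|\<mu>. C)" .
  then show ?thesis by (simp add: prob_space)
qed

text \<open>Inversion carries source fibres to range fibres, so this is the invariance of
  \<open>\<mu>\<close>; the invariance equation is applied only here.\<close>

lemma I_ginv: assumes "f \<in> Cc" shows "I (\<lambda>g. f (ginv G g)) = I f"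
proof -
  have "I f = (LINT x|\<mu>. (\<Sum>\<^sub>\<infinity>g\<in>rfibre G x. f g))"
    unfolding I_def by (rule Bochner_Integration.integral_cong) (simp_all add: space_mu Psi_def)
  also have "\<dots> = (LINT x|\<mu>. (\<Sum>\<^sub>\<infinity>g\<in>sfibre G x. f g))"
    using invariant_probability assms by (simp add: invariant_probability_def)
  also have "\<dots> = I (\<lambda>g. f (ginv G g))"
    unfolding I_def infsum_sfibre
    by (rule Bochner_Integration.integral_cong) (simp_all add: space_mu Psi_def)
  finally show ?thesis by simp
qed

lemma Psi_unit_supported:
  assumes "\<And>g. g \<notin> units G \<Longrightarrow> f g = 0" "x \<in> units G" shows "Psi G f x = f x"
proof -
  have "(\<Sum>\<^sub>\<infinity>g\<in>rfibre G x. f g) = infsum f {x}"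
    by (rule infsum_cong_neutral) (use assms in \<open>auto simp: rfibre_def units_iff\<close>)
  then show ?thesis using assms by (simp add: Psi_def)
qed

lemma I_unit_supported:
  assumes "\<And>g. g \<notin> units G \<Longrightarrow> f g = 0" shows "I f = (LINT x|\<mu>. f x)"
  unfolding I_def
  by (rule Bochner_Integration.integral_cong) (simp_all add: space_mu Psi_unit_supported assms)

lemma Psi_of_real: "Psi G (\<lambda>g. of_real (h g)) x = of_real (Re (Psi G (\<lambda>g. of_real (h g)) x))"
  using Psi_cnj[of "\<lambda>g. of_real (h g)" x] by (simp add: complex_eq_iff)

lemma Psi_mono:
  assumes "f \<in> Cc" "f' \<in> Cc" "\<And>g. Re (f g) \<le> Re (f' g)" shows "Re (Psi G f x) \<le> Re (Psi G f' x)"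
proof -
  have "0 \<le> Re (Psi G (\<lambda>g. f' g + -1 * f g) x)"
    using assms by (intro Re_Psi_nonneg Cc_add Cc_smult) auto
  then show ?thesis using Psi_add[OF assms(2) Cc_smult[OF assms(1), of "-1"], of x]
    by (simp add: Psi_smult[of "-1" f, simplified])
qed

text \<open>Variances are nonnegative. This passes from second moments to means, both for the
  transported density and for the fibre norm of an error.\<close>

lemma integral_square_le:
  fixes Y :: "'g \<Rightarrow> real"
  assumes "continuous_on UNIV Y" shows "(LINT x|\<mu>. Y x)\<^sup>2 \<le> (LINT x|\<mu>. (Y x)\<^sup>2)"
proof -
  interpret prob_space \<mu> by (rule prob_space_mu)
  have "integrable \<mu> Y" "integrable \<mu> (\<lambda>x. (Y x)\<^sup>2)"
    by (intro integrable_units continuous_intros assms)+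
  from variance_eq[OF this] show ?thesis using variance_positive[of Y] by simp
qed

text \<open>Both sides are the integral over \<open>G\<close> of \<open>l \<mapsto> f l * conv G (cnj b) (c\<^sup>-\<^sup>1) l\<close>, evaluated with the two fibrations.\<close>

lemma I_conv_adjoint:
  assumes f: "f \<in> Cc" and b: "b \<in> Cc" and c: "continuous_on UNIV c"
  shows "I (\<lambda>h. cnj (b h) * conv G f c h) = I (\<lambda>h. cnj (conv G (star G f) b h) * c h)"
proof -
  define \<Theta> where "\<Theta> l = f l * conv G (\<lambda>h. cnj (b h)) (\<lambda>g. c (ginv G g)) l" for l
  have bc: "(\<lambda>h. cnj (b h)) \<in> Cc" using b by (rule Cc_cnj)
  have ci: "continuous_on UNIV (\<lambda>g. c (ginv G g))"
    by (rule continuous_on_compose2[OF c continuous_inv]) auto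
  have \<Theta>: "\<Theta> \<in> Cc" unfolding \<Theta>_def[abs_def] by (intro Cc_mult f conv_cont bc ci)
  have "I (\<lambda>h. cnj (b h) * conv G f c h) = I \<Theta>"
  proof (rule I_cong)
    fix x assume x: "x \<in> units G"
    let ?R = "rfibre G x"
    have "Psi G (\<lambda>h. cnj (b h) * conv G f c h) x = (\<Sum>\<^sub>\<infinity>h\<in>?R. cnj (b h) * (\<Sum>\<^sub>\<infinity>l\<in>?R. f l * c (ldiv l h)))"
      using x by (auto simp: Psi_def conv_eq rfibre_def intro!: infsum_cong)
    also have "\<dots> = (\<Sum>\<^sub>\<infinity>h\<in>?R. \<Sum>\<^sub>\<infinity>l\<in>?R. cnj (b h) * (f l * c (ldiv l h)))"
      by (simp add: infsum_cmult_right')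
    also have "\<dots> = (\<Sum>\<^sub>\<infinity>l\<in>?R. \<Sum>\<^sub>\<infinity>h\<in>?R. cnj (b h) * (f l * c (ldiv l h)))"
    proof (rule infsum_swap_finite)
      show "finite {h \<in> ?R. \<exists>l\<in>?R. cnj (b h) * (f l * c (ldiv l h)) \<noteq> 0}"
        by (rule finite_subset[OF _ finite_rfibre[OF b]]) auto
      show "finite {l \<in> ?R. cnj (b h) * (f l * c (ldiv l h)) \<noteq> 0}" for h
        by (rule finite_subset[OF _ finite_rfibre[OF f]]) auto
    qed
    also have "\<dots> = (\<Sum>\<^sub>\<infinity>l\<in>?R. \<Theta> l)"
    proof (rule infsum_cong)
      fix l assume "l \<in> ?R"
      then have "rng G l = x" by (simp add: rfibre_def)
      then show "(\<Sum>\<^sub>\<infinity>h\<in>?R. cnj (b h) * (f l * c (ldiv l h))) = \<Theta> l"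
        unfolding \<Theta>_def conv_ginv_eq by (simp add: mult.left_commute infsum_cmult_right')
    qed
    finally show "Psi G (\<lambda>h. cnj (b h) * conv G f c h) x = Psi G \<Theta> x"
      using x by (simp add: Psi_def)
  qed
  \<comment> \<open>In the source fibration the factor \<open>f (ginv G l)\<close> appears, which is
    what produces \<open>star G f\<close>.\<close>
  also have "\<dots> = I (\<lambda>l. \<Theta> (ginv G l))" by (rule I_ginv[OF \<Theta>, symmetric])
  also have "\<dots> = I (\<lambda>h. cnj (conv G (star G f) b h) * c h)"
  proof (rule I_cong)
    fix x assume x: "x \<in> units G"
    let ?R = "rfibre G x"
    have fi: "(\<lambda>l. f (ginv G l)) \<in> Cc" by (rule Cc_ginv[OF f])
    have "\<Theta> (ginv G l) = (\<Sum>\<^sub>\<infinity>h\<in>?R. f (ginv G l) * cnj (b (ldiv l h)) * c h)" if l: "l \<in> ?R" for l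
    proof -
      have rl: "rng G l = x" using l by (simp add: rfibre_def)
      have "\<Theta> (ginv G l) = f (ginv G l) * (\<Sum>\<^sub>\<infinity>h\<in>rfibre G (src G l). cnj (b h) * c (gmult G l h))"
        by (simp add: \<Theta>_def conv_ginv_eq rng_inv)
      also have "(\<Sum>\<^sub>\<infinity>h\<in>rfibre G (src G l). cnj (b h) * c (gmult G l h))
         = (\<Sum>\<^sub>\<infinity>h\<in>rfibre G (rng G l). cnj (b (ldiv l h)) * c (gmult G l (ldiv l h)))"
        by (rule infsum_reindex_bij_betw[OF bij_ldiv, symmetric])
      also have "\<dots> = (\<Sum>\<^sub>\<infinity>h\<in>?R. cnj (b (ldiv l h)) * c h)"
        unfolding rl by (rule infsum_cong) (simp add: rfibre_def mult_ldiv rl)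
      finally show ?thesis by (simp add: mult.assoc infsum_cmult_right')
    qed
    then have "Psi G (\<lambda>l. \<Theta> (ginv G l)) x
        = (\<Sum>\<^sub>\<infinity>l\<in>?R. \<Sum>\<^sub>\<infinity>h\<in>?R. f (ginv G l) * cnj (b (ldiv l h)) * c h)"
      using x by (auto simp: Psi_def intro!: infsum_cong)
    also have "\<dots> = (\<Sum>\<^sub>\<infinity>h\<in>?R. \<Sum>\<^sub>\<infinity>l\<in>?R. f (ginv G l) * cnj (b (ldiv l h)) * c h)"
    proof (rule infsum_swap_finite)
      show "finite {l \<in> ?R. \<exists>h\<in>?R. f (ginv G l) * cnj (b (ldiv l h)) * c h \<noteq> 0}"
        by (rule finite_subset[OF _ finite_rfibre[OF fi]]) auto
      fix l assume "l \<in> ?R"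
      then show "finite {h \<in> ?R. f (ginv G l) * cnj (b (ldiv l h)) * c h \<noteq> 0}"
        by (intro finite_subset[OF _ finite_rfibre_ldiv[OF b, of l]]) (auto simp: rfibre_def)
    qed
    also have "\<dots> = (\<Sum>\<^sub>\<infinity>h\<in>?R. cnj (conv G (star G f) b h) * c h)"
    proof (rule infsum_cong)
      fix h assume "h \<in> ?R"
      then have h: "rng G h = x" by (simp add: rfibre_def)
      show "(\<Sum>\<^sub>\<infinity>l\<in>?R. f (ginv G l) * cnj (b (ldiv l h)) * c h) = cnj (conv G (star G f) b h) * c h"
        by (simp add: infsum_cmult_left' conv_eq h star_def flip: infsum_cnj)
    qed
    finally show "Psi G (\<lambda>l. \<Theta> (ginv G l)) x = Psi G (\<lambda>h. cnj (conv G (star G f) b h) * c h) x"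
      using x by (simp add: Psi_def)
  qed
  finally show ?thesis .
qed

end

section \<open>The positive form defined by a function of positive type\<close>

locale positive_type = measured_groupoid G \<mu> for G :: "'g::t2_space groupoid" and \<mu> +
  fixes \<phi> :: "'g \<Rightarrow> real"
  assumes phi_cont: "continuous_on UNIV \<phi>"
    and phi_unit: "x \<in> units G \<Longrightarrow> \<phi> x = 1"
    and phi_ginv: "\<phi> (ginv G g) = \<phi> g"
    and phi_psd: "finite S \<Longrightarrow> S \<subseteq> rfibre G x \<Longrightarrow> psd_kernel S (\<lambda>h k. \<phi> (ldiv h k))"
begin

abbreviation vphi :: "('g \<Rightarrow> complex) \<Rightarrow> 'g \<Rightarrow> complex" where
  "vphi a \<equiv> conv G a (\<lambda>g. of_real (\<phi> g))"

text \<open>The GNS form: over \<open>x\<close> it is the sum of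
  \<open>cnj (b k) * a h * \<phi> (ldiv h k)\<close> over \<open>h\<close> and \<open>k\<close> in
  the range fibre, integrated against \<open>\<mu>\<close>.\<close>

definition B :: "('g \<Rightarrow> complex) \<Rightarrow> ('g \<Rightarrow> complex) \<Rightarrow> complex" where
  "B a b = I (\<lambda>g. cnj (b g) * vphi a g)"

lemma vphi_cont: "a \<in> Cc \<Longrightarrow> continuous_on UNIV (vphi a)"
  by (rule conv_cont) (auto intro: continuous_on_of_real phi_cont)

lemma form_Cc: "a \<in> Cc \<Longrightarrow> b \<in> Cc \<Longrightarrow> (\<lambda>g. cnj (b g) * vphi a g) \<in> Cc"
  by (intro Cc_mult Cc_cnj vphi_cont)

lemma phi_ldiv: "rng G h = rng G k \<Longrightarrow> \<phi> (ldiv h k) = \<phi> (ldiv k h)"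
  using phi_ginv[of "ldiv h k"] by (simp add: ginv_ldiv)

lemma vphi_sum:
  assumes "finite T" "T \<subseteq> rfibre G x" "\<And>h. h \<in> rfibre G x - T \<Longrightarrow> a h = 0" "rng G g = x"
  shows "vphi a g = (\<Sum>k\<in>T. a k * of_real (\<phi> (ldiv k g)))"
proof -
  have "vphi a g = infsum (\<lambda>k. a k * of_real (\<phi> (ldiv k g))) T"
    unfolding conv_eq by (rule infsum_cong_neutral) (use assms in auto)
  then show ?thesis using assms by simp
qed

text \<open>\<open>T\<close> may exceed the support of \<open>a\<close> on the fibre, because it
  will be enlarged by a point at which a second vector is concentrated.\<close>

lemma form_sum:
  assumes "finite T" "T \<subseteq> rfibre G x" "\<And>h. h \<in> rfibre G x - T \<Longrightarrow> a h = 0" "x \<in> units G"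
  shows "Psi G (\<lambda>g. cnj (a g) * vphi a g) x
    = (\<Sum>i\<in>T. \<Sum>j\<in>T. cnj (a i) * a j * of_real (\<phi> (ldiv i j)))"
proof -
  have "Psi G (\<lambda>g. cnj (a g) * vphi a g) x = infsum (\<lambda>g. cnj (a g) * vphi a g) T"
    using assms(4) by (simp add: Psi_def) (rule infsum_cong_neutral, use assms in auto)
  also have "\<dots> = (\<Sum>i\<in>T. cnj (a i) * vphi a i)" using assms by simp
  also have "\<dots> = (\<Sum>i\<in>T. \<Sum>j\<in>T. cnj (a i) * a j * of_real (\<phi> (ldiv i j)))"
  proof (intro sum.cong refl)
    fix i assume i: "i \<in> T"
    have ri: "rng G i = x" using i assms(2) by (auto simp: rfibre_def)
    have "vphi a i = (\<Sum>k\<in>T. a k * of_real (\<phi> (ldiv k i)))"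
      by (rule vphi_sum[OF assms(1,2) _ ri]) (use assms(3) in auto)
    also have "\<dots> = (\<Sum>k\<in>T. a k * of_real (\<phi> (ldiv i k)))"
    proof (intro sum.cong refl)
      fix k assume "k \<in> T"
      then have "rng G k = rng G i" using assms(2) ri by (auto simp: rfibre_def)
      from phi_ldiv[OF this] show "a k * of_real (\<phi> (ldiv k i)) = a k * of_real (\<phi> (ldiv i k))"
        by simp
    qed
    finally show "cnj (a i) * vphi a i = (\<Sum>j\<in>T. cnj (a i) * a j * of_real (\<phi> (ldiv i j)))"
      by (simp add: sum_distrib_left mult.assoc)
  qed
  finally show ?thesis .
qed

definition fibre_form :: "('g \<Rightarrow> complex) \<Rightarrow> 'g \<Rightarrow> real" where
  "fibre_form a x = Re (Psi G (\<lambda>g. cnj (a g) * vphi a g) x)"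

text \<open>Cauchy-Schwarz on a single fibre: \<open>vphi a g\<close> is the inner product of
  \<open>a\<close> with the point mass at \<open>g\<close>, a vector of norm 1 since
  \<open>\<phi>\<close> is 1 on units. It gives pointwise control along the whole fibre, which the
  integrated form \<open>B\<close> does not.\<close>

lemma vphi_le_fibre_form:
  assumes a: "a \<in> Cc" shows "(cmod (vphi a g))\<^sup>2 \<le> fibre_form a (rng G g)"
proof -
  define x where "x = rng G g"
  define T where "T = insert g {h \<in> rfibre G x. a h \<noteq> 0}"
  have T: "finite T" "T \<subseteq> rfibre G x" "\<And>h. h \<in> rfibre G x - T \<Longrightarrow> a h = 0" "g \<in> T"
    using finite_rfibre[OF a] by (auto simp: T_def x_def rfibre_def)
  have x: "x \<in> units G" by (simp add: x_def)
  define K where "K i j = complex_of_real (\<phi> (ldiv i j))" for i j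
  have K: "K j i = K i j" if "i \<in> T" "j \<in> T" for i j
  proof -
    have "rng G j = rng G i" using T(2) that by (auto simp: rfibre_def)
    from phi_ldiv[OF this] show ?thesis by (simp add: K_def)
  qed
  have Kg: "K g g = 1" by (simp add: K_def ldiv_self phi_unit)
  define z where "z = (\<Sum>j\<in>T. a j * K j g)"
  have z: "vphi a g = z" unfolding z_def K_def
    by (rule vphi_sum[OF T(1,2) _ x_def[symmetric]]) (use T(3) in blast)
  \<comment> \<open>\<open>a\<close> minus its projection onto the unit vector at \<open>g\<close>;
    the form at \<open>a'\<close> is the form at \<open>a\<close> minus
    \<open>(cmod z)\<^sup>2\<close>.\<close>
  define a' where "a' i = a i - (if i = g then z else 0)" for i
  have ex: "(\<Sum>j\<in>T. (if j = g then y else 0) * h j) = y * h g" for h and y :: complex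
    using T by (simp add: if_distrib[of "\<lambda>x. x * _"] cong: if_cong)
  have w: "(\<Sum>j\<in>T. a' j * K i j) = (\<Sum>j\<in>T. a j * K i j) - z * K i g" for i
    using ex[of z "K i"] by (simp add: a'_def left_diff_distrib sum_subtractf)
  have wg: "(\<Sum>j\<in>T. a j * K g j) = z" unfolding z_def using K T by (intro sum.cong) auto
  have cz: "(\<Sum>i\<in>T. cnj (a i) * K i g) = cnj z" by (simp add: z_def K_def)
  have exc: "(\<Sum>i\<in>T. cnj (a' i) * y i) = (\<Sum>i\<in>T. cnj (a i) * y i) - cnj z * y g" for y
    using ex[of "cnj z" y]
    by (simp add: a'_def left_diff_distrib sum_subtractf if_distrib[of cnj] cong: if_cong)
  have "(\<Sum>i\<in>T. \<Sum>j\<in>T. cnj (a' i) * a' j * K i j) = (\<Sum>i\<in>T. cnj (a' i) * (\<Sum>j\<in>T. a' j * K i j))"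
    by (simp add: sum_distrib_left mult.assoc)
  also have "\<dots> = (\<Sum>i\<in>T. cnj (a i) * ((\<Sum>j\<in>T. a j * K i j) - z * K i g))"
    unfolding w exc by (simp add: wg Kg)
  also have "\<dots> = (\<Sum>i\<in>T. cnj (a i) * (\<Sum>j\<in>T. a j * K i j)) - z * (\<Sum>i\<in>T. cnj (a i) * K i g)"
    by (simp add: right_diff_distrib sum_subtractf sum_distrib_left mult.left_commute)
  also have "(\<Sum>i\<in>T. cnj (a i) * (\<Sum>j\<in>T. a j * K i j)) = (\<Sum>i\<in>T. \<Sum>j\<in>T. cnj (a i) * a j * K i j)"
    by (simp add: sum_distrib_left mult.assoc)
  also have "\<dots> = Psi G (\<lambda>g. cnj (a g) * vphi a g) x"
    unfolding K_def by (rule form_sum[OF T(1,2) _ x, symmetric]) (use T(3) in blast)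
  also note cz
  also have "z * cnj z = of_real ((cmod z)\<^sup>2)" by (rule complex_norm_square[symmetric])
  finally have "Re (\<Sum>i\<in>T. \<Sum>j\<in>T. cnj (a' i) * a' j * K i j) = fibre_form a x - (cmod z)\<^sup>2"
    by (simp add: fibre_form_def)
  moreover have "0 \<le> Re (\<Sum>i\<in>T. \<Sum>j\<in>T. cnj (a' i) * a' j * K i j)"
    unfolding K_def by (rule psd_kernel_complex[OF phi_psd[OF T(1,2)]])
  ultimately show ?thesis using z by (simp add: x_def)
qed

lemma fibre_form_nonneg: assumes "a \<in> Cc" "x \<in> units G" shows "0 \<le> fibre_form a x"
  using vphi_le_fibre_form[OF assms(1), of x] assms(2) by (metis order_trans units_iff zero_le_power2)

text \<open>The identity holds already on each fibre, by exchanging the two finite sums and using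
  the symmetry of \<open>\<phi> (ldiv h k)\<close>.\<close>

lemma B_cnj:
  assumes a: "a \<in> Cc" and b: "b \<in> Cc" shows "B b a = cnj (B a b)"
proof -
  have "B b a = I (\<lambda>g. cnj (cnj (b g) * vphi a g))" unfolding B_def
  proof (rule I_cong)
    fix x assume x: "x \<in> units G"
    let ?R = "rfibre G x"
    have "Psi G (\<lambda>g. cnj (a g) * vphi b g) x
        = (\<Sum>\<^sub>\<infinity>h\<in>?R. \<Sum>\<^sub>\<infinity>k\<in>?R. cnj (a h) * (b k * of_real (\<phi> (ldiv k h))))"
      using x by (auto simp: Psi_def conv_eq rfibre_def infsum_cmult_right' intro!: infsum_cong)
    also have "\<dots> = (\<Sum>\<^sub>\<infinity>k\<in>?R. \<Sum>\<^sub>\<infinity>h\<in>?R. cnj (a h) * (b k * of_real (\<phi> (ldiv k h))))"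
    proof (rule infsum_swap_finite)
      show "finite {h \<in> ?R. \<exists>k\<in>?R. cnj (a h) * (b k * of_real (\<phi> (ldiv k h))) \<noteq> 0}"
        by (rule finite_subset[OF _ finite_rfibre[OF a]]) auto
      show "finite {k \<in> ?R. cnj (a h) * (b k * of_real (\<phi> (ldiv k h))) \<noteq> 0}" for h
        by (rule finite_subset[OF _ finite_rfibre[OF b]]) auto
    qed
    also have "\<dots> = (\<Sum>\<^sub>\<infinity>k\<in>?R. cnj (cnj (b k) * vphi a k))"
    proof (rule infsum_cong)
      fix k assume "k \<in> ?R"
      then have k: "rng G k = x" by (simp add: rfibre_def)
      have "(\<Sum>\<^sub>\<infinity>h\<in>?R. cnj (a h) * (b k * of_real (\<phi> (ldiv k h))))
          = (\<Sum>\<^sub>\<infinity>h\<in>?R. b k * cnj (a h * of_real (\<phi> (ldiv h k))))"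
        by (rule infsum_cong) (use k in \<open>auto simp: rfibre_def phi_ldiv\<close>)
      then show "(\<Sum>\<^sub>\<infinity>h\<in>?R. cnj (a h) * (b k * of_real (\<phi> (ldiv k h)))) = cnj (cnj (b k) * vphi a k)"
        by (simp add: conv_eq k infsum_cmult_right' flip: infsum_cnj)
    qed
    finally show "Psi G (\<lambda>g. cnj (a g) * vphi b g) x = Psi G (\<lambda>g. cnj (cnj (b g) * vphi a g)) x"
      using x by (simp add: Psi_def)
  qed
  then show ?thesis by (simp add: I_cnj B_def del: complex_cnj_mult)
qed

sublocale semi_inner_product "Cc :: ('g \<Rightarrow> complex) set" B
proof
  fix f g h :: "'g \<Rightarrow> complex" and c
  assume f: "f \<in> Cc" and g: "g \<in> Cc" and h: "h \<in> Cc"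
  show "B (\<lambda>x. f x + g x) h = B f h + B g h"
    unfolding B_def using I_add[OF form_Cc[OF f h] form_Cc[OF g h]]
    by (simp add: conv_add_left[OF f g] distrib_left)
  show "B (\<lambda>x. c * f x) h = c * B f h"
    unfolding B_def conv_smult_left using I_smult[of c "\<lambda>x. cnj (h x) * vphi f x"]
    by (simp add: mult.left_commute)
  show "B g f = cnj (B f g)" by (rule B_cnj[OF f g])
  show "0 \<le> Re (B f f)" unfolding B_def
    using fibre_form_nonneg[OF f] by (intro Re_I_nonneg' form_Cc f) (simp add: fibre_form_def)
qed (auto intro: Cc_zero Cc_add Cc_smult)

lemma B_adjoint:
  assumes "f \<in> Cc" "a \<in> Cc" "b \<in> Cc" shows "B (conv G f a) b = B a (conv G (star G f) b)"
proof -
  have "vphi (conv G f a) = conv G f (vphi a)" using conv_assoc[OF assms(1,2)] by blast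
  then show ?thesis unfolding B_def
    using I_conv_adjoint[OF assms(1,3) vphi_cont[OF assms(2)]] by simp
qed

text \<open>For \<open>f\<close> supported in a bisection, \<open>p = conv G (star G f) f\<close>
  lives on the units and takes values between 0 and \<open>M\<^sup>2\<close>. Convolution by
  \<open>p\<close> is multiplication by a function of the range, so its form is at most
  \<open>M\<^sup>2\<close> times the form of \<open>a\<close>. Sums of such \<open>f\<close> follow
  from the triangle inequality.\<close>

lemma conv_bounded:
  assumes "f \<in> Cc" shows "\<exists>C\<ge>0. \<forall>a\<in>Cc. seminorm (conv G f a) \<le> C * seminorm a"
  using assms
proof (induction rule: Cc_induct)
  case (add f f')
  then obtain C C' where C: "C \<ge> 0" "\<forall>a\<in>Cc. seminorm (conv G f a) \<le> C * seminorm a"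
    and C': "C' \<ge> 0" "\<forall>a\<in>Cc. seminorm (conv G f' a) \<le> C' * seminorm a" by blast
  have "seminorm (conv G (\<lambda>g. f g + f' g) a) \<le> (C + C') * seminorm a" if a: "a \<in> Cc" for a
  proof -
    have "conv G (\<lambda>g. f g + f' g) a = (\<lambda>g. conv G f a g + conv G f' a g)"
      using conv_add_left[OF add(1,2)] by blast
    then have "seminorm (conv G (\<lambda>g. f g + f' g) a) \<le> seminorm (conv G f a) + seminorm (conv G f' a)"
      using seminorm_add[OF conv_Cc[OF add(1) a] conv_Cc[OF add(2) a]] by simp
    then show ?thesis using C C' a by (fastforce simp: distrib_right)
  qed
  then show ?case using C(1) C'(1) by (intro exI[of _ "C + C'"]) auto
next
  case (bisection f U)
  obtain M where M: "M \<ge> 0" "\<And>g. cmod (f g) \<le> M" using Cc_bounded[OF bisection(1)] by blast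
  define p where "p = conv G (star G f) f"
  have fU: "h \<in> U" if "f h \<noteq> 0" for h using that supp_zero bisection(3) by blast
  have sf: "star G f \<in> Cc" by (rule Cc_star[OF bisection(1)])
  have p_Cc: "p \<in> Cc" unfolding p_def by (rule conv_Cc[OF sf bisection(1)])
  have p0: "p g = 0" if g: "g \<notin> units G" for g
    unfolding p_def conv_eq
  proof (rule infsum_0, rule ccontr)
    fix h assume "h \<in> rfibre G (rng G g)" and nz: "star G f h * f (ldiv h g) \<noteq> 0"
    then have h: "rng G h = rng G g" by (simp add: rfibre_def)
    have "ginv G h \<in> U" "ldiv h g \<in> U" using nz fU by (auto simp: star_def)
    moreover have "rng G (ginv G h) = rng G (ldiv h g)" using h by (simp add: rng_inv rng_ldiv)
    ultimately have "ginv G h = ldiv h g" using bisection_rng_inj[OF bisection(2)] by blast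
    then have "g = gmult G h (ginv G h)" using mult_ldiv[OF h] by simp
    then show False using g by (simp add: mult_inv_right)
  qed
  \<comment> \<open>At most one arrow of the bisection has source \<open>x\<close>, so the sum for
    \<open>p x\<close> has at most one nonzero term.\<close>
  have p1: "\<exists>t. p x = of_real t \<and> 0 \<le> t \<and> t \<le> M\<^sup>2" if x: "x \<in> units G" for x
  proof -
    have "p x = (\<Sum>\<^sub>\<infinity>h\<in>rfibre G x. of_real ((cmod (f (ginv G h)))\<^sup>2))"
    proof -
      have "rng G x = x" using x by (simp add: units_iff)
      moreover have "star G f h * f (ldiv h x) = of_real ((cmod (f (ginv G h)))\<^sup>2)" if "h \<in> rfibre G x" for h
      proof -
        have "ldiv h x = ginv G h" using that src_mult_right[of "ginv G h"] by (simp add: rfibre_def src_inv)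
        then show ?thesis using complex_norm_square[of "f (ginv G h)"] by (simp add: star_def mult.commute)
      qed
      ultimately show ?thesis unfolding p_def conv_eq by (auto intro!: infsum_cong)
    qed
    also have "\<exists>t. \<dots> = of_real t \<and> 0 \<le> t \<and> t \<le> M\<^sup>2"
    proof (cases "\<exists>h\<in>rfibre G x. f (ginv G h) \<noteq> 0")
      case True
      then obtain h where h: "h \<in> rfibre G x" "f (ginv G h) \<noteq> 0" by blast
      have "(\<Sum>\<^sub>\<infinity>h\<in>rfibre G x. complex_of_real ((cmod (f (ginv G h)))\<^sup>2))
         = infsum (\<lambda>h. complex_of_real ((cmod (f (ginv G h)))\<^sup>2)) {h}"
      proof (rule infsum_cong_neutral)
        fix k assume k: "k \<in> rfibre G x - {h}"
        have "f (ginv G k) = 0"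
        proof (rule ccontr)
          assume "f (ginv G k) \<noteq> 0"
          then have "ginv G k = ginv G h"
            using bisection_src_inj[OF bisection(2) fU fU, of "ginv G k" "ginv G h"] h k
            by (simp add: rfibre_def src_inv)
          then have "k = h" by (metis ginv_ginv)
          then show False using k by simp
        qed
        then show "complex_of_real ((cmod (f (ginv G k)))\<^sup>2) = 0" by simp
      qed (use h in auto)
      then show ?thesis using M by (intro exI[of _ "(cmod (f (ginv G h)))\<^sup>2"]) (simp add: power_mono)
    next
      case False
      then have "(\<Sum>\<^sub>\<infinity>h\<in>rfibre G x. complex_of_real ((cmod (f (ginv G h)))\<^sup>2)) = 0"
        by (intro infsum_0) auto
      then show ?thesis by (intro exI[of _ 0]) simp
    qed
    finally show ?thesis .
  qed
  have "seminorm (conv G f a) \<le> M * seminorm a" if a: "a \<in> Cc" for a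
  proof -
    have fa: "conv G f a \<in> Cc" by (rule conv_Cc[OF bisection(1) a])
    have pa: "conv G p a \<in> Cc" by (rule conv_Cc[OF p_Cc a])
    have "B (conv G p a) a = B (conv G (star G f) (conv G f a)) a"
      unfolding p_def using conv_assoc[OF sf bisection(1)] by presburger
    also have "\<dots> = B (conv G f a) (conv G f a)"
      using B_adjoint[OF sf fa a] by simp
    finally have 1: "(seminorm (conv G f a))\<^sup>2 = Re (B (conv G p a) a)" using fa by (simp add: seminorm_sq)
    have vp: "vphi (conv G p a) g = p (rng G g) * vphi a g" for g
      using conv_assoc[OF p_Cc a] conv_unit_supported[of p, OF p0] by simp
    \<comment> \<open>The factor \<open>M\<^sup>2 - p (rng G g)\<close> is nonnegative and constant
      on each range fibre, so it comes out of the fibre form.\<close>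
    have "0 \<le> Re (I (\<lambda>g. of_real (M\<^sup>2) * (cnj (a g) * vphi a g) - cnj (a g) * vphi (conv G p a) g))"
    proof (rule Re_I_nonneg')
      show "(\<lambda>g. of_real (M\<^sup>2) * (cnj (a g) * vphi a g) - cnj (a g) * vphi (conv G p a) g) \<in> Cc"
        by (intro Cc_diff Cc_smult form_Cc a pa)
      fix x assume x: "x \<in> units G"
      obtain t where t: "p x = of_real t" "0 \<le> t" "t \<le> M\<^sup>2" using p1[OF x] by blast
      have "(\<lambda>g. of_real (M\<^sup>2) * (cnj (a g) * vphi a g) - cnj (a g) * vphi (conv G p a) g)
        = (\<lambda>g. (of_real (M\<^sup>2) - p (rng G g)) * (cnj (a g) * vphi a g))"
        by (rule ext) (simp add: vp algebra_simps)
      then have "Psi G (\<lambda>g. of_real (M\<^sup>2) * (cnj (a g) * vphi a g) - cnj (a g) * vphi (conv G p a) g) x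
        = of_real (M\<^sup>2 - t) * Psi G (\<lambda>g. cnj (a g) * vphi a g) x"
        using Psi_rng_mult[OF x, of "\<lambda>y. of_real (M\<^sup>2) - p y"] t by simp
      then show "0 \<le> Re (Psi G (\<lambda>g. of_real (M\<^sup>2) * (cnj (a g) * vphi a g) - cnj (a g) * vphi (conv G p a) g) x)"
        using t fibre_form_nonneg[OF a x] by (simp add: fibre_form_def)
    qed
    also have "I (\<lambda>g. of_real (M\<^sup>2) * (cnj (a g) * vphi a g) - cnj (a g) * vphi (conv G p a) g)
      = of_real (M\<^sup>2) * B a a - B (conv G p a) a"
      unfolding B_def by (subst I_diff) (auto intro!: Cc_smult form_Cc a pa simp: I_smult)
    finally have "(seminorm (conv G f a))\<^sup>2 \<le> (M * seminorm a)\<^sup>2"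
      using 1 a by (simp add: seminorm_sq power_mult_distrib del: of_real_power)
    then show ?thesis using M(1) a by (auto intro: power2_le_imp_le)
  qed
  then show ?case using M(1) by blast
qed

text \<open>Forced by the adjoint relation: the inner product of \<open>rep f L\<close> with
  \<open>a\<close> has to be that of \<open>L\<close> with
  \<open>conv G (star G f) a\<close>.\<close>

definition rep :: "('g \<Rightarrow> complex) \<Rightarrow> (('g \<Rightarrow> complex) \<Rightarrow> complex) \<Rightarrow> ('g \<Rightarrow> complex) \<Rightarrow> complex" where
  "rep f L a = (if a \<in> Cc then L (conv G (star G f) a) else 0)"

text \<open>Boundedness of convolution by \<open>star G f\<close> transfers the approximation. Thus
  \<open>rep f\<close> is the continuous extension of left convolution by \<open>f\<close>.\<close>

lemma approx_rep:
  assumes f: "f \<in> Cc" and L: "approx L u" shows "approx (rep f L) (\<lambda>n. conv G f (u n))"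
proof -
  obtain e where e: "e \<longlonglongrightarrow> 0" "\<And>n a. a \<in> Cc \<Longrightarrow> cmod (L a - B (u n) a) \<le> e n * seminorm a"
    and u: "\<And>n. u n \<in> Cc"
    using L by (auto simp: approx_def)
  obtain C where C: "C \<ge> 0" "\<forall>a\<in>Cc. seminorm (conv G (star G f) a) \<le> C * seminorm a"
    using conv_bounded[OF Cc_star[OF f]] by blast
  have "cmod (rep f L a - B (conv G f (u n)) a) \<le> (\<bar>e n\<bar> * C) * seminorm a" if a: "a \<in> Cc" for n a
  proof -
    have fa: "conv G (star G f) a \<in> Cc" by (intro conv_Cc Cc_star f a)
    have "cmod (rep f L a - B (conv G f (u n)) a) \<le> e n * seminorm (conv G (star G f) a)"
      using e(2)[OF fa] a B_adjoint[OF f u a] by (simp add: rep_def)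
    also have "\<dots> \<le> \<bar>e n\<bar> * seminorm (conv G (star G f) a)" using fa by (intro mult_right_mono) auto
    also have "\<dots> \<le> \<bar>e n\<bar> * (C * seminorm a)" using C a by (intro mult_left_mono) auto
    finally show ?thesis by (simp add: mult.assoc)
  qed
  moreover have "(\<lambda>n. \<bar>e n\<bar> * C) \<longlonglongrightarrow> 0" using e(1) by (auto intro!: tendsto_eq_intros)
  moreover have "\<forall>n. conv G f (u n) \<in> Cc" using u f conv_Cc by blast
  ultimately show ?thesis unfolding approx_def by blast
qed

lemma rep_in: assumes "f \<in> Cc" "L \<in> completion" shows "rep f L \<in> completion"
proof -
  obtain u where "approx L u" using approx_exists[OF assms(2)] by blast
  from completionI[OF _ approx_rep[OF assms(1) this]] show ?thesis by (simp add: rep_def)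
qed

lemma rep_embed: "f \<in> Cc \<Longrightarrow> a \<in> Cc \<Longrightarrow> rep f (embed a) = embed (conv G f a)"
  by (rule ext) (simp add: rep_def embed_def B_adjoint conv_Cc Cc_star)

section \<open>Antilinearity of the functionals, and the GNS representation\<close>

lemma completion_diff:
  assumes "L \<in> completion" "a \<in> Cc" "b \<in> Cc" shows "L (\<lambda>x. a x - b x) = L a - L b"
  using approx_exists[OF assms(1)] approx_diff assms by metis

lemma completion_smult:
  assumes "L \<in> completion" "a \<in> Cc" shows "L (\<lambda>x. c * a x) = cnj c * L a"
proof -
  obtain u where u: "approx L u" using approx_exists[OF assms(1)] by blast
  have "(\<lambda>n. B (u n) (\<lambda>x. c * a x)) \<longlonglongrightarrow> L (\<lambda>x. c * a x)"
    by (rule approx_tendsto[OF u Cc_smult[OF assms(2)]])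
  moreover have "(\<lambda>n. cnj c * B (u n) a) \<longlonglongrightarrow> cnj c * L a"
    by (intro tendsto_mult_left approx_tendsto u assms)
  moreover have "B (u n) (\<lambda>x. c * a x) = cnj c * B (u n) a" for n
    using u assms by (intro B_smult_right) (auto simp: approx_def)
  ultimately show ?thesis using LIMSEQ_unique by simp
qed

lemma completion_add:
  assumes "L \<in> completion" "a \<in> Cc" "b \<in> Cc" shows "L (\<lambda>x. a x + b x) = L a + L b"
  using completion_diff[OF assms(1,2) Cc_smult[OF assms(3), of "-1"]] completion_smult[OF assms(1,3), of "-1"]
  by simp

lemma groupoid_representation_hilb: "groupoid_representation G hilb rep"
proof -
  interpret H: hilbert_space hilb by (rule hilbert_space_hilb)
  show ?thesis
  proof
    fix f :: "'g \<Rightarrow> complex" assume f: "f \<in> Cc"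
    obtain C where C: "C \<ge> 0" "\<forall>a\<in>Cc. seminorm (conv G (star G f) a) \<le> C * seminorm a"
      using conv_bounded[OF Cc_star[OF f]] by blast
    have "hnorm hilb (rep f L) \<le> C * hnorm hilb L" if L: "L \<in> completion" for L
    proof (rule hnorm_le[OF rep_in[OF f L]])
      have n: "0 \<le> hnorm hilb L" using ip_nonneg'[OF L] by (simp add: hnorm_hilb)
      then show "0 \<le> C * hnorm hilb L" using C by simp
      fix a :: "'g \<Rightarrow> complex" assume a: "a \<in> Cc"
      have "cmod (rep f L a) \<le> hnorm hilb L * seminorm (conv G (star G f) a)"
        using hnorm_bound[OF L conv_Cc[OF Cc_star[OF f] a]] a by (simp add: rep_def)
      also have "\<dots> \<le> hnorm hilb L * (C * seminorm a)" using C a n by (intro mult_left_mono) auto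
      finally show "cmod (rep f L a) \<le> C * hnorm hilb L * seminorm a" by (simp add: ac_simps)
    qed
    then show "bounded_operator hilb (rep f)"
      unfolding bounded_operator_def by (auto simp: rep_in f) (auto simp: rep_def)
  next
    fix f1 f2 :: "'g \<Rightarrow> complex" and L assume f: "f1 \<in> Cc" "f2 \<in> Cc" and "L \<in> carrier hilb"
    then have L: "L \<in> completion" by simp
    have "rep (\<lambda>g. f1 g + f2 g) L a = rep f1 L a + rep f2 L a" for a
    proof (cases "a \<in> Cc")
      case True
      have "conv G (star G (\<lambda>g. f1 g + f2 g)) a = (\<lambda>x. conv G (star G f1) a x + conv G (star G f2) a x)"
        using conv_add_left[OF Cc_star[OF f(1)] Cc_star[OF f(2)], of a] by (auto simp: star_def[abs_def])
      then show ?thesis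
        using True completion_add[OF L conv_Cc[OF Cc_star[OF f(1)] True] conv_Cc[OF Cc_star[OF f(2)] True]]
        by (simp add: rep_def)
    qed (simp add: rep_def)
    then show "rep (\<lambda>g. f1 g + f2 g) L = rep f1 L \<oplus>\<^bsub>hilb\<^esub> rep f2 L" by auto
  next
    fix f :: "'g \<Rightarrow> complex" and L c assume f: "f \<in> Cc" and "L \<in> carrier hilb"
    then have L: "L \<in> completion" by simp
    have "rep (\<lambda>g. c * f g) L a = c * rep f L a" for a
    proof (cases "a \<in> Cc")
      case True
      have "conv G (star G (\<lambda>g. c * f g)) a = (\<lambda>x. cnj c * conv G (star G f) a x)"
        using conv_smult_left[of "cnj c" "star G f" a] by (auto simp: star_def[abs_def])
      then show ?thesis
        using True completion_smult[OF L conv_Cc[OF Cc_star[OF f] True], of "cnj c"]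
        by (simp add: rep_def)
    qed (simp add: rep_def)
    then show "rep (\<lambda>g. c * f g) L = c \<odot>\<^bsub>hilb\<^esub> rep f L" by auto
  next
    fix f1 f2 :: "'g \<Rightarrow> complex" and L assume f: "f1 \<in> Cc" "f2 \<in> Cc" and "L \<in> carrier hilb"
    show "rep (conv G f1 f2) L = rep f1 (rep f2 L)"
    proof
      fix a show "rep (conv G f1 f2) L a = rep f1 (rep f2 L) a"
      proof (cases "a \<in> Cc")
        case True
        have "star G (conv G f1 f2) = conv G (star G f2) (star G f1)" using star_conv by blast
        then have "conv G (star G (conv G f1 f2)) a = conv G (star G f2) (conv G (star G f1) a)"
          using conv_assoc[OF Cc_star[OF f(2)] Cc_star[OF f(1)]] by auto
        then show ?thesis using True conv_Cc[OF Cc_star[OF f(1)] True] by (simp add: rep_def)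
      qed (simp add: rep_def)
    qed
  next
    fix f :: "'g \<Rightarrow> complex" and L M assume f: "f \<in> Cc" and "L \<in> carrier hilb" "M \<in> carrier hilb"
    then obtain u v where a: "approx L u" "approx M v" using approx_exists by (metis hilb_simps(1))
    have uv: "u n \<in> Cc" "v n \<in> Cc" for n using a by (auto simp: approx_def)
    have "(\<lambda>n. B (conv G (star G f) (u n)) (v n)) \<longlonglongrightarrow> ip_lim (rep (star G f) L) M"
      by (rule B_tendsto[OF approx_rep[OF Cc_star[OF f] a(1)] a(2)])
    moreover have "(\<lambda>n. B (u n) (conv G f (v n))) \<longlonglongrightarrow> ip_lim L (rep f M)"
      by (rule B_tendsto[OF a(1) approx_rep[OF f a(2)]])
    moreover have "B (conv G (star G f) (u n)) (v n) = B (u n) (conv G f (v n))" for n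
      using B_adjoint[OF Cc_star[OF f] uv] by simp
    ultimately show "ip hilb (rep (star G f) L) M = ip hilb L (rep f M)"
      using LIMSEQ_unique by simp
  next
    fix L assume "L \<in> carrier hilb"
    then show "rep (conv_one G) L = L"
      by (auto simp: rep_def conv_one_left completion_def)
  qed
qed

end

section \<open>Proper functions of negative type\<close>

locale proper_negative_type = measured_groupoid G \<mu> for G :: "'g::t2_space groupoid" and \<mu> +
  fixes F :: "'g \<Rightarrow> real"
  assumes F_cont: "continuous_on UNIV F"
    and F_nonneg: "0 \<le> F g"
    and F_proper: "C \<subseteq> {0..} \<Longrightarrow> compact C \<Longrightarrow> compact (F -` C)"
    and F_neg: "negative_type G F"
begin

lemma F_unit: "x \<in> units G \<Longrightarrow> F x = 0"
  using F_neg by (simp add: negative_type_def)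

lemma F_ginv: "F (ginv G g) = F g"
  using F_neg by (simp add: negative_type_def)

lemma F_sum:
  fixes n :: nat
  assumes "\<And>i j. i < n \<Longrightarrow> j < n \<Longrightarrow> rng G (\<gamma> i) = rng G (\<gamma> j)" "(\<Sum>j<n. a j) = 0"
  shows "(\<Sum>i<n. \<Sum>j<n. a i * a j * F (ldiv (\<gamma> i) (\<gamma> j))) \<le> 0"
  using F_neg assms unfolding negative_type_def by blast

lemma F_ldiv_sym: "rng G h = rng G k \<Longrightarrow> F (ldiv h k) = F (ldiv k h)"
  using F_ginv[of "ldiv h k"] by (simp add: ginv_ldiv)

text \<open>\<open>F\<close> behaves like a squared length, so the factor 2 replaces the triangle
  inequality. It comes from negative type at the three points \<open>h\<close>, \<open>k\<close> and
  the unit \<open>x\<close>, with coefficients 1, 1 and -2.\<close>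

lemma F_ldiv_le: assumes "rng G h = rng G k" shows "F (ldiv h k) \<le> 2 * F h + 2 * F k"
proof -
  define x where "x = rng G h"
  define \<gamma> where "\<gamma> i = (if i = 0 then h else if i = 1 then k else x)" for i :: nat
  define a where "a i = (if i = 0 then 1 else if i = 1 then 1 else -2 :: real)" for i :: nat
  have x: "x \<in> units G" "rng G x = x" by (simp_all add: x_def rng_rng)
  have "(\<Sum>i<3. \<Sum>j<3. a i * a j * F (ldiv (\<gamma> i) (\<gamma> j))) \<le> 0"
    by (rule F_sum) (use assms x in \<open>auto simp: \<gamma>_def a_def x_def numeral_3_eq_3\<close>)
  moreover have "F (ldiv h h) = 0" "F (ldiv k k) = 0" "F (ldiv x x) = 0"
    by (simp_all add: ldiv_self F_unit)
  moreover have "F (ldiv x h) = F h" "F (ldiv x k) = F k"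
    using ldiv_unit[OF x(1)] assms by (simp_all add: x_def)
  moreover have "F (ldiv h x) = F (ldiv x h)" "F (ldiv k x) = F (ldiv x k)" "F (ldiv k h) = F (ldiv h k)"
    using assms x by (auto intro!: F_ldiv_sym simp: x_def)
  ultimately show ?thesis by (simp add: numeral_3_eq_3 \<gamma>_def a_def)
qed

lemma psd_kernel_exp_F:
  assumes "finite S" "S \<subseteq> rfibre G x" "0 \<le> t"
  shows "psd_kernel S (\<lambda>h k. exp (- t * F (ldiv h k)))"
proof (rule psd_kernel_Schoenberg[OF assms(1) _ _ _ assms(3)])
  fix h k assume "h \<in> S" "k \<in> S"
  then show "F (ldiv h k) = F (ldiv k h)" using assms(2) by (intro F_ldiv_sym) (auto simp: rfibre_def)
next
  fix h show "F (ldiv h h) = 0" by (simp add: ldiv_self F_unit)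
next
  fix a :: "'g \<Rightarrow> real" assume a: "(\<Sum>i\<in>S. a i) = 0"
  obtain e where e: "bij_betw e {0..<card S} S" using ex_bij_betw_nat_finite[OF assms(1)] by blast
  then have e: "bij_betw e {..<card S} S" by (simp add: atLeast0LessThan)
  have "(\<Sum>i<card S. \<Sum>j<card S. a (e i) * a (e j) * F (ldiv (e i) (e j))) \<le> 0"
  proof (rule F_sum)
    show "(\<Sum>j<card S. a (e j)) = 0" using a sum.reindex_bij_betw[OF e, of a] by simp
    fix i j assume "i < card S" "j < card S"
    then have "e i \<in> S" "e j \<in> S" using bij_betwE[OF e] by auto
    then show "rng G (e i) = rng G (e j)" using assms(2) by (auto simp: rfibre_def)
  qed
  also have "(\<Sum>i<card S. \<Sum>j<card S. a (e i) * a (e j) * F (ldiv (e i) (e j)))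
    = (\<Sum>i<card S. \<Sum>k\<in>S. a (e i) * a k * F (ldiv (e i) k))"
    by (intro sum.cong refl sum.reindex_bij_betw[OF e, of "\<lambda>k. a (e _) * a k * F (ldiv (e _) k)"])
  also have "\<dots> = (\<Sum>h\<in>S. \<Sum>k\<in>S. a h * a k * F (ldiv h k))"
    by (rule sum.reindex_bij_betw[OF e])
  finally show "(\<Sum>h\<in>S. \<Sum>k\<in>S. a h * a k * F (ldiv h k)) \<le> 0" .
qed

text \<open>A continuous plateau: 1 where \<open>F\<close> is at most \<open>R\<close> and 0 where
  it is at least \<open>R + 1\<close>. Properness of \<open>F\<close> gives compact support.\<close>

definition cutoff :: "real \<Rightarrow> 'g \<Rightarrow> real" where
  "cutoff R g = max 0 (min 1 (R + 1 - F g))"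

lemma cutoff_bounds [simp]: "0 \<le> cutoff R g" "cutoff R g \<le> 1"
  by (auto simp: cutoff_def)

lemma cutoff_eq_1: "F g \<le> R \<Longrightarrow> cutoff R g = 1"
  by (simp add: cutoff_def)

lemma cutoff_mono: "R \<le> R' \<Longrightarrow> cutoff R g \<le> cutoff R' g"
  by (auto simp: cutoff_def)

lemma cutoff_Cc: "(\<lambda>g. complex_of_real (cutoff R g)) \<in> Cc"
proof (rule CcI)
  show "continuous_on UNIV (\<lambda>g. complex_of_real (cutoff R g))"
    unfolding cutoff_def by (intro continuous_intros F_cont)
  show "compact (F -` {0..R + 1})" by (rule F_proper) auto
  show "complex_of_real (cutoff R g) = 0" if "g \<notin> F -` {0..R + 1}" for g
    using that F_nonneg[of g] by (simp add: cutoff_def)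
qed

text \<open>A cutoff at a large radius, normalised on each fibre, is a probability density; it is at
  most \<open>1 / n\<close> once the total mass \<open>N R\<close> of the cutoff is at least
  \<open>n\<close>. Infinite fibres provide such a radius at each unit, and compactness of the unit
  space together with monotonicity in \<open>R\<close> provides a common one.\<close>

lemma spread_measures:
  assumes inf: "\<And>x. x \<in> units G \<Longrightarrow> infinite (rfibre G x)" and n: "0 < n"
  shows "\<exists>Q :: 'g \<Rightarrow> real. (\<lambda>g. complex_of_real (Q g)) \<in> Cc \<and> (\<forall>g. 0 \<le> Q g \<and> Q g \<le> 1 / real n) \<and>
    (\<forall>x\<in>units G. Psi G (\<lambda>g. of_real (Q g)) x = 1)"
proof -
  define N where "N R x = Re (Psi G (\<lambda>g. of_real (cutoff (real R) g)) x)" for R :: nat and x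
  have N_cont: "continuous_on UNIV (N R)" for R
    unfolding N_def[abs_def] by (intro continuous_on_Re Cc_cont Psi_Cc cutoff_Cc)
  have N_mono: "N R x \<le> N R' x" if "R \<le> R'" for R R' x
    unfolding N_def by (intro Psi_mono cutoff_Cc) (use that cutoff_mono in auto)
  have cover: "\<exists>R. real n < N R x" if x: "x \<in> units G" for x
  proof -
    \<comment> \<open>One point more than \<open>n\<close> gives the strict inequality that defines
      an open cover.\<close>
    obtain S where S: "finite S" "card S = Suc n" "S \<subseteq> rfibre G x"
      using infinite_arbitrarily_large[OF inf[OF x]] by metis
    obtain R :: nat where R: "\<forall>g\<in>S. F g \<le> real R"
    proof -
      obtain R :: nat where "Max (F ` S) \<le> real R" using real_arch_simple by blast
      then show ?thesis using S(1) by (intro that[of R]) (auto intro: order_trans[OF Max_ge])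
    qed
    have "real (Suc n) = (\<Sum>g\<in>S. cutoff (real R) g)" using R S(2) by (simp add: cutoff_eq_1)
    also have "\<dots> \<le> (\<Sum>\<^sub>\<infinity>g\<in>rfibre G x. cutoff (real R) g)"
      by (rule finite_sum_le_infsum)
        (use S finite_rfibre[OF cutoff_Cc, of x R] in \<open>auto intro!: finite_nonzero_values_imp_summable_on\<close>)
    also have "\<dots> = N R x"
      using infsum_Re[OF summable_rfibre[OF cutoff_Cc[of R]], of x] x by (simp add: N_def Psi_def)
    finally show ?thesis by (intro exI[of _ R]) simp
  qed
  obtain D :: "nat set" where D: "finite D" "units G \<subseteq> (\<Union>R\<in>D. {x. real n < N R x})"
  proof (rule compactE_image[OF compact_units, of UNIV "\<lambda>R. {x. real n < N R x}"])
    show "open {x. real n < N R x}" for R by (intro open_Collect_less continuous_intros N_cont)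
    show "units G \<subseteq> (\<Union>R. {x. real n < N R x})" using cover by blast
  qed (use that in blast)
  define R where "R = Max (insert 0 D)"
  have N_big: "real n \<le> N R x" if x: "x \<in> units G" for x
  proof -
    obtain R' where "R' \<in> D" "real n < N R' x" using D x by blast
    moreover have "R' \<le> R" using \<open>R' \<in> D\<close> D(1) by (simp add: R_def)
    ultimately show ?thesis using N_mono[of R' R x] by simp
  qed
  have N_pos: "0 < N R (rng G g)" for g using N_big[of "rng G g"] n by simp
  define Q where "Q g = cutoff R g / N R (rng G g)" for g
  have Nr_cont: "continuous_on UNIV (\<lambda>g. N R (rng G g))"
    by (rule continuous_on_compose2[OF N_cont continuous_rng]) auto
  have Q_eq: "(\<lambda>g. complex_of_real (Q g)) = (\<lambda>g. of_real (1 / N R (rng G g)) * of_real (cutoff R g))"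
    by (auto simp: Q_def)
  have "(\<lambda>g. complex_of_real (Q g)) \<in> Cc" unfolding Q_eq
    by (intro Cc_mult2 cutoff_Cc continuous_intros Nr_cont) (use N_pos in \<open>metis less_irrefl\<close>)
  moreover have "Q g \<le> 1 / real n" "0 \<le> Q g" for g
  proof -
    show "Q g \<le> 1 / real n" unfolding Q_def using N_big[of "rng G g"] n by (intro frac_le) auto
    show "0 \<le> Q g" unfolding Q_def using N_pos[of g] by simp
  qed
  moreover have "Psi G (\<lambda>g. of_real (Q g)) x = 1" if x: "x \<in> units G" for x
  proof -
    have "Psi G (\<lambda>g. of_real (Q g)) x = of_real (1 / N R x) * Psi G (\<lambda>g. of_real (cutoff R g)) x"
      unfolding Q_eq by (rule Psi_rng_mult[OF x, of "\<lambda>y. of_real (1 / N R y)"])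
    also have "Psi G (\<lambda>g. of_real (cutoff R g)) x = of_real (N R x)"
      unfolding N_def by (rule Psi_of_real)
    finally show ?thesis using N_pos[of x] x by (simp add: units_iff)
  qed
  ultimately show ?thesis by (intro exI[of _ Q]) auto
qed

end

section \<open>The representation of \<open>exp (- t * F)\<close>\<close>

locale schoenberg = proper_negative_type G \<mu> F for G :: "'g::t2_space groupoid" and \<mu> F +
  fixes t :: real
  assumes t_pos: "0 < t"
begin

definition phi :: "'g \<Rightarrow> real" where
  "phi g = exp (- t * F g)"

sublocale positive_type G \<mu> phi
proof
  show "continuous_on UNIV phi" unfolding phi_def[abs_def] by (intro continuous_intros F_cont)
  show "psd_kernel S (\<lambda>h k. phi (ldiv h k))" if "finite S" "S \<subseteq> rfibre G x" for S x
    using psd_kernel_exp_F[OF that] t_pos by (simp add: phi_def)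
qed (simp_all add: phi_def F_unit F_ginv)

lemma vphi_norm_le:
  assumes h: "h \<in> Cc" and E: "\<And>k. rng G k = rng G g \<Longrightarrow> h k \<noteq> 0 \<Longrightarrow> phi (ldiv k g) \<le> E"
  shows "cmod (vphi h g) \<le> Re (Psi G (\<lambda>k. of_real (cmod (h k))) (rng G g)) * E"
proof -
  let ?R = "rfibre G (rng G g)"
  let ?a = "\<lambda>k. h k * complex_of_real (phi (ldiv k g))"
  have f: "finite {k \<in> ?R. h k \<noteq> 0}" by (rule finite_rfibre[OF h])
  have s1: "(\<lambda>k. cmod (?a k)) summable_on ?R"
    by (rule finite_nonzero_values_imp_summable_on, rule finite_subset[OF _ f]) auto
  have s2: "(\<lambda>k. cmod (h k) * E) summable_on ?R"
    by (rule finite_nonzero_values_imp_summable_on, rule finite_subset[OF _ f]) auto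
  have "cmod (vphi h g) \<le> (\<Sum>\<^sub>\<infinity>k\<in>?R. cmod (?a k))"
    unfolding conv_eq by (rule norm_infsum_bound[OF s1])
  also have "\<dots> \<le> (\<Sum>\<^sub>\<infinity>k\<in>?R. cmod (h k) * E)"
  proof (rule infsum_mono[OF s1 s2])
    fix k assume "k \<in> ?R"
    then have k: "rng G k = rng G g" by (simp add: rfibre_def)
    show "cmod (?a k) \<le> cmod (h k) * E"
      using E[OF k] by (cases "h k = 0") (auto simp: norm_mult phi_def intro!: mult_left_mono)
  qed
  also have "\<dots> = (\<Sum>\<^sub>\<infinity>k\<in>?R. cmod (h k)) * E" by (rule infsum_cmult_left')
  also have "(\<Sum>\<^sub>\<infinity>k\<in>?R. cmod (h k)) = Re (Psi G (\<lambda>k. of_real (cmod (h k))) (rng G g))"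
    using infsum_Re[OF summable_rfibre[OF Cc_norm[OF h]], of "rng G g"] by (simp add: Psi_def)
  finally show ?thesis .
qed

text \<open>Properness of \<open>F\<close> makes \<open>phi\<close> vanish at infinity. By
  \<open>F_ldiv_le\<close>, dividing \<open>g\<close> by an element of the compact set
  \<open>supp h\<close> keeps \<open>F\<close> large.\<close>

lemma vphi_decay:
  assumes h: "h \<in> Cc" and d: "0 < \<delta>"
  shows "\<exists>R. \<forall>g. R < F g \<longrightarrow> cmod (vphi h g) \<le> \<delta>"
proof -
  have "bounded (F ` supp h)"
    by (intro compact_imp_bounded compact_continuous_image Cc_compact h continuous_on_subset[OF F_cont]) simp
  then obtain M where M: "\<And>k. k \<in> supp h \<Longrightarrow> F k \<le> M" by (auto simp: bounded_iff) (metis abs_le_D1)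
  obtain C where C: "0 \<le> C" "\<And>x. x \<in> units G \<Longrightarrow> cmod (Psi G (\<lambda>k. of_real (cmod (h k))) x) \<le> C"
    using units_bounded[OF Cc_cont[OF Psi_Cc[OF Cc_norm[OF h]]]] by blast
  \<comment> \<open>For \<open>F g > R\<close> and \<open>k\<close> in the support,
    \<open>F (ldiv k g)\<close> is at least \<open>R / 2 - M\<close>, which makes \<open>phi\<close>
    at most \<open>\<delta> / (C + 1)\<close>. Using \<open>C + 1\<close> avoids division by
    zero.\<close>
  define R where "R = 2 * (M + ln ((C + 1) / \<delta>) / t)"
  have "cmod (vphi h g) \<le> \<delta>" if g: "R < F g" for g
  proof -
    have "cmod (vphi h g) \<le> Re (Psi G (\<lambda>k. of_real (cmod (h k))) (rng G g)) * (\<delta> / (C + 1))"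
    proof (rule vphi_norm_le[OF h])
      fix k assume k: "rng G k = rng G g" "h k \<noteq> 0"
      have "F k \<le> M" using k supp_zero M by blast
      moreover have "F g \<le> 2 * F k + 2 * F (ldiv k g)"
        using F_ldiv_le[of "ginv G k" "ldiv k g"] k by (simp add: rng_inv rng_ldiv mult_ldiv F_ginv)
      ultimately have "R / 2 - M \<le> F (ldiv k g)" using g by simp
      then have "ln ((C + 1) / \<delta>) / t \<le> F (ldiv k g)" by (simp add: R_def)
      then have "ln ((C + 1) / \<delta>) \<le> t * F (ldiv k g)" using t_pos by (simp add: field_simps)
      then have "exp (- t * F (ldiv k g)) \<le> exp (- ln ((C + 1) / \<delta>))" by simp
      also have "\<dots> = \<delta> / (C + 1)" using C d by (simp add: exp_minus)
      finally show "phi (ldiv k g) \<le> \<delta> / (C + 1)" by (simp add: phi_def)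
    qed
    also have "\<dots> \<le> (C + 1) * (\<delta> / (C + 1))"
      using C(1) C(2)[of "rng G g"] complex_Re_le_cmod[of "Psi G (\<lambda>k. of_real (cmod (h k))) (rng G g)"] d
      by (intro mult_right_mono) auto
    also have "\<dots> = \<delta>" using C by simp
    finally show ?thesis .
  qed
  then show ?thesis by blast
qed

text \<open>Since \<open>phi\<close> is at most 1, \<open>vphi f\<close> is bounded by the fibrewise
  absolute sums of \<open>f\<close>; pairing with \<open>f\<close> contributes the same bound
  again.\<close>

lemma seminorm_le:
  assumes f: "f \<in> Cc" and C: "0 \<le> C" "\<And>x. x \<in> units G \<Longrightarrow> Re (Psi G (\<lambda>g. of_real (cmod (f g))) x) \<le> C"
  shows "seminorm f \<le> C"
proof -
  have v: "cmod (vphi f g) \<le> C" for g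
  proof -
    have "cmod (vphi f g) \<le> Re (Psi G (\<lambda>g. of_real (cmod (f g))) (rng G g)) * 1"
      by (rule vphi_norm_le[OF f]) (use t_pos F_nonneg in \<open>auto simp: phi_def\<close>)
    then show ?thesis using C(2)[of "rng G g"] by simp
  qed
  have "cmod (B f f) \<le> C * C" unfolding B_def
  proof (rule I_bound[OF form_Cc[OF f f]])
    fix x assume x: "x \<in> units G"
    have "cmod (Psi G (\<lambda>g. cnj (f g) * vphi f g) x) \<le> Re (Psi G (\<lambda>g. of_real (cmod (cnj (f g) * vphi f g))) x)"
      by (rule Psi_norm[OF form_Cc[OF f f]])
    also have "\<dots> \<le> Re (Psi G (\<lambda>g. of_real C * of_real (cmod (f g))) x)"
      by (rule Psi_mono[OF Cc_norm[OF form_Cc[OF f f]] Cc_smult[OF Cc_norm[OF f]]])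
        (use mult_left_mono[OF v norm_ge_zero] in \<open>auto simp: norm_mult mult.commute[of C]\<close>)
    also have "\<dots> = C * Re (Psi G (\<lambda>g. of_real (cmod (f g))) x)" by (simp add: Psi_smult)
    also have "\<dots> \<le> C * C" using C x by (intro mult_left_mono) auto
    finally show "cmod (Psi G (\<lambda>g. cnj (f g) * vphi f g) x) \<le> C * C" .
  qed
  then have "(seminorm f)\<^sup>2 \<le> C * C" using complex_Re_le_cmod[of "B f f"] seminorm_sq[OF f] by linarith
  then have "(seminorm f)\<^sup>2 \<le> C\<^sup>2" by (simp add: power2_eq_square)
  then show ?thesis using C(1) by (rule power2_le_imp_le)
qed

text \<open>
  Here \<open>h\<close> and \<open>h'\<close> approximate \<open>L\<close> with errors \<open>\<delta>\<close> and \<open>\<delta>'\<close>.  The compact set where matrix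
  coefficients exceed \<open>\<delta>\<close>, and hence the fibre measures \<open>Q\<close>, depend on \<open>h\<close>.  The second
  approximant is chosen only after \<open>Q\<close>, because constancy of \<open>L\<close> has to be accurate on the support
  of \<open>A\<close>.  The function \<open>b\<close> cuts off \<open>|v'|\<close> where the fibrewise distance \<open>e\<close> between \<open>h\<close> and
  \<open>h'\<close> is large; this makes \<open>b (rng k) * b (src k)\<close> almost vanish outside the compact set.
\<close>

lemma constant_functional_zero:
  assumes inf: "\<And>x. x \<in> units G \<Longrightarrow> infinite (rfibre G x)"
    and L: "L \<in> completion"
    and const: "\<And>f. f \<in> Cc \<Longrightarrow> L f = L (\<lambda>g. cnj (Psi G (star G f) g))"
  shows "L (conv_one G) = 0"
proof (rule ccontr)
  define c where "c = cmod (L (conv_one G))"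
  assume "L (conv_one G) \<noteq> 0"
  then have c: "0 < c" by (simp add: c_def)
  \<comment> \<open>The lower bound at the end loses \<open>2 * \<delta> + 2 * \<delta>'\<close>;
    with both errors at most \<open>c / 8\<close>, \<open>c / 2\<close> remains.\<close>
  define \<delta> where "\<delta> = c / 8"
  have d: "0 < \<delta>" using c by (simp add: \<delta>_def)
  have "\<exists>h\<in>Cc. \<forall>f\<in>Cc. cmod (L f - B h f) \<le> \<delta> * seminorm f"
    using L d by (simp add: completion_def)
  then obtain h where h: "h \<in> Cc" "\<And>f. f \<in> Cc \<Longrightarrow> cmod (L f - B h f) \<le> \<delta> * seminorm f" by blast
  define v where "v = vphi h"
  obtain R where R: "\<And>g. R < F g \<Longrightarrow> cmod (v g) \<le> \<delta>"
    using vphi_decay[OF h(1) d] by (auto simp: v_def)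
  obtain M where M: "0 \<le> M" "\<And>x. x \<in> units G \<Longrightarrow> cmod (v x) \<le> M"
    using units_bounded[OF vphi_cont[OF h(1)]] by (auto simp: v_def)
  obtain C0 where C0: "0 \<le> C0" "\<And>x. x \<in> units G \<Longrightarrow> cmod (Psi G (\<lambda>g. of_real (cutoff R g)) x) \<le> C0"
    using units_bounded[OF Cc_cont[OF Psi_Cc[OF cutoff_Cc]]] by blast
  \<comment> \<open>Makes the contribution of arrows in the compact set where
    \<open>cutoff R\<close> lives at most \<open>c\<^sup>2 / 16\<close>.\<close>
  obtain n :: nat where n: "0 < n" "M\<^sup>2 * C0 / real n \<le> c\<^sup>2 / 16"
  proof -
    obtain n :: nat where n: "16 * M\<^sup>2 * C0 / c\<^sup>2 \<le> real n" using real_arch_simple by blast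
    then have "16 * M\<^sup>2 * C0 / c\<^sup>2 \<le> real (Suc n)" by simp
    then have "M\<^sup>2 * C0 / real (Suc n) \<le> c\<^sup>2 / 16" using c
      by (simp add: field_simps del: of_nat_Suc)
    then show ?thesis using that[of "Suc n"] by simp
  qed
  obtain Q :: "'g \<Rightarrow> real" where Q: "(\<lambda>g. complex_of_real (Q g)) \<in> Cc"
      "\<And>g. 0 \<le> Q g" "\<And>g. Q g \<le> 1 / real n"
      "\<And>x. x \<in> units G \<Longrightarrow> Psi G (\<lambda>g. of_real (Q g)) x = 1"
    using spread_measures[OF inf n(1)] by metis
  define Qc where "Qc = (\<lambda>g. complex_of_real (Q g))"
  have Qc: "Qc \<in> Cc" using Q(1) by (simp add: Qc_def)
  \<comment> \<open>\<open>A k\<close> measures the overlap of the density \<open>Q\<close> on the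
    range fibre of \<open>rng G k\<close> with the translate by \<open>k\<close> of the one at
    \<open>src G k\<close>. It governs the second moment after transport. Being an average of values
    of \<open>Q\<close>, it is at most \<open>1 / n\<close>.\<close>
  define A where "A = conv G Qc (star G Qc)"
  have A: "A \<in> Cc" unfolding A_def by (intro conv_Cc Qc Cc_star)
  define \<alpha> where "\<alpha> k = Re (A k)" for k
  have A_eq: "A k = (\<Sum>\<^sub>\<infinity>g\<in>rfibre G (rng G k). of_real (Q g * Q (ldiv k g)))" for k
    unfolding A_def conv_eq
    by (intro infsum_cong) (simp add: star_def Qc_def rfibre_def ginv_ldiv)
  have "cnj (A k) = A k" for k unfolding A_eq by (simp flip: infsum_cnj)
  then have A_alpha: "A k = of_real (\<alpha> k)" for k
    by (metis Reals_cnj_iff \<alpha>_def of_real_Re)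
  have s0: "(\<lambda>g. complex_of_real (Q g * Q (ldiv k g))) summable_on rfibre G x" for k x
    by (rule finite_nonzero_values_imp_summable_on,
        rule finite_subset[OF _ finite_rfibre[OF Q(1), of x]]) auto
  have alpha_sum: "\<alpha> k = (\<Sum>\<^sub>\<infinity>g\<in>rfibre G (rng G k). Q g * Q (ldiv k g))" for k
    unfolding \<alpha>_def A_eq using infsum_Re[OF s0] by simp
  have alpha0: "0 \<le> \<alpha> k" for k unfolding alpha_sum by (intro infsum_nonneg) (simp add: Q)
  have alpha1: "\<alpha> k \<le> 1 / real n" for k
  proof -
    have s1: "(\<lambda>g. Q g * Q (ldiv k g)) summable_on rfibre G (rng G k)"
      using finite_rfibre[OF Q(1), of "rng G k"]
      by (intro finite_nonzero_values_imp_summable_on) (rule rev_finite_subset, auto)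
    have s2: "(\<lambda>g. Q g * (1 / real n)) summable_on rfibre G (rng G k)"
      using finite_rfibre[OF Q(1), of "rng G k"]
      by (intro finite_nonzero_values_imp_summable_on) (rule rev_finite_subset, auto)
    have "\<alpha> k \<le> (\<Sum>\<^sub>\<infinity>g\<in>rfibre G (rng G k). Q g * (1 / real n))"
      unfolding alpha_sum using Q(2,3) by (intro infsum_mono s1 s2 mult_left_mono)
    also have "\<dots> = (\<Sum>\<^sub>\<infinity>g\<in>rfibre G (rng G k). Q g) * (1 / real n)" by (rule infsum_cmult_left')
    also have "(\<Sum>\<^sub>\<infinity>g\<in>rfibre G (rng G k). Q g) = 1"
      using infsum_Re[OF summable_rfibre[OF Q(1)], of "rng G k"] Q(4)[of "rng G k"] by (simp add: Psi_def)
    finally show ?thesis by simp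
  qed
  have alpha_ginv: "\<alpha> (ginv G k) = \<alpha> k" for k
  proof -
    have "star G A k = A k" using star_conv[of Qc "star G Qc" k] by (simp add: A_def)
    then show ?thesis by (simp add: star_def A_alpha)
  qed
  have alpha_Cc: "(\<lambda>k. complex_of_real (\<alpha> k)) \<in> Cc" using A by (simp flip: A_alpha)
  obtain cA where cA: "0 \<le> cA" "\<And>x. x \<in> units G \<Longrightarrow> cmod (Psi G (\<lambda>k. of_real (\<alpha> k)) x) \<le> cA"
    using units_bounded[OF Cc_cont[OF Psi_Cc[OF alpha_Cc]]] by blast
  have cA_Re: "Re (Psi G (\<lambda>k. of_real (\<alpha> k)) x) \<le> cA" if "x \<in> units G" for x
    using cA(2)[OF that] complex_Re_le_cmod order_trans by blast

  \<comment> \<open>The second entry of the minimum bounds the error term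
    \<open>3 * M * cA * \<delta>'\<close> by \<open>c\<^sup>2 / 16\<close>; the summand 1 protects
    the denominator. Then \<open>upper\<close> is at most \<open>c\<^sup>2 / 8\<close>, below
    \<open>(c / 2)\<^sup>2\<close>.\<close>
  define \<delta>' where "\<delta>' = min (c / 8) (c\<^sup>2 / (16 * (3 * M * cA + 1)))"
  have den: "0 < 16 * (3 * M * cA + 1)" using M(1) cA(1) by (simp add: add_nonneg_pos)
  have d': "0 < \<delta>'" "\<delta>' \<le> c / 8"
  proof -
    show "0 < \<delta>'" using c den by (simp add: \<delta>'_def)
    show "\<delta>' \<le> c / 8" unfolding \<delta>'_def by (rule min.cobounded1)
  qed
  have d'': "3 * M * cA * \<delta>' \<le> c\<^sup>2 / 16"
  proof -
    have "3 * M * cA * \<delta>' \<le> (3 * M * cA + 1) * (c\<^sup>2 / (16 * (3 * M * cA + 1)))"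
      using M(1) cA(1) d'(1) by (intro mult_mono) (auto simp: \<delta>'_def)
    also have "\<dots> = c\<^sup>2 / 16" using den by (simp add: field_simps)
    finally show ?thesis .
  qed
  have "\<exists>h'\<in>Cc. \<forall>f\<in>Cc. cmod (L f - B h' f) \<le> \<delta>' * seminorm f"
    using L d' by (simp add: completion_def)
  then obtain h' where h': "h' \<in> Cc" "\<And>f. f \<in> Cc \<Longrightarrow> cmod (L f - B h' f) \<le> \<delta>' * seminorm f" by blast
  define v' where "v' = vphi h'"
  have v'_cont: "continuous_on UNIV v'" unfolding v'_def by (rule vphi_cont[OF h'(1)])
  have v's_cont: "continuous_on UNIV (\<lambda>k. v' (src G k))"
    by (rule continuous_on_compose2[OF v'_cont continuous_src]) auto
  have v'r_cont: "continuous_on UNIV (\<lambda>k. v' (rng G k))"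
    by (rule continuous_on_compose2[OF v'_cont continuous_rng]) auto
  \<comment> \<open>The defect of constancy: for an exactly constant vector, the coefficient at
    \<open>k\<close> equals the one at the unit \<open>src G k\<close>.\<close>
  define z where "z k = v' k - v' (src G k)" for k
  have z_cont: "continuous_on UNIV z" unfolding z_def by (intro continuous_intros v'_cont v's_cont)
  have az_Cc: "(\<lambda>k. complex_of_real (\<alpha> k) * of_real (cmod (z k))) \<in> Cc"
    by (intro Cc_mult alpha_Cc continuous_intros z_cont)

  have small: "Re (I (\<lambda>k. of_real (\<alpha> k) * of_real (cmod (z k)))) \<le> 3 * cA * \<delta>'"
  proof -
    \<comment> \<open>Constancy of \<open>L\<close> is tested against a continuous substitute for
      the phase of \<open>z\<close>, weighted by \<open>\<alpha>\<close>. The two uses of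
      \<open>h'\<close> cost \<open>2 * cA * \<delta>'\<close>, and the smoothed phase costs another
      \<open>cA * \<delta>'\<close>.\<close>
    define f where "f k = complex_of_real (\<alpha> k) * (z k / of_real (cmod (z k) + \<delta>'))" for k
    have nz: "cmod (z k) + \<delta>' \<noteq> 0" "0 < cmod (z k) + \<delta>'" for k
      using d'(1) norm_ge_zero[of "z k"] by linarith+
    have "continuous_on UNIV (\<lambda>k. z k / of_real (cmod (z k) + \<delta>'))"
      by (intro continuous_intros z_cont) (use nz in \<open>metis of_real_eq_0_iff\<close>)
    then have f: "f \<in> Cc" unfolding f_def[abs_def] by (intro Cc_mult alpha_Cc)
    have f_le: "cmod (f k) \<le> \<alpha> k" for k
    proof -
      have "cmod (z k) / (cmod (z k) + \<delta>') \<le> 1" using nz(2)[of k] d'(1) by simp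
      then have "\<alpha> k * (cmod (z k) / (cmod (z k) + \<delta>')) \<le> \<alpha> k * 1"
        using alpha0 by (intro mult_left_mono)
      moreover have "cmod (complex_of_real (cmod (z k) + \<delta>')) = cmod (z k) + \<delta>'"
        using nz(2)[of k] by (simp only: norm_of_real abs_of_pos)
      ultimately show ?thesis using alpha0[of k] by (simp add: f_def norm_mult norm_divide del: of_real_add)
    qed
    have sn_f: "seminorm f \<le> cA"
    proof (rule seminorm_le[OF f cA(1)])
      fix x assume x: "x \<in> units G"
      have "Re (Psi G (\<lambda>g. of_real (cmod (f g))) x) \<le> Re (Psi G (\<lambda>k. of_real (\<alpha> k)) x)"
        using f_le by (intro Psi_mono Cc_norm f alpha_Cc) simp
      then show "Re (Psi G (\<lambda>g. of_real (cmod (f g))) x) \<le> cA" using cA_Re[OF x] by simp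
    qed
    define p where "p = Psi G (star G f)"
    have p: "p \<in> Cc" unfolding p_def by (intro Psi_Cc Cc_star f)
    have p0: "g \<notin> units G \<Longrightarrow> p g = 0" for g by (simp add: p_def Psi_def)
    have p_le: "cmod (p x) \<le> cA" if x: "x \<in> units G" for x
    proof -
      have "cmod (p x) \<le> Re (Psi G (\<lambda>g. of_real (cmod (star G f g))) x)"
        unfolding p_def by (rule Psi_norm[OF Cc_star[OF f]])
      also have "\<dots> \<le> Re (Psi G (\<lambda>k. of_real (\<alpha> k)) x)"
      proof (rule Psi_mono[OF Cc_norm[OF Cc_star[OF f]] alpha_Cc])
        show "Re (of_real (cmod (star G f g))) \<le> Re (of_real (\<alpha> g))" for g
          using f_le[of "ginv G g"] by (simp add: star_def alpha_ginv)
      qed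
      finally show ?thesis using cA_Re[OF x] by simp
    qed
    have cp: "(\<lambda>g. cnj (p g)) \<in> Cc" by (rule Cc_cnj[OF p])
    have sn_p: "seminorm (\<lambda>g. cnj (p g)) \<le> cA"
    proof (rule seminorm_le[OF cp cA(1)])
      fix x assume x: "x \<in> units G"
      have "Psi G (\<lambda>g. of_real (cmod (cnj (p g)))) x = of_real (cmod (cnj (p x)))"
        by (rule Psi_unit_supported[OF _ x]) (simp add: p0)
      then show "Re (Psi G (\<lambda>g. of_real (cmod (cnj (p g)))) x) \<le> cA" using p_le[OF x] by simp
    qed
    have "L f = L (\<lambda>g. cnj (p g))" unfolding p_def by (rule const[OF f])
    then have "B h' f - B h' (\<lambda>g. cnj (p g)) = (L (\<lambda>g. cnj (p g)) - B h' (\<lambda>g. cnj (p g))) - (L f - B h' f)"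
      by simp
    also have "cmod \<dots> \<le> \<delta>' * cA + \<delta>' * cA"
    proof -
      have "cmod (L f - B h' f) \<le> \<delta>' * cA"
        using h'(2)[OF f] mult_left_mono[OF sn_f, of \<delta>'] d'(1) by linarith
      moreover have "cmod (L (\<lambda>g. cnj (p g)) - B h' (\<lambda>g. cnj (p g))) \<le> \<delta>' * cA"
        using h'(2)[OF cp] mult_left_mono[OF sn_p, of \<delta>'] d'(1) by linarith
      ultimately show ?thesis
        using norm_triangle_ineq4[of "L (\<lambda>g. cnj (p g)) - B h' (\<lambda>g. cnj (p g))" "L f - B h' f"] by linarith
    qed
    finally have 1: "cmod (B h' f - B h' (\<lambda>g. cnj (p g))) \<le> 2 * cA * \<delta>'" by (simp add: ac_simps)
    have cf: "(\<lambda>k. cnj (f k)) \<in> Cc" by (rule Cc_cnj[OF f])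
    \<comment> \<open>Constancy replaces \<open>f\<close> by a function on the units; inversion
      turns the resulting evaluation of \<open>v'\<close> at ranges into evaluation at
      sources.\<close>
    have 2: "B h' (\<lambda>g. cnj (p g)) = I (\<lambda>k. cnj (f k) * v' (src G k))"
    proof -
      have "B h' (\<lambda>g. cnj (p g)) = I (\<lambda>g. v' (rng G g) * star G f g)"
        unfolding B_def
      proof (rule I_cong)
        fix x assume x: "x \<in> units G"
        have "Psi G (\<lambda>g. cnj (cnj (p g)) * vphi h' g) x = p x * v' x"
          using Psi_unit_supported[of "\<lambda>g. cnj (cnj (p g)) * vphi h' g", OF _ x] p0 by (simp add: v'_def)
        then show "Psi G (\<lambda>g. cnj (cnj (p g)) * vphi h' g) x = Psi G (\<lambda>g. v' (rng G g) * star G f g) x"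
          by (simp add: Psi_rng_mult[OF x] p_def)
      qed
      also have "\<dots> = I (\<lambda>k. cnj (f k) * v' (src G k))"
        using I_ginv[OF Cc_mult[OF cf v's_cont]] by (simp add: star_def src_inv mult.commute)
      finally show ?thesis .
    qed
    have 3: "B h' f - B h' (\<lambda>g. cnj (p g)) = I (\<lambda>k. cnj (f k) * z k)"
    proof -
      have "I (\<lambda>k. cnj (f k) * z k) = I (\<lambda>k. cnj (f k) * v' k - cnj (f k) * v' (src G k))"
        by (simp add: z_def right_diff_distrib)
      also have "\<dots> = I (\<lambda>k. cnj (f k) * v' k) - I (\<lambda>k. cnj (f k) * v' (src G k))"
        by (intro I_diff Cc_mult cf v'_cont v's_cont)
      finally show ?thesis unfolding 2 by (simp add: B_def v'_def)
    qed
    have fz: "Re (cnj (f k) * z k) \<ge> \<alpha> k * cmod (z k) - \<alpha> k * \<delta>'" for k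
    proof -
      have "cnj (f k) * z k = of_real (\<alpha> k) * (z k * cnj (z k)) / of_real (cmod (z k) + \<delta>')"
        by (simp add: f_def)
      also have "\<dots> = of_real (\<alpha> k * ((cmod (z k))\<^sup>2 / (cmod (z k) + \<delta>')))"
        by (simp flip: complex_norm_square)
      finally have "Re (cnj (f k) * z k) = \<alpha> k * ((cmod (z k))\<^sup>2 / (cmod (z k) + \<delta>'))" by simp
      moreover have "cmod (z k) - \<delta>' \<le> (cmod (z k))\<^sup>2 / (cmod (z k) + \<delta>')"
        unfolding pos_le_divide_eq[OF nz(2)] by (simp add: algebra_simps power2_eq_square)
      then have "\<alpha> k * (cmod (z k) - \<delta>') \<le> \<alpha> k * ((cmod (z k))\<^sup>2 / (cmod (z k) + \<delta>'))"
        using alpha0 by (intro mult_left_mono)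
      ultimately show ?thesis by (simp add: right_diff_distrib)
    qed
    have ad_Cc: "(\<lambda>k. complex_of_real \<delta>' * of_real (\<alpha> k)) \<in> Cc" by (rule Cc_smult[OF alpha_Cc])
    have "Re (I (\<lambda>k. of_real (\<alpha> k) * of_real (cmod (z k))))
       \<le> Re (I (\<lambda>k. cnj (f k) * z k + of_real \<delta>' * of_real (\<alpha> k)))"
      using fz by (intro Re_I_mono az_Cc Cc_add Cc_mult cf z_cont ad_Cc) (simp add: algebra_simps)
    also have "\<dots> = Re (I (\<lambda>k. cnj (f k) * z k)) + \<delta>' * Re (I (\<lambda>k. of_real (\<alpha> k)))"
      by (subst I_add) (auto intro!: Cc_mult cf z_cont ad_Cc simp: I_smult)
    also have "Re (I (\<lambda>k. cnj (f k) * z k)) \<le> 2 * cA * \<delta>'"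
      using 1 3 complex_Re_le_cmod[of "I (\<lambda>k. cnj (f k) * z k)"] by simp
    also have "Re (I (\<lambda>k. of_real (\<alpha> k))) \<le> cA"
      using I_bound[OF alpha_Cc cA(2)] complex_Re_le_cmod[of "I (\<lambda>k. of_real (\<alpha> k))"] by simp
    finally show ?thesis using d'(1) by (simp add: algebra_simps)
  qed

  define w where "w = (\<lambda>x. h x - h' x)"
  have w: "w \<in> Cc" unfolding w_def by (intro Cc_diff h h')
  have vphi_w: "vphi w g = v g - v' g" for g
    unfolding w_def v_def v'_def by (rule conv_diff_left[OF h(1) h'(1)])
  \<comment> \<open>The fibre norm of \<open>h - h'\<close>. By \<open>vphi_le_fibre_form\<close> it
    dominates \<open>v - v'\<close> at every arrow with range \<open>x\<close>, not only at the
    unit.\<close>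
  define e where "e x = sqrt (fibre_form w x)" for x
  have q_cont: "continuous_on UNIV (fibre_form w)" unfolding fibre_form_def[abs_def]
    by (intro continuous_on_Re Cc_cont Psi_Cc form_Cc w)
  have e_cont: "continuous_on UNIV e" unfolding e_def[abs_def]
    by (intro continuous_intros q_cont)
  have q0: "0 \<le> fibre_form w x" for x
    using fibre_form_nonneg[OF w, of x] by (cases "x \<in> units G") (auto simp: fibre_form_def Psi_def)
  have e0: "0 \<le> e x" for x using q0 by (simp add: e_def)
  have v_v': "cmod (v g - v' g) \<le> e (rng G g)" for g
    using real_sqrt_le_mono[OF vphi_le_fibre_form[OF w, of g]] by (simp add: e_def vphi_w)
  define b where "b x = max 0 (cmod (v' x) - e x - \<delta>)" for x
  have b_cont: "continuous_on UNIV b" unfolding b_def[abs_def]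
    by (intro continuous_intros v'_cont e_cont)
  have b0: "0 \<le> b x" for x by (simp add: b_def)
  \<comment> \<open>\<open>M\<close> bounds \<open>v\<close> and was fixed before \<open>h'\<close>;
    no bound on \<open>v'\<close> independent of \<open>h'\<close> is at hand. Subtracting
    \<open>e\<close> is what brings \<open>b\<close> below \<open>M\<close>.\<close>
  have bM: "b x \<le> M" if x: "x \<in> units G" for x
  proof -
    have "cmod (v' x) \<le> cmod (v x) + cmod (v x - v' x)"
      using norm_triangle_ineq4[of "v x" "v x - v' x"] by simp
    moreover have "cmod (v x - v' x) \<le> e x" using v_v'[of x] x by (simp add: units_iff)
    ultimately show ?thesis using M(1) M(2)[OF x] d by (simp add: b_def)
  qed
  have brM: "b (rng G k) \<le> M" and bsM: "b (src G k) \<le> M" for k by (simp_all add: bM)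
  have br_cont: "continuous_on UNIV (\<lambda>k. complex_of_real (b (rng G k)))"
    by (intro continuous_intros continuous_on_compose2[OF b_cont continuous_rng]) auto
  have bs_cont: "continuous_on UNIV (\<lambda>k. complex_of_real (b (src G k)))"
    by (intro continuous_intros continuous_on_compose2[OF b_cont continuous_src]) auto

  have upper: "(LINT x|\<mu>. b x)\<^sup>2 \<le> M\<^sup>2 * C0 / real n + 3 * M * cA * \<delta>'"
  proof -
    \<comment> \<open>The value of \<open>b\<close> at \<open>src G k\<close> is sent to
      \<open>rng G k\<close> along the inverse of \<open>k\<close> with weight
      \<open>Q (ginv G k)\<close>. Summing over the range fibre gives the transported density
      \<open>Y\<close>.\<close>
    define W where "W k = star G Qc k * of_real (b (src G k))" for k
    have W: "W \<in> Cc" unfolding W_def[abs_def] by (intro Cc_mult Cc_star Qc bs_cont)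
    have W_real: "W k = of_real (Q (ginv G k) * b (src G k))" for k
      by (simp add: W_def star_def Qc_def)
    define Y where "Y x = Re (Psi G W x)" for x
    have PW: "Psi G W x = of_real (Y x)" for x
    proof -
      have "W = (\<lambda>k. of_real (Q (ginv G k) * b (src G k)))" using W_real by blast
      then show ?thesis
        unfolding Y_def using Psi_of_real[of "\<lambda>k. Q (ginv G k) * b (src G k)" x] by simp
    qed
    have Y_cont: "continuous_on UNIV Y" unfolding Y_def[abs_def]
      by (intro continuous_on_Re Cc_cont Psi_Cc W)
    have Yr_cont: "continuous_on UNIV (\<lambda>g. complex_of_real (Y (rng G g)))"
      by (intro continuous_intros continuous_on_compose2[OF Y_cont continuous_rng]) auto
    have LY: "(LINT x|\<mu>. Y x) = (LINT x|\<mu>. b x)"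
    proof -
      have "complex_of_real (LINT x|\<mu>. Y x) = I W"
        unfolding I_def PW by simp
      also have "\<dots> = I (\<lambda>k. W (ginv G k))" by (rule I_ginv[OF W, symmetric])
      also have "\<dots> = I (\<lambda>k. of_real (b (rng G k)) * Qc k)"
        by (simp add: W_def star_def src_inv Qc_def mult.commute)
      also have "\<dots> = (LINT x|\<mu>. complex_of_real (b x))"
        unfolding I_def
      proof (rule Bochner_Integration.integral_cong)
        fix x assume "x \<in> space \<mu>"
        then have x: "x \<in> units G" by (simp add: space_mu)
        show "Psi G (\<lambda>k. of_real (b (rng G k)) * Qc k) x = complex_of_real (b x)"
          using Psi_rng_mult[OF x, of "\<lambda>y. of_real (b y)" Qc] Q(4)[OF x] by (simp add: Qc_def)
      qed simp
      finally show ?thesis by (simp only: integral_complex_of_real of_real_eq_iff)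
    qed
    \<comment> \<open>One factor \<open>Y\<close> is kept while the other is unfolded; after
      inversion the double sum becomes the convolution of \<open>Qc\<close> with \<open>W\<close>.
      Its value at \<open>k\<close> contains the overlap \<open>\<alpha> k\<close>, because all
      terms share the source of \<open>k\<close>.\<close>
    have sq: "complex_of_real (LINT x|\<mu>. (Y x)\<^sup>2) = I (\<lambda>k. of_real (b (rng G k)) * (of_real (\<alpha> k) * of_real (b (src G k))))"
    proof -
      have "complex_of_real (LINT x|\<mu>. (Y x)\<^sup>2) = (LINT x|\<mu>. complex_of_real ((Y x)\<^sup>2))"
        by (rule integral_complex_of_real[symmetric])
      also have "\<dots> = I (\<lambda>g. of_real (Y (rng G g)) * W g)"
        unfolding I_def
      proof (rule Bochner_Integration.integral_cong)
        fix x assume "x \<in> space \<mu>"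
        then have x: "x \<in> units G" by (simp add: space_mu)
        show "complex_of_real ((Y x)\<^sup>2) = Psi G (\<lambda>g. of_real (Y (rng G g)) * W g) x"
          using Psi_rng_mult[OF x, of "\<lambda>y. of_real (Y y)" W] by (simp add: PW power2_eq_square)
      qed simp
      also have "\<dots> = I (\<lambda>g. of_real (Y (rng G (ginv G g))) * W (ginv G g))"
        by (rule I_ginv[OF Cc_mult2[OF W Yr_cont], symmetric])
      also have "\<dots> = I (\<lambda>k. of_real (b (rng G k)) * conv G Qc W k)"
      proof (rule I_cong)
        fix x assume x: "x \<in> units G"
        then have rx: "rng G x = x" by (simp add: units_iff)
        have "Psi G (\<lambda>k. of_real (b (rng G k)) * conv G Qc W k) x = of_real (b x) * conv G (conv G Qc W) (\<lambda>_. 1) x"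
          using Psi_rng_mult[OF x, of "\<lambda>y. of_real (b y)" "conv G Qc W"] by (simp add: conv_one_right rx Psi_eq[OF x])
        also have "conv G (conv G Qc W) (\<lambda>_. 1) x = conv G Qc (conv G W (\<lambda>_. 1)) x"
          by (rule conv_assoc[OF Qc W])
        also have "\<dots> = (\<Sum>\<^sub>\<infinity>g\<in>rfibre G x. Qc g * of_real (Y (src G g)))"
          unfolding conv_eq[of Qc] rx
        proof (rule infsum_cong)
          fix g assume "g \<in> rfibre G x"
          then have "rng G g = rng G x" by (simp add: rfibre_def rx)
          from rng_ldiv[OF this]
          show "Qc g * conv G W (\<lambda>_. 1) (ldiv g x) = Qc g * of_real (Y (src G g))"
            by (simp add: conv_one_right PW flip: Psi_eq)
        qed
        also have "of_real (b x) * \<dots> = (\<Sum>\<^sub>\<infinity>g\<in>rfibre G x. of_real (b x) * (Qc g * of_real (Y (src G g))))"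
          by (rule infsum_cmult_right'[symmetric])
        also have "\<dots> = Psi G (\<lambda>g. of_real (Y (rng G (ginv G g))) * W (ginv G g)) x"
          unfolding Psi_eq[OF x]
          by (intro infsum_cong) (simp add: rfibre_def W_def star_def Qc_def src_inv rng_inv)
        finally show "Psi G (\<lambda>g. of_real (Y (rng G (ginv G g))) * W (ginv G g)) x
          = Psi G (\<lambda>k. of_real (b (rng G k)) * conv G Qc W k) x" by simp
      qed
      also have "conv G Qc W = (\<lambda>k. of_real (\<alpha> k) * of_real (b (src G k)))"
      proof
        fix k
        have "conv G Qc W k = (\<Sum>\<^sub>\<infinity>g\<in>rfibre G (rng G k). Qc g * star G Qc (ldiv g k) * of_real (b (src G k)))"
          unfolding conv_eq by (intro infsum_cong) (simp add: rfibre_def W_def src_ldiv)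
        also have "\<dots> = A k * of_real (b (src G k))"
          unfolding A_def conv_eq by (rule infsum_cmult_left')
        finally show "conv G Qc W k = of_real (\<alpha> k) * of_real (b (src G k))" by (simp add: A_alpha)
      qed
      finally show ?thesis .
    qed
    define T where "T = (\<lambda>k. of_real (M\<^sup>2 / real n) * complex_of_real (cutoff R k))"
    define T1 where "T1 = (\<lambda>k. of_real (M / 2) * (complex_of_real (\<alpha> k) * of_real (cmod (z k))))"
    define T2 where "T2 = (\<lambda>k. of_real (M / 2) * (complex_of_real (\<alpha> (ginv G k)) * of_real (cmod (z (ginv G k)))))"
    have T: "T \<in> Cc" "T1 \<in> Cc" "T2 \<in> Cc" unfolding T_def T1_def T2_def
      by (intro Cc_smult cutoff_Cc az_Cc Cc_ginv[OF az_Cc])+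
    \<comment> \<open>Where \<open>F\<close> is at most \<open>R\<close>, the bound
      \<open>1 / n\<close> on \<open>\<alpha>\<close> suffices. Elsewhere the matrix coefficients of
      \<open>h\<close> are small, so the product of the two values of \<open>b\<close> is controlled
      by the defect of constancy.\<close>
    have ptw: "b (rng G k) * (\<alpha> k * b (src G k)) \<le> M\<^sup>2 / real n * cutoff R k
        + M / 2 * (\<alpha> k * cmod (z k)) + M / 2 * (\<alpha> k * cmod (z (ginv G k)))" for k
    proof (cases "F k \<le> R")
      case True
      have "b (rng G k) * (\<alpha> k * b (src G k)) \<le> M * (1 / real n * M)"
        using b0 brM bsM alpha0 alpha1 M(1) by (intro mult_mono) auto
      also have "\<dots> = M\<^sup>2 / real n * cutoff R k" using True by (simp add: cutoff_eq_1 power2_eq_square)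
      finally show ?thesis using M(1) alpha0[of k]
        by (smt (verit, ccfv_SIG) divide_nonneg_nonneg mult_nonneg_nonneg norm_ge_zero)
    next
      case False
      have bb: "b (rng G k) * b (src G k) \<le> M / 2 * (cmod (z k) + cmod (z (ginv G k)))"
      proof (cases "b (rng G k) = 0 \<or> b (src G k) = 0")
        case True
        then show ?thesis using M(1) by auto
      next
        case nz: False
        have vk: "cmod (v k) \<le> \<delta>" "cmod (v (ginv G k)) \<le> \<delta>" using R False F_ginv by auto
        have est: "cmod (v' (src G l)) \<le> cmod (z l) + e (rng G l) + \<delta>" if "cmod (v l) \<le> \<delta>" for l
        proof -
          have "v' (src G l) = v l - (v l - v' l) - z l" by (simp add: z_def)
          then have "cmod (v' (src G l)) \<le> cmod (v l) + cmod (v l - v' l) + cmod (z l)"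
            by (metis norm_triangle_ineq4 add_right_mono order_trans)
          then show ?thesis using that v_v'[of l] by linarith
        qed
        \<comment> \<open>Applied to \<open>k\<close> and to its inverse, \<open>est\<close>
          contributes \<open>e\<close> at the opposite end of the arrow. In the sum these terms
          cancel those subtracted in \<open>b\<close>.\<close>
        have "b (rng G k) + b (src G k) \<le> cmod (z k) + cmod (z (ginv G k))"
          using nz est[OF vk(1)] est[OF vk(2)] by (auto simp: b_def max_def src_inv rng_inv split: if_splits)
        then have "M / 2 * (b (rng G k) + b (src G k)) \<le> M / 2 * (cmod (z k) + cmod (z (ginv G k)))"
          using M(1) by (intro mult_left_mono) auto
        moreover have "b (rng G k) * b (src G k) \<le> M * b (src G k)" "b (rng G k) * b (src G k) \<le> b (rng G k) * M"
          using b0 brM bsM by (auto intro: mult_right_mono mult_left_mono)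
        ultimately show ?thesis by (simp add: algebra_simps)
      qed
      have "\<alpha> k * (b (rng G k) * b (src G k)) \<le> \<alpha> k * (M / 2 * (cmod (z k) + cmod (z (ginv G k))))"
        by (rule mult_left_mono[OF bb alpha0])
      moreover have "0 \<le> M\<^sup>2 / real n * cutoff R k" by simp
      moreover have "\<alpha> k * (M / 2 * (cmod (z k) + cmod (z (ginv G k))))
        = M / 2 * (\<alpha> k * cmod (z k)) + M / 2 * (\<alpha> k * cmod (z (ginv G k)))"
        by (simp add: algebra_simps)
      moreover have "b (rng G k) * (\<alpha> k * b (src G k)) = \<alpha> k * (b (rng G k) * b (src G k))"
        by (simp only: ac_simps)
      ultimately show ?thesis by linarith
    qed
    have "(LINT x|\<mu>. b x)\<^sup>2 \<le> (LINT x|\<mu>. (Y x)\<^sup>2)"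
      using integral_square_le[OF Y_cont] by (simp add: LY)
    also have "\<dots> = Re (I (\<lambda>k. of_real (b (rng G k)) * (of_real (\<alpha> k) * of_real (b (src G k)))))"
      using sq by (metis Re_complex_of_real)
    also have "\<dots> \<le> Re (I (\<lambda>k. (T k + T1 k) + T2 k))"
    proof (rule Re_I_mono)
      show "(\<lambda>k. of_real (b (rng G k)) * (complex_of_real (\<alpha> k) * of_real (b (src G k)))) \<in> Cc"
        by (rule Cc_mult2[OF Cc_mult[OF alpha_Cc bs_cont] br_cont])
      show "(\<lambda>k. (T k + T1 k) + T2 k) \<in> Cc" by (rule Cc_add[OF Cc_add[OF T(1,2)] T(3)])
      show "Re (of_real (b (rng G k)) * (complex_of_real (\<alpha> k) * of_real (b (src G k))))
        \<le> Re ((T k + T1 k) + T2 k)" for k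
        using ptw[of k] by (simp add: T_def T1_def T2_def alpha_ginv)
    qed
    also have "\<dots> = Re (I T) + Re (I T1) + Re (I T2)" using T by (simp add: I_add Cc_add)
    also have "I T2 = I T1" using I_ginv[OF T(2)] by (simp add: T1_def T2_def)
    also have "Re (I T) \<le> M\<^sup>2 * C0 / real n"
    proof -
      have "Re (I (\<lambda>g. complex_of_real (cutoff R g))) \<le> C0"
        using I_bound[OF cutoff_Cc C0(2)] complex_Re_le_cmod[of "I (\<lambda>g. complex_of_real (cutoff R g))"] by simp
      then have "M\<^sup>2 / real n * Re (I (\<lambda>g. complex_of_real (cutoff R g))) \<le> M\<^sup>2 / real n * C0"
        by (intro mult_left_mono) auto
      then show ?thesis unfolding T_def I_smult by simp
    qed
    also have "Re (I T1) \<le> M / 2 * (3 * cA * \<delta>')"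
      using mult_left_mono[OF small, of "M / 2"] M(1) unfolding T1_def I_smult by simp
    finally show ?thesis by (simp add: algebra_simps)
  qed

  have lower: "c / 2 \<le> (LINT x|\<mu>. b x)"
  proof -
    have one: "cmod (L (conv_one G) - B h' (conv_one G)) \<le> \<delta>'"
    proof -
      have "seminorm (conv_one G) \<le> 1"
      proof (rule seminorm_le[OF conv_one_Cc])
        fix x assume x: "x \<in> units G"
        show "Re (Psi G (\<lambda>g. of_real (cmod (conv_one G g))) x) \<le> 1"
          using Psi_unit_supported[of "\<lambda>g. of_real (cmod (conv_one G g))", OF _ x] x by (simp add: conv_one_def)
      qed simp
      then have "\<delta>' * seminorm (conv_one G) \<le> \<delta>' * 1" using d'(1) by (intro mult_left_mono) auto
      then show ?thesis using h'(2)[OF conv_one_Cc] by linarith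
    qed
    have "B h' (conv_one G) = (LINT x|\<mu>. cnj (conv_one G x) * v' x)"
      unfolding B_def v'_def by (rule I_unit_supported) (simp add: conv_one_def)
    also have "\<dots> = (LINT x|\<mu>. v' x)"
      by (rule Bochner_Integration.integral_cong) (simp_all add: space_mu conv_one_def)
    finally have "cmod (B h' (conv_one G)) \<le> (LINT x|\<mu>. cmod (v' x))"
      by (simp add: integral_norm_bound)
    then have 1: "c - \<delta>' \<le> (LINT x|\<mu>. cmod (v' x))"
      using one norm_triangle_ineq2[of "L (conv_one G)" "B h' (conv_one G)"] by (simp add: c_def)
    \<comment> \<open>The mean of \<open>e\<close> is at most the norm of \<open>h - h'\<close>, and
      both functions approximate \<open>L\<close>.\<close>
    have 2: "(LINT x|\<mu>. e x) \<le> \<delta> + \<delta>'"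
    proof -
      have "(LINT x|\<mu>. e x)\<^sup>2 \<le> (LINT x|\<mu>. (e x)\<^sup>2)" by (rule integral_square_le[OF e_cont])
      also have "\<dots> = (LINT x|\<mu>. fibre_form w x)" using q0 by (simp add: e_def)
      also have "\<dots> = Re (B w w)" unfolding B_def I_def fibre_form_def
        by (rule integral_Re) (rule integrable_Psi[OF form_Cc[OF w w]])
      also have "\<dots> = (seminorm w)\<^sup>2" using w by (simp add: seminorm_sq)
      finally have "(LINT x|\<mu>. e x) \<le> seminorm w" using seminorm_nonneg[OF w] by (rule power2_le_imp_le)
      also have "\<dots> \<le> \<bar>\<delta>\<bar> + \<bar>\<delta>'\<bar>"
        unfolding w_def by (rule seminorm_diff_le[OF h(1) h'(1) h(2) h'(2)])
      finally show ?thesis using d d'(1) by simp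
    qed
    interpret prob_space \<mu> by (rule prob_space_mu)
    have "(LINT x|\<mu>. cmod (v' x)) - (LINT x|\<mu>. e x) - \<delta> = (LINT x|\<mu>. cmod (v' x) - e x - \<delta>)"
      using integrable_units[OF continuous_on_norm[OF v'_cont]] integrable_units[OF e_cont]
      by (simp add: prob_space)
    also have "\<dots> \<le> (LINT x|\<mu>. b x)"
      by (intro integral_mono integrable_units continuous_intros v'_cont e_cont b_cont) (simp add: b_def)
    finally show ?thesis using 1 2 d'(2) by (simp add: \<delta>_def)
  qed
  have "(c / 2)\<^sup>2 \<le> (LINT x|\<mu>. b x)\<^sup>2" using lower c by (intro power_mono) auto
  moreover have "(c / 2)\<^sup>2 = c\<^sup>2 / 4" by (simp add: power_divide)
  moreover have "0 < c\<^sup>2" using c by simp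
  ultimately show False using upper n(2) d'' by linarith
qed

section \<open>The unit vector of \<open>conv_one\<close> as a test vector for property (T)\<close>

lemma seminorm_conv_one: "seminorm (conv_one G) = 1"
proof -
  interpret prob_space \<mu> by (rule prob_space_mu)
  have "B (conv_one G) (conv_one G) = (LINT x|\<mu>. cnj (conv_one G x) * vphi (conv_one G) x)"
    unfolding B_def by (rule I_unit_supported) (simp add: conv_one_def)
  also have "\<dots> = (LINT x|\<mu>. 1)"
    by (rule Bochner_Integration.integral_cong) (simp_all add: space_mu conv_one_left phi_unit conv_one_def)
  finally show ?thesis by (simp add: seminorm_def prob_space)
qed

text \<open>Evaluating the constancy equation for \<open>star G f\<close> at \<open>conv_one\<close>
  turns it into the functional equation of \<open>constant_functional_zero\<close>, and evaluation
  at \<open>conv_one\<close> is the inner product with \<open>embed (conv_one G)\<close>.\<close>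

lemma embed_one_nonconstant:
  assumes inf: "\<And>x. x \<in> units G \<Longrightarrow> infinite (rfibre G x)"
  shows "embed (conv_one G) \<in> nonconstant_part G hilb rep"
proof -
  have "ip_lim (embed (conv_one G)) \<eta> = 0" if \<eta>: "\<eta> \<in> constant_vectors G hilb rep" for \<eta>
  proof -
    have \<eta>_in: "\<eta> \<in> completion" using \<eta> by (simp add: constant_vectors_def)
    have "\<eta> (conv_one G) = 0"
    proof (rule constant_functional_zero[OF inf \<eta>_in])
      fix f :: "'g \<Rightarrow> complex" assume f: "f \<in> Cc"
      have "rep (star G f) \<eta> = rep (Psi G (star G f)) \<eta>"
        using \<eta> Cc_star[OF f] unfolding constant_vectors_def by blast
      then have "rep (star G f) \<eta> (conv_one G) = rep (Psi G (star G f)) \<eta> (conv_one G)" by simp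
      then have "\<eta> f = \<eta> (star G (Psi G (star G f)))"
        by (simp add: rep_def conv_one_Cc conv_one_right_unit)
      also have "star G (Psi G (star G f)) = (\<lambda>g. cnj (Psi G (star G f) g))"
        by (rule star_unit_supported) (simp add: Psi_def)
      finally show "\<eta> f = \<eta> (\<lambda>g. cnj (Psi G (star G f) g))" .
    qed
    then show ?thesis
      using ip_commute'[OF \<eta>_in embed_in[OF conv_one_Cc]] ip_embed[OF conv_one_Cc \<eta>_in] by simp
  qed
  then show ?thesis by (simp add: nonconstant_part_def embed_in conv_one_Cc)
qed

text \<open>A real supremum dominates its family only if the family is bounded above. Here the fibre
  sums are values of a continuous function on the compact unit space.\<close>

lemma rfibre_sum_le_I_norm:
  assumes f: "f \<in> Cc" and x: "x \<in> units G"
  shows "(\<Sum>\<^sub>\<infinity>g\<in>rfibre G x. cmod (f g)) \<le> I_norm G f"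
proof -
  have eq: "(\<Sum>\<^sub>\<infinity>g\<in>rfibre G y. cmod (f g)) = Re (Psi G (\<lambda>g. of_real (cmod (f g))) y)" if "y \<in> units G" for y
    using infsum_Re[OF summable_rfibre[OF Cc_norm[OF f]], of y] that by (simp add: Psi_def)
  obtain C where C: "\<And>y. y \<in> units G \<Longrightarrow> cmod (Psi G (\<lambda>g. of_real (cmod (f g))) y) \<le> C"
    using units_bounded[OF Cc_cont[OF Psi_Cc[OF Cc_norm[OF f]]]] by blast
  have "bdd_above ((\<lambda>y. \<Sum>\<^sub>\<infinity>g\<in>rfibre G y. cmod (f g)) ` units G)"
  proof (rule bdd_aboveI2)
    fix y assume y: "y \<in> units G"
    show "(\<Sum>\<^sub>\<infinity>g\<in>rfibre G y. cmod (f g)) \<le> C"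
      unfolding eq[OF y] using C[OF y] complex_Re_le_cmod order_trans by blast
  qed
  from cSUP_upper[OF x this] show ?thesis unfolding I_norm_def by simp
qed

text \<open>On each range fibre \<open>Psi G f\<close> places the total mass of \<open>f\<close> at
  the unit. In the form of the difference only mixed differences of the kernel against the unit
  remain. They are linear in \<open>t * M\<close>, since \<open>1 - exp (- s) \<le> s\<close>, and
  the coefficients have absolute sum at most 1.\<close>

lemma almost_constant:
  assumes f: "f \<in> Cc" and K: "supp f \<subseteq> K" and M: "0 \<le> M" "\<And>g. g \<in> K \<Longrightarrow> F g \<le> M"
    and norm: "I_norm G f \<le> 1"
  shows "(seminorm (\<lambda>g. f g - Psi G f g))\<^sup>2 \<le> 12 * t * M"
proof -
  define a where "a = (\<lambda>g. f g - Psi G f g)"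
  have a: "a \<in> Cc" unfolding a_def by (intro Cc_diff Psi_Cc f)
  have bound: "cmod (Psi G (\<lambda>g. cnj (a g) * vphi a g) x) \<le> 12 * t * M" if x: "x \<in> units G" for x
  proof -
    have rx: "rng G x = x" using x by (simp add: units_iff)
    define T where "T = insert x {g \<in> rfibre G x. f g \<noteq> 0}"
    have T: "finite T" "T \<subseteq> rfibre G x" "x \<in> T"
      using finite_rfibre[OF f] rx by (auto simp: T_def rfibre_def)
    define S where "S = Psi G f x"
    have a_T: "a i = f i - (if i = x then S else 0)" if "i \<in> rfibre G x" for i
      using that x by (auto simp: a_def S_def rfibre_def units_iff Psi_def)
    have S_sum: "S = (\<Sum>j\<in>T. f j)"
    proof -
      have "S = infsum f T" unfolding S_def Psi_eq[OF x]
        by (rule infsum_cong_neutral) (use T in \<open>auto simp: T_def\<close>)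
      then show ?thesis using T by simp
    qed
    define \<kappa> where "\<kappa> i j = complex_of_real (phi (ldiv i j))" for i j
    have ex: "(\<Sum>j\<in>T. (if j = x then y else 0) * h j) = y * h x" for h and y :: complex
      using T by (simp add: if_distrib[of "\<lambda>x. x * _"] cong: if_cong)
    define y where "y i = (\<Sum>j\<in>T. f j * (\<kappa> i j - \<kappa> i x))" for i
    have inner: "(\<Sum>j\<in>T. a j * \<kappa> i j) = y i" for i
    proof -
      have "(\<Sum>j\<in>T. a j * \<kappa> i j) = (\<Sum>j\<in>T. f j * \<kappa> i j - (if j = x then S else 0) * \<kappa> i j)"
        using T(2) by (intro sum.cong refl) (auto simp: a_T left_diff_distrib)
      also have "\<dots> = (\<Sum>j\<in>T. f j * \<kappa> i j) - S * \<kappa> i x"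
        by (simp only: sum_subtractf ex)
      also have "\<dots> = y i"
        by (simp add: y_def S_sum right_diff_distrib sum_subtractf sum_distrib_right)
      finally show ?thesis .
    qed
    have "Psi G (\<lambda>g. cnj (a g) * vphi a g) x = (\<Sum>i\<in>T. \<Sum>j\<in>T. cnj (a i) * a j * \<kappa> i j)"
      unfolding \<kappa>_def
      by (rule form_sum[OF T(1,2) _ x]) (use a_T T in \<open>auto simp: T_def\<close>)
    also have "\<dots> = (\<Sum>i\<in>T. cnj (a i) * y i)"
      by (simp add: sum_distrib_left mult.assoc flip: inner)
    also have "\<dots> = (\<Sum>i\<in>T. cnj (f i) * y i - (if i = x then cnj S else 0) * y i)"
      using T(2) by (intro sum.cong refl) (auto simp: a_T left_diff_distrib)
    also have "\<dots> = (\<Sum>i\<in>T. cnj (f i) * y i) - cnj S * y x"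
      by (simp only: sum_subtractf ex)
    also have "\<dots> = (\<Sum>i\<in>T. cnj (f i) * (y i - y x))"
      by (simp add: S_sum right_diff_distrib sum_subtractf sum_distrib_right)
    also have "\<dots> = (\<Sum>i\<in>T. \<Sum>j\<in>T. cnj (f i) * f j * (\<kappa> i j - \<kappa> i x - \<kappa> x j + \<kappa> x x))"
      by (simp add: y_def sum_distrib_left mult.assoc algebra_simps flip: sum_subtractf)
    also have "cmod \<dots> \<le> (\<Sum>i\<in>T. \<Sum>j\<in>T. cmod (f i) * cmod (f j) * (12 * t * M))"
    proof (intro sum_norm_le)
      fix i j assume ij: "i \<in> T" "j \<in> T"
      then have r: "rng G i = x" "rng G j = x" using T(2) by (auto simp: rfibre_def)
      show "cmod (cnj (f i) * f j * (\<kappa> i j - \<kappa> i x - \<kappa> x j + \<kappa> x x))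
        \<le> cmod (f i) * cmod (f j) * (12 * t * M)"
      proof (cases "f i = 0 \<or> f j = 0")
        case False
        then have "i \<in> K" "j \<in> K" using supp_zero K by blast+
        then have Fij: "F i \<le> M" "F j \<le> M" using M by auto
        have phi1: "1 - t * F g \<le> phi g" "phi g \<le> 1" for g
          using exp_ge_add_one_self[of "- t * F g"] t_pos F_nonneg[of g] by (auto simp: phi_def)
        have tF: "t * F g \<le> t * N" if "F g \<le> N" for g N
          using that t_pos by (intro mult_left_mono) auto
        have "F (ldiv i j) \<le> 4 * M" using F_ldiv_le[of i j] r Fij by simp
        then have "1 - 4 * t * M \<le> phi (ldiv i j)" using phi1(1)[of "ldiv i j"] tF by fastforce
        moreover have "1 - t * M \<le> phi i" "1 - t * M \<le> phi j"
          using phi1(1)[of i] phi1(1)[of j] tF Fij by fastforce+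
        moreover have "phi (ldiv i j) \<le> 1" "phi i \<le> 1" "phi j \<le> 1" by (rule phi1(2))+
        moreover have "0 \<le> t * M" using t_pos M(1) by simp
        \<comment> \<open>The combination lies between \<open>- 4 * t * M\<close> and
          \<open>2 * t * M\<close>.\<close>
        ultimately have "\<bar>phi (ldiv i j) - phi i - phi j + 1\<bar> \<le> 12 * t * M" by linarith
        moreover have "\<kappa> i j - \<kappa> i x - \<kappa> x j + \<kappa> x x = of_real (phi (ldiv i j) - phi i - phi j + 1)"
        proof -
          have "phi (ldiv x j) = phi j" using ldiv_unit[OF x r(2)] by simp
          moreover have "phi (ldiv i x) = phi i"
            using phi_ldiv[of i x] ldiv_unit[OF x r(1)] r rx by simp
          moreover have "phi (ldiv x x) = 1" by (simp add: ldiv_self phi_unit)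
          ultimately show ?thesis by (simp add: \<kappa>_def)
        qed
        ultimately have "cmod (\<kappa> i j - \<kappa> i x - \<kappa> x j + \<kappa> x x) \<le> 12 * t * M"
          by (simp only: norm_of_real)
        then show ?thesis unfolding norm_mult complex_mod_cnj by (intro mult_left_mono) auto
      qed auto
    qed
    also have "\<dots> = (\<Sum>i\<in>T. cmod (f i)) * (\<Sum>i\<in>T. cmod (f i)) * (12 * t * M)"
      unfolding sum_product by (simp add: sum_distrib_right)
    also have "\<dots> \<le> 1 * 1 * (12 * t * M)"
    proof -
      have "(\<Sum>i\<in>T. cmod (f i)) = (\<Sum>\<^sub>\<infinity>g\<in>T. cmod (f g))" using T by simp
      also have "\<dots> = (\<Sum>\<^sub>\<infinity>g\<in>rfibre G x. cmod (f g))"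
        by (rule infsum_cong_neutral) (use T in \<open>auto simp: T_def\<close>)
      also have "\<dots> \<le> 1" using rfibre_sum_le_I_norm[OF f x] norm by simp
      finally have "(\<Sum>i\<in>T. cmod (f i)) \<le> 1" .
      then show ?thesis using t_pos M(1) by (intro mult_right_mono mult_mono sum_nonneg) auto
    qed
    finally show ?thesis by simp
  qed
  have "(seminorm a)\<^sup>2 \<le> cmod (B a a)" using complex_Re_le_cmod[of "B a a"] a by (simp add: seminorm_sq)
  also have "\<dots> \<le> 12 * t * M" unfolding B_def by (rule I_bound[OF form_Cc[OF a a] bound])
  finally show ?thesis by (simp add: a_def)
qed

end

section \<open>The contradiction with property (T)\<close>

theorem theorem6p6:
  fixes G :: "'g::t2_space groupoid" and \<mu> :: "'g measure"
  assumes "etale_groupoid G"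
    and "locally compact (UNIV :: 'g set)"
    and "compact (units G)"
    and "a_T_menable G"
    and "property_T G"
    and "invariant_probability G \<mu>"
  shows "\<not> large G"
proof
  assume large: "large G"
  obtain F :: "'g \<Rightarrow> real" where F: "range F \<subseteq> {0..}" "continuous_on UNIV F"
      "\<forall>C\<subseteq>{0..}. compact C \<longrightarrow> compact (F -` C)" "negative_type G F"
    using assms(4) by (auto simp: a_T_menable_def)
  interpret etale_groupoid G by (rule assms(1))
  interpret proper_negative_type G \<mu> F
    by unfold_locales (use assms F in auto)
  \<comment> \<open>A finite fibre is compact, and removing it removes \<open>x\<close> from the
    range.\<close>
  have inf: "infinite (rfibre G x)" if x: "x \<in> units G" for x
  proof
    assume "finite (rfibre G x)"
    then have "rng G ` (UNIV - rfibre G x) = units G"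
      using large by (simp add: large_def finite_imp_compact)
    then have "x \<in> rng G ` (UNIV - rfibre G x)" using x by simp
    then obtain g where "g \<notin> rfibre G x" "rng G g = x" by blast
    then show False by (simp add: rfibre_def)
  qed
  obtain K c where K: "compact K" and c: "0 < c"
    and T: "\<And>(H :: (('g \<Rightarrow> complex) \<Rightarrow> complex) hilbert) \<pi> \<xi>.
      groupoid_representation G H \<pi> \<Longrightarrow> \<xi> \<in> nonconstant_part G H \<pi> \<Longrightarrow>
      \<exists>f\<in>Cc. supp f \<subseteq> K \<and> I_norm G f \<le> 1 \<and>
        hnorm H (\<pi> f \<xi> \<ominus>\<^bsub>H\<^esub> \<pi> (Psi G f) \<xi>) \<ge> c * hnorm H \<xi>"
    using assms(5) unfolding property_T_def by blast
  have "bounded (F ` K)"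
    by (intro compact_imp_bounded compact_continuous_image K continuous_on_subset[OF F(2)]) simp
  then obtain M0 where M0: "\<And>g. g \<in> K \<Longrightarrow> F g \<le> M0"
    by (auto simp: bounded_iff) (metis abs_le_D1)
  define M where "M = max 0 M0"
  have M: "0 \<le> M" "\<And>g. g \<in> K \<Longrightarrow> F g \<le> M" using M0 by (auto simp: M_def max.coboundedI2)
  \<comment> \<open>\<open>12 * t * M\<close> equals \<open>c\<^sup>2 * M / (M + 1)\<close>,
    strictly below \<open>c\<^sup>2\<close>. This choice is possible because \<open>K\<close> and
    \<open>c\<close> are given before the representation.\<close>
  define t where "t = c\<^sup>2 / (12 * (M + 1))"
  have t: "0 < t" using c M by (simp add: t_def)
  have tM: "12 * t * M < c\<^sup>2" using c M by (simp add: t_def field_simps)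
  interpret schoenberg G \<mu> F t by unfold_locales (rule t)
  let ?\<xi> = "embed (conv_one G)"
  obtain f where f: "f \<in> Cc" "supp f \<subseteq> K" "I_norm G f \<le> 1"
      "c * hnorm hilb ?\<xi> \<le> hnorm hilb (rep f ?\<xi> \<ominus>\<^bsub>hilb\<^esub> rep (Psi G f) ?\<xi>)"
    using T[OF groupoid_representation_hilb embed_one_nonconstant[OF inf]] by blast
  have d: "(\<lambda>g. f g - Psi G f g) \<in> Cc" by (intro Cc_diff Psi_Cc f)
  have "rep f ?\<xi> \<ominus>\<^bsub>hilb\<^esub> rep (Psi G f) ?\<xi> = (\<lambda>a. embed f a - embed (Psi G f) a)"
    by (simp add: rep_embed f Psi_Cc conv_one_Cc conv_one_right_unit minus_hilb embed_in)
  also have "\<dots> = embed (\<lambda>g. f g - Psi G f g)"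
    by (rule ext) (simp add: embed_def B_diff f Psi_Cc)
  finally have "c \<le> seminorm (\<lambda>g. f g - Psi G f g)"
    using f(4) by (simp add: hnorm_embed conv_one_Cc seminorm_conv_one d)
  then have "c\<^sup>2 \<le> (seminorm (\<lambda>g. f g - Psi G f g))\<^sup>2" using c by (intro power_mono) auto
  also have "\<dots> \<le> 12 * t * M" by (rule almost_constant[OF f(1,2) M f(3)])
  finally show False using tM by simp
qed

end
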